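(* Let $\mathcal{M}\subset\mathcal{L}$ be the submanifold (space of leaves) associated with a smooth foliation of $\mathbb{H}^3$ by oriented geodesics, given by the unit vector field $V$. Then (a) the foliation is semi-nondegenerate if and only if $\mathcal{M}$ is semidefinite; (b) the foliation is nondegenerate if and only if $g_\times$ induces on $\mathcal{M}$ a definite metric.
   Context: $\mathbb{H}^3$ is the oriented three-dimensional hyperbolic space of curvature $-1$ with cross product $\times$. $\mathcal{L}$ is the smooth 4-manifold of complete oriented geodesics of $\mathbb{H}^3$. For a unit speed geodesic $\gamma$, $\mathcal{J}_\gamma$ is the space of Jacobi fields along $\gamma$ orthogonal to $\dot\gamma$ and $T_\gamma:\mathcal{J}_\gamma\to T_{[\gamma]}\mathcal{L}$, $T_\gamma(J)=\frac{d}{dt}\big|_0[\gamma_t]$ (variation by unit speed geodesics with variation field $J$), is a linear isomorphism. The metrics $g_\times,g_K$ of signature $(2,2)$ on $\mathcal{L}$ have square norms $\|T_\gamma(J)\|_\times=\langle\dot\gamma\times J,J'\rangle$, $\|T_\gamma(J)\|_K=|J|^2-|J'|^2$. A smooth foliation of $\mathbb{H}^3$ by oriented geodesics is given by a smooth unit vector field $V$ whose integral curves are geodesics; its space of leaves $\mathcal{M}$ is a closed connected 2-dimensional submanifold of $\mathcal{L}$. $\mathbb{H}^3(\infty)$ is the sphere at infinity (classes of asymptotic geodesics, two unit speed geodesics being asymptotic if $d(\gamma(s),\sigma(s))$ is bounded for $s\ge0$), and $\varphi^\pm:\mathcal{L}\to\mathbb{H}^3(\infty)$, $\varphi^\pm([\gamma])=\gamma(\pm\infty)$,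 are the forward/backward Gauss maps. The foliation is semi-nondegenerate if $\varphi^\pm|_{\mathcal{M}}:\mathcal{M}\to\mathbb{H}^3(\infty)$ are both local diffeomorphisms; it is nondegenerate if for every $p$ the only eigenvectors of the endomorphism $X\mapsto\nabla_XV$ of $T_p\mathbb{H}^3$ lie in $\mathbb{R}V(p)$. A submanifold $\mathcal{M}\subset\mathcal{L}$ is semidefinite if for every nonzero $X\in T\mathcal{M}$, $\|X\|_\times=0$ implies $\|X\|_K>0$. *)

theory Defs
  imports "HOL-Analysis.Analysis"
begin

text \<open>Concrete model: H^3 is the upper sheet of the hyperboloid in Minkowski space R^{1,3}
  (type real^4, coordinate 1 is the time coordinate).\<close>

definition lor :: "real^4 \<Rightarrow> real^4 \<Rightarrow> real" where
  "lor x y = - (x$1 * y$1) + x$2 * y$2 + x$3 * y$3 + x$4 * y$4"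

definition H3 :: "(real^4) set" where
  "H3 = {p. lor p p = -1 \<and> p$1 > 0}"

definition tang :: "real^4 \<Rightarrow> real^4 \<Rightarrow> real^4" where
  "tang p w = w + lor p w *\<^sub>R p"

definition det4 :: "real^4 \<Rightarrow> real^4 \<Rightarrow> real^4 \<Rightarrow> real^4 \<Rightarrow> real" where
  "det4 a b c d = det (vector [a, b, c, d] :: real^4^4)"

definition hcross :: "real^4 \<Rightarrow> real^4 \<Rightarrow> real^4 \<Rightarrow> real^4" where
  "hcross p u w = (THE x. lor p x = 0 \<and> (\<forall>z. lor p z = 0 \<longrightarrow> lor x z = det4 p u w z))"

text \<open>Riemann curvature tensor of H^3 (constant curvature -1)\<close>
definition hypR :: "real^4 \<Rightarrow> real^4 \<Rightarrow> real^4 \<Rightarrow> real^4" where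
  "hypR X Y Z = - (lor Y Z *\<^sub>R X - lor X Z *\<^sub>R Y)"

text \<open>C^infinity maps on open subsets: all iterated directional derivatives exist\<close>
definition smooth_on :: "'a::real_normed_vector set \<Rightarrow> ('a \<Rightarrow> 'b::real_normed_vector) \<Rightarrow> bool" where
  "smooth_on U f \<longleftrightarrow> open U \<and>
     (\<exists>F. f \<in> F \<and> (\<forall>g\<in>F. \<exists>Dg. (\<forall>x\<in>U. (g has_derivative Dg x) (at x)) \<and> (\<forall>v. (\<lambda>x. Dg x v) \<in> F)))"

definition smooth_map :: "'a::real_normed_vector set \<Rightarrow> ('a \<Rightarrow> 'b::real_normed_vector) \<Rightarrow> bool" where
  "smooth_map A f \<longleftrightarrow> (\<forall>x\<in>A. \<exists>W g. x \<in> W \<and> smooth_on W g \<and> (\<forall>y\<in>W \<inter> A. g y = f y))"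

definition local_diffeo :: "'a::real_normed_vector set \<Rightarrow> 'b::real_normed_vector set \<Rightarrow> ('a \<Rightarrow> 'b) \<Rightarrow> bool" where
  "local_diffeo M S f \<longleftrightarrow> f ` M \<subseteq> S \<and>
     (\<forall>m\<in>M. \<exists>U. openin (top_of_set M) U \<and> m \<in> U \<and> openin (top_of_set S) (f ` U) \<and>
        inj_on f U \<and> smooth_map U f \<and> smooth_map (f ` U) (inv_into U f))"

definition vel :: "(real \<Rightarrow> real^4) \<Rightarrow> real \<Rightarrow> real^4" where
  "vel c t = vector_derivative c (at t)"

definition covD :: "(real \<Rightarrow> real^4) \<Rightarrow> (real \<Rightarrow> real^4) \<Rightarrow> real \<Rightarrow> real^4" where
  "covD c W t = tang (c t) (vector_derivative W (at t))"

definition unit_geod :: "(real \<Rightarrow> real^4) \<Rightarrow> bool" where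
  "unit_geod \<gamma> \<longleftrightarrow> (\<forall>t. \<gamma> t \<in> H3) \<and> smooth_on UNIV \<gamma> \<and>
     (\<forall>t. lor (vel \<gamma> t) (vel \<gamma> t) = 1) \<and> (\<forall>t. covD \<gamma> (vel \<gamma>) t = 0)"

definition normal_jacobi :: "(real \<Rightarrow> real^4) \<Rightarrow> (real \<Rightarrow> real^4) \<Rightarrow> bool" where
  "normal_jacobi \<gamma> J \<longleftrightarrow> smooth_on UNIV J \<and>
     (\<forall>t. lor (\<gamma> t) (J t) = 0 \<and> lor (J t) (vel \<gamma> t) = 0) \<and>
     (\<forall>t. covD \<gamma> (covD \<gamma> J) t + hypR (J t) (vel \<gamma> t) (vel \<gamma> t) = 0)"

text \<open>Smooth structure on the space of oriented geodesics L: the (Pluecker) embedding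
  [\<gamma>] \<mapsto> \<gamma>(0) \<and> \<gamma>'(0) into antisymmetric 4x4 matrices (independent of the time shift).\<close>
definition wedge :: "real^4 \<Rightarrow> real^4 \<Rightarrow> real^4^4" where
  "wedge u v = (\<chi> i j. u$i * v$j - u$j * v$i)"

definition pl :: "(real \<Rightarrow> real^4) \<Rightarrow> real^4^4" where
  "pl \<gamma> = wedge (\<gamma> 0) (vel \<gamma> 0)"

definition Lspace :: "(real^4^4) set" where
  "Lspace = pl ` {\<gamma>. unit_geod \<gamma>}"

definition geod_var :: "(real \<Rightarrow> real \<Rightarrow> real^4) \<Rightarrow> (real \<Rightarrow> real^4) \<Rightarrow> bool" where
  "geod_var \<Gamma> \<gamma> \<longleftrightarrow> smooth_on UNIV (\<lambda>z::real\<times>real. \<Gamma> (fst z) (snd z)) \<and>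
     (\<forall>s. unit_geod (\<Gamma> s)) \<and> \<Gamma> 0 = \<gamma>"

definition var_field :: "(real \<Rightarrow> real \<Rightarrow> real^4) \<Rightarrow> real \<Rightarrow> real^4" where
  "var_field \<Gamma> t = vector_derivative (\<lambda>s. \<Gamma> s t) (at 0)"

definition Tmap :: "(real \<Rightarrow> real^4) \<Rightarrow> (real \<Rightarrow> real^4) \<Rightarrow> real^4^4" where
  "Tmap \<gamma> J = (SOME X. \<exists>\<Gamma>. geod_var \<Gamma> \<gamma> \<and> var_field \<Gamma> = J \<and>
                  ((\<lambda>s. pl (\<Gamma> s)) has_vector_derivative X) (at 0))"

definition gx :: "real^4^4 \<Rightarrow> real^4^4 \<Rightarrow> real" where
  "gx m X = (SOME r. \<exists>\<gamma> J. unit_geod \<gamma> \<and> pl \<gamma> = m \<and> normal_jacobi \<gamma> J \<and> Tmap \<gamma> J = X \<and>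
       r = lor (hcross (\<gamma> 0) (vel \<gamma> 0) (J 0)) (covD \<gamma> J 0))"

definition gK :: "real^4^4 \<Rightarrow> real^4^4 \<Rightarrow> real" where
  "gK m X = (SOME r. \<exists>\<gamma> J. unit_geod \<gamma> \<and> pl \<gamma> = m \<and> normal_jacobi \<gamma> J \<and> Tmap \<gamma> J = X \<and>
       r = lor (J 0) (J 0) - lor (covD \<gamma> J 0) (covD \<gamma> J 0))"

definition tspace :: "'a::real_normed_vector set \<Rightarrow> 'a \<Rightarrow> 'a set" where
  "tspace M m = {X. \<exists>c. smooth_on UNIV c \<and> (\<forall>s::real. c s \<in> M) \<and> c 0 = m \<and>
                        (c has_vector_derivative X) (at 0)}"

text \<open>sphere at infinity (boundary of the Klein model: future null rays normalised) and Gauss maps\<close>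
definition Sinf :: "(real^4) set" where
  "Sinf = {x. x$1 = 1 \<and> lor x x = 0}"

definition endpt_fwd :: "(real \<Rightarrow> real^4) \<Rightarrow> real^4" where
  "endpt_fwd \<gamma> = (1 / (\<gamma> 0 + vel \<gamma> 0)$1) *\<^sub>R (\<gamma> 0 + vel \<gamma> 0)"

definition endpt_bwd :: "(real \<Rightarrow> real^4) \<Rightarrow> real^4" where
  "endpt_bwd \<gamma> = (1 / (\<gamma> 0 - vel \<gamma> 0)$1) *\<^sub>R (\<gamma> 0 - vel \<gamma> 0)"

definition gauss_plus :: "real^4^4 \<Rightarrow> real^4" where
  "gauss_plus m = (SOME x. \<exists>\<gamma>. unit_geod \<gamma> \<and> pl \<gamma> = m \<and> x = endpt_fwd \<gamma>)"

definition gauss_minus :: "real^4^4 \<Rightarrow> real^4" where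
  "gauss_minus m = (SOME x. \<exists>\<gamma>. unit_geod \<gamma> \<and> pl \<gamma> = m \<and> x = endpt_bwd \<gamma>)"

definition geod_foliation :: "(real^4 \<Rightarrow> real^4) \<Rightarrow> bool" where
  "geod_foliation V \<longleftrightarrow> smooth_map H3 V \<and>
     (\<forall>p\<in>H3. lor p (V p) = 0 \<and> lor (V p) (V p) = 1) \<and>
     (\<forall>p\<in>H3. \<exists>\<gamma>. unit_geod \<gamma> \<and> \<gamma> 0 = p \<and> (\<forall>t. vel \<gamma> t = V (\<gamma> t)))"

definition leaf_space :: "(real^4 \<Rightarrow> real^4) \<Rightarrow> (real^4^4) set" where
  "leaf_space V = pl ` {\<gamma>. unit_geod \<gamma> \<and> (\<forall>t. vel \<gamma> t = V (\<gamma> t))}"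

definition semi_nondegenerate :: "(real^4 \<Rightarrow> real^4) \<Rightarrow> bool" where
  "semi_nondegenerate V \<longleftrightarrow>
     local_diffeo (leaf_space V) Sinf gauss_plus \<and> local_diffeo (leaf_space V) Sinf gauss_minus"

definition nablaV :: "(real^4 \<Rightarrow> real^4) \<Rightarrow> real^4 \<Rightarrow> real^4 \<Rightarrow> real^4" where
  "nablaV V p X = (SOME w. \<exists>c. smooth_on UNIV c \<and> (\<forall>s. c s \<in> H3) \<and> c 0 = p \<and> vel c 0 = X \<and>
                     w = tang p (vector_derivative (V \<circ> c) (at 0)))"

definition nondegenerate :: "(real^4 \<Rightarrow> real^4) \<Rightarrow> bool" where
  "nondegenerate V \<longleftrightarrow> (\<forall>p\<in>H3. \<forall>X. lor p X = 0 \<and> X \<noteq> 0 \<and> (\<exists>k. nablaV V p X = k *\<^sub>R X)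
        \<longrightarrow> (\<exists>\<mu>. X = \<mu> *\<^sub>R V p))"

definition semidefinite :: "(real^4^4) set \<Rightarrow> bool" where
  "semidefinite M \<longleftrightarrow> (\<forall>m\<in>M. \<forall>X\<in>tspace M m. X \<noteq> 0 \<and> gx m X = 0 \<longrightarrow> gK m X > 0)"

definition gx_definite_on :: "(real^4^4) set \<Rightarrow> bool" where
  "gx_definite_on M \<longleftrightarrow> (\<forall>m\<in>M. (\<forall>X\<in>tspace M m. X \<noteq> 0 \<longrightarrow> gx m X > 0) \<or>
                                 (\<forall>X\<in>tspace M m. X \<noteq> 0 \<longrightarrow> gx m X < 0))"

end

theory Submission
  imports Defs
begin

text \<open>
  Let \<open>A\<close> be the endomorphism \<open>X \<mapsto> \<nabla>\<^sub>X V\<close> of the plane orthogonal to \<open>V p\<close>. The tangent vectors of the leaf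
  space at the leaf through \<open>p\<close> are the Jacobi fields with initial data \<open>(X, A X)\<close>, on which \<open>g\<^sub>\<times>\<close> is
  \<open>det (p, V p, X, A X)\<close> and \<open>g\<^sub>K\<close> is \<open>|X|\<^sup>2 - |A X|\<^sup>2\<close>. Hence \<open>g\<^sub>\<times>\<close> vanishes exactly on the eigenvectors
  of \<open>A\<close>, which gives (b), because a binary quadratic form without nontrivial zeros is definite. For an eigenvalue
  \<open>k\<close> the Jacobi field is \<open>(cosh t + k sinh t) X\<close>. As it has no zeros, \<open>|k| \<le> 1\<close>, so the leaf space is
  semidefinite iff \<open>1\<close> and \<open>-1\<close> are never eigenvalues of \<open>A\<close>. The derivative of
  \<open>\<phi>\<^sup>+\<close> (resp. \<open>\<phi>\<^sup>-\<close>) is injective iff \<open>-1\<close> (resp. \<open>1\<close>) is not an eigenvalue, and the inverse function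
  theorem gives (a).
\<close>

section \<open>Smooth maps\<close>

text \<open>Many of the notions are choices over geodesics, Jacobi fields, variations or curves, so
  each must be shown independent of the choice before it can be computed. The bivector of a leaf
  does most of this work: both metrics turn out to be functions of the tangent bivector alone, and
  the endpoints of a geodesic are null eigenlines of contraction with its bivector.

  The leaf space is given merely as a set of matrices. Charts come from slicing: a leaf near the one
  through \<open>p\<close> meets the plane through \<open>p\<close> orthogonal to \<open>V p\<close>
  in a point that is an explicit smooth function of the bivector. This yields the tangent spaces
  and, with stereographic coordinates at infinity, turns a Gauss map into a map from an open set of
  the plane to the plane.

  That the relevant Jacobi fields have no zeros is not argued by following nearby leaves. All points
  of a leaf have the same bivector, so the tangent space may be computed at any of them; a tangent
  vector whose field vanishes at \<open>q\<close> has the zero description at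
  \<open>q\<close>.\<close>

lemma smooth_on_openD: "smooth_on U f \<Longrightarrow> open U"
  by (simp add: smooth_on_def)

lemma smooth_on_derivative:
  assumes "smooth_on U f"
  obtains D where "\<And>x. x \<in> U \<Longrightarrow> (f has_derivative D x) (at x)" "\<And>v. smooth_on U (\<lambda>x. D x v)"
proof -
  obtain F where F: "f \<in> F" "\<forall>g\<in>F. \<exists>Dg. (\<forall>x\<in>U. (g has_derivative Dg x) (at x)) \<and> (\<forall>v. (\<lambda>x. Dg x v) \<in> F)"
    and U: "open U" using assms unfolding smooth_on_def by blast
  then obtain D where "\<forall>x\<in>U. (f has_derivative D x) (at x)" "\<forall>v. (\<lambda>x. D x v) \<in> F" by blast
  moreover have "smooth_on U (\<lambda>x. D x v)" for v
    unfolding smooth_on_def using calculation U F by blast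
  ultimately show ?thesis using that by blast
qed

text \<open>The family in \<open>smooth_on_def\<close> makes smoothness a greatest fixed point. A
  closure proof therefore amounts to finding a class of functions that contains the given one and is
  stable under directional derivatives.\<close>

lemma smooth_on_coinduct:
  assumes "open U" "P f"
    and "\<And>g. P g \<Longrightarrow> \<exists>D. (\<forall>x\<in>U. (g has_derivative D x) (at x)) \<and> (\<forall>v. P (\<lambda>x. D x v))"
  shows "smooth_on U f"
  unfolding smooth_on_def using assms by (intro conjI exI[of _ "Collect P"]) auto

lemma smooth_on_local:
  fixes f :: "'a::real_normed_vector \<Rightarrow> 'b::real_normed_vector"
  assumes "\<And>x. x \<in> U \<Longrightarrow> \<exists>W f'. x \<in> W \<and> smooth_on W f' \<and> W \<subseteq> U \<and> (\<forall>y\<in>W. f' y = f y)"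
  shows "smooth_on U f"
proof (rule smooth_on_coinduct[where
      P="\<lambda>g. \<forall>x\<in>U. \<exists>W f'. x \<in> W \<and> smooth_on W f' \<and> W \<subseteq> U \<and> (\<forall>y\<in>W. f' y = g y)"])
  have "\<exists>W. open W \<and> x \<in> W \<and> W \<subseteq> U" if "x \<in> U" for x
    using assms[OF that] smooth_on_openD by blast
  then show "open U" by (subst open_subopen) blast
next
  fix g :: "'a \<Rightarrow> 'b"
  assume g: "\<forall>x\<in>U. \<exists>W f'. x \<in> W \<and> smooth_on W f' \<and> W \<subseteq> U \<and> (\<forall>y\<in>W. f' y = g y)"
  show "\<exists>D. (\<forall>x\<in>U. (g has_derivative D x) (at x)) \<and>
    (\<forall>v. \<forall>x\<in>U. \<exists>W f'. x \<in> W \<and> smooth_on W f' \<and> W \<subseteq> U \<and> (\<forall>y\<in>W. f' y = D y v))"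
  \<comment> \<open>The local representatives \<open>f'\<close> vary with the point, so the
    derivative is named without them; uniqueness of derivatives identifies it with theirs on each
    \<open>W\<close>.\<close>
  proof (intro exI[of _ "\<lambda>x. frechet_derivative g (at x)"] conjI allI ballI)
    fix x assume "x \<in> U"
    then obtain W f' where W: "x \<in> W" "smooth_on W f'" "W \<subseteq> U" "\<forall>y\<in>W. f' y = g y" using g by blast
    then obtain D where D: "\<And>x. x \<in> W \<Longrightarrow> (f' has_derivative D x) (at x)" "\<And>v. smooth_on W (\<lambda>x. D x v)"
      using smooth_on_derivative by blast
    have gd: "(g has_derivative D y) (at y)" if "y \<in> W" for y
      using has_derivative_transform_within_open[OF D(1)[OF that] smooth_on_openD[OF W(2)] that] W(4) by simp
    then have eq: "D y = frechet_derivative g (at y)" if "y \<in> W" for y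
      using that frechet_derivative_at by blast
    show "(g has_derivative frechet_derivative g (at x)) (at x)" using gd eq W(1) by metis
    fix v
    show "\<exists>W f'. x \<in> W \<and> smooth_on W f' \<and> W \<subseteq> U \<and> (\<forall>y\<in>W. f' y = frechet_derivative g (at y) v)"
      using W D(2) eq by (intro exI[of _ W] exI[of _ "\<lambda>x. D x v"]) auto
  qed
qed (use assms in blast)

lemma smooth_on_cong:
  assumes "smooth_on U f" "\<And>x. x \<in> U \<Longrightarrow> f x = g x"
  shows "smooth_on U g"
  using assms by (intro smooth_on_local) blast

lemma smooth_on_subset:
  fixes f :: "'a::real_normed_vector \<Rightarrow> 'b::real_normed_vector"
  assumes "smooth_on U f" "open W" "W \<subseteq> U"
  shows "smooth_on W f"
proof (rule smooth_on_coinduct[where P="smooth_on U"])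
  fix g :: "'a \<Rightarrow> 'b" assume g: "smooth_on U g"
  obtain D where "\<And>x. x \<in> U \<Longrightarrow> (g has_derivative D x) (at x)" "\<And>v. smooth_on U (\<lambda>x. D x v)"
    using smooth_on_derivative[OF g] by blast
  then show "\<exists>D. (\<forall>x\<in>W. (g has_derivative D x) (at x)) \<and> (\<forall>v. smooth_on U (\<lambda>x. D x v))"
    using assms(3) by (intro exI[of _ D]) auto
qed (use assms in auto)

lemma smooth_on_imp_continuous_on: "smooth_on U f \<Longrightarrow> continuous_on U f"
  by (metis continuous_at_imp_continuous_on has_derivative_continuous smooth_on_derivative)

section \<open>Closure of smoothness under algebraic operations, composition and elementary
  functions\<close>

lemma smooth_on_const:
  fixes U :: "'a::real_normed_vector set" and c :: "'b::real_normed_vector"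
  shows "open U \<Longrightarrow> smooth_on U (\<lambda>x. c)"
proof (rule smooth_on_coinduct[where P="\<lambda>g. \<exists>c. g = (\<lambda>x. c)"])
  fix g :: "'a \<Rightarrow> 'b" assume "\<exists>c. g = (\<lambda>x. c)"
  then show "\<exists>D. (\<forall>x\<in>U. (g has_derivative D x) (at x)) \<and> (\<forall>v. \<exists>c. (\<lambda>x. D x v) = (\<lambda>x. c))"
    by (intro exI[of _ "\<lambda>x v. 0"]) auto
qed auto

lemma smooth_on_linear:
  assumes "bounded_linear f" "open U" shows "smooth_on U f"
proof (rule smooth_on_coinduct[where P="\<lambda>g. g = f \<or> (\<exists>c. g = (\<lambda>x. c))"])
  fix g assume "g = f \<or> (\<exists>c. g = (\<lambda>x. c))"
  then show "\<exists>D. (\<forall>x\<in>U. (g has_derivative D x) (at x)) \<and> (\<forall>v. (\<lambda>x. D x v) = f \<or> (\<exists>c. (\<lambda>x. D x v) = (\<lambda>x. c)))"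
  proof
    assume "g = f"
    then show ?thesis using assms bounded_linear_imp_has_derivative by (intro exI[of _ "\<lambda>x. f"]) auto
  qed (auto intro!: exI[of _ "\<lambda>x v. 0"])
qed (use assms in auto)

lemma smooth_on_id: "open U \<Longrightarrow> smooth_on U (\<lambda>x. x)"
  by (rule smooth_on_linear) (rule bounded_linear_ident)

text \<open>The product rule turns one product into a sum of two, so the class for the coinduction
  is the closure of products under sums.\<close>

inductive bilin_sum :: "('b::real_normed_vector \<Rightarrow> 'c::real_normed_vector \<Rightarrow> 'd::real_normed_vector)
    \<Rightarrow> 'a::real_normed_vector set \<Rightarrow> ('a \<Rightarrow> 'd) \<Rightarrow> bool" for B U where
  prod: "smooth_on U f \<Longrightarrow> smooth_on U g \<Longrightarrow> bilin_sum B U (\<lambda>x. B (f x) (g x))"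
| sum: "bilin_sum B U f \<Longrightarrow> bilin_sum B U g \<Longrightarrow> bilin_sum B U (\<lambda>x. f x + g x)"

lemma smooth_on_bilin_sum:
  assumes B: "bounded_bilinear B" and U: "open U" and f: "bilin_sum B U f"
  shows "smooth_on U f"
proof (rule smooth_on_coinduct[where P="bilin_sum B U", OF U f])
  fix g assume "bilin_sum B U g"
  then show "\<exists>D. (\<forall>x\<in>U. (g has_derivative D x) (at x)) \<and> (\<forall>v. bilin_sum B U (\<lambda>x. D x v))"
  proof induction
    case (prod f g)
    obtain Df Dg where
      D: "\<And>x. x \<in> U \<Longrightarrow> (f has_derivative Df x) (at x)" "\<And>v. smooth_on U (\<lambda>x. Df x v)"
         "\<And>x. x \<in> U \<Longrightarrow> (g has_derivative Dg x) (at x)" "\<And>v. smooth_on U (\<lambda>x. Dg x v)"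
      using prod smooth_on_derivative by metis
    show ?case
    proof (intro exI conjI ballI allI)
      fix x assume "x \<in> U"
      then show "((\<lambda>x. B (f x) (g x)) has_derivative (\<lambda>v. B (f x) (Dg x v) + B (Df x v) (g x))) (at x)"
        using D bounded_bilinear.FDERIV[OF B] by blast
    qed (intro bilin_sum.intros D prod)
  next
    case (sum f g)
    then obtain Df Dg where
      "\<And>x. x \<in> U \<Longrightarrow> (f has_derivative Df x) (at x)" "\<And>v. bilin_sum B U (\<lambda>x. Df x v)"
      "\<And>x. x \<in> U \<Longrightarrow> (g has_derivative Dg x) (at x)" "\<And>v. bilin_sum B U (\<lambda>x. Dg x v)"
      by metis
    then show ?case
      by (intro exI[of _ "\<lambda>x v. Df x v + Dg x v"]) (auto intro: bilin_sum.intros has_derivative_add)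
  qed
qed

lemma smooth_on_bilinear:
  assumes "bounded_bilinear B" "smooth_on U f" "smooth_on U g"
  shows "smooth_on U (\<lambda>x. B (f x) (g x))"
  using assms smooth_on_bilin_sum bilin_sum.prod smooth_on_openD by blast

lemma smooth_on_add:
  fixes f g :: "'a::real_normed_vector \<Rightarrow> 'b::real_normed_vector"
  assumes "smooth_on U f" "smooth_on U g"
  shows "smooth_on U (\<lambda>x. f x + g x)"
proof (rule smooth_on_coinduct[where P="\<lambda>h. \<exists>f g. smooth_on U f \<and> smooth_on U g \<and> h = (\<lambda>x. f x + g x)"])
  fix h :: "'a \<Rightarrow> 'b" assume "\<exists>f g. smooth_on U f \<and> smooth_on U g \<and> h = (\<lambda>x. f x + g x)"
  then obtain f g where h: "smooth_on U f" "smooth_on U g" "h = (\<lambda>x. f x + g x)" by blast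
  obtain Df where Df: "\<And>x. x \<in> U \<Longrightarrow> (f has_derivative Df x) (at x)" "\<And>v. smooth_on U (\<lambda>x. Df x v)"
    using smooth_on_derivative[OF h(1)] by blast
  obtain Dg where Dg: "\<And>x. x \<in> U \<Longrightarrow> (g has_derivative Dg x) (at x)" "\<And>v. smooth_on U (\<lambda>x. Dg x v)"
    using smooth_on_derivative[OF h(2)] by blast
  show "\<exists>D. (\<forall>x\<in>U. (h has_derivative D x) (at x)) \<and>
      (\<forall>v. \<exists>f g. smooth_on U f \<and> smooth_on U g \<and> (\<lambda>x. D x v) = (\<lambda>x. f x + g x))"
    unfolding h(3)
  proof (intro exI[of _ "\<lambda>x v. Df x v + Dg x v"] conjI allI ballI)
    fix v
    show "\<exists>f g. smooth_on U f \<and> smooth_on U g \<and> (\<lambda>x. Df x v + Dg x v) = (\<lambda>x. f x + g x)"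
      by (rule exI[of _ "\<lambda>x. Df x v"], rule exI[of _ "\<lambda>x. Dg x v"]) (simp add: Df(2) Dg(2))
  qed (rule has_derivative_add[OF Df(1) Dg(1)])
qed (use assms smooth_on_openD[OF assms(1)] in auto)

lemmas smooth_on_scaleR = smooth_on_bilinear[OF bounded_bilinear_scaleR]
lemmas smooth_on_mult = smooth_on_bilinear[OF bounded_bilinear_mult]

text \<open>By the chain rule a derivative of \<open>f \<circ> g\<close> expands over the basis into
  functions composed with \<open>g\<close>, with smooth scalar coefficients. The expansion is the
  reason for closing under scaling and sums and for a Euclidean intermediate space.\<close>

inductive comp_sum :: "('a::real_normed_vector \<Rightarrow> 'b::euclidean_space) \<Rightarrow> 'a set \<Rightarrow> 'b set
    \<Rightarrow> ('a \<Rightarrow> 'c::real_normed_vector) \<Rightarrow> bool" for g U W where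
  zero: "comp_sum g U W (\<lambda>x. 0)"
| comp: "smooth_on W f \<Longrightarrow> comp_sum g U W (\<lambda>x. f (g x))"
| scale: "smooth_on U a \<Longrightarrow> comp_sum g U W f \<Longrightarrow> comp_sum g U W (\<lambda>x. a x *\<^sub>R f x)"
| sum: "comp_sum g U W f \<Longrightarrow> comp_sum g U W h \<Longrightarrow> comp_sum g U W (\<lambda>x. f x + h x)"

lemma comp_sum_sum:
  assumes "\<And>i. i \<in> I \<Longrightarrow> comp_sum g U W (f i)"
  shows "comp_sum g U W (\<lambda>x. \<Sum>i\<in>I. f i x)"
  using assms by (induction I rule: infinite_finite_induct) (auto intro: comp_sum.intros)

lemma smooth_on_comp_sum:
  assumes g: "smooth_on U g" and gW: "g ` U \<subseteq> W" and f: "comp_sum g U W f"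
  shows "smooth_on U f"
proof (rule smooth_on_coinduct[where P="comp_sum g U W", OF smooth_on_openD[OF g] f])
  obtain Dg where Dg: "\<And>x. x \<in> U \<Longrightarrow> (g has_derivative Dg x) (at x)" "\<And>v. smooth_on U (\<lambda>x. Dg x v)"
    using g smooth_on_derivative by blast
  have Dgb: "smooth_on U (\<lambda>x. Dg x v \<bullet> b)" for v b
    by (rule smooth_on_bilinear[OF bounded_bilinear_inner Dg(2) smooth_on_const[OF smooth_on_openD[OF g]]])
  fix h assume "comp_sum g U W h"
  then show "\<exists>D. (\<forall>x\<in>U. (h has_derivative D x) (at x)) \<and> (\<forall>v. comp_sum g U W (\<lambda>x. D x v))"
  proof induction
    case zero
    show ?case by (intro exI[of _ "\<lambda>x v. 0"]) (auto intro: comp_sum.intros)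
  next
    case (comp f)
    then obtain Df where Df: "\<And>x. x \<in> W \<Longrightarrow> (f has_derivative Df x) (at x)" "\<And>v. smooth_on W (\<lambda>x. Df x v)"
      using smooth_on_derivative by blast
    show ?case
    proof (intro exI conjI ballI allI)
      fix x assume x: "x \<in> U"
      then have gx: "g x \<in> W" using gW by auto
      interpret Df: bounded_linear "Df (g x)" using Df(1)[OF gx] has_derivative_bounded_linear by blast
      have "(\<lambda>v. Df (g x) (Dg x v)) = (\<lambda>v. \<Sum>b\<in>Basis. (Dg x v \<bullet> b) *\<^sub>R Df (g x) b)"
        by (subst euclidean_representation[symmetric]) (simp only: Df.sum Df.scaleR)
      then show "((\<lambda>x. f (g x)) has_derivative (\<lambda>v. \<Sum>b\<in>Basis. (Dg x v \<bullet> b) *\<^sub>R Df (g x) b)) (at x)"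
        using has_derivative_compose[OF Dg(1)[OF x] Df(1)[OF gx]] by simp
    next
      fix v
      have "comp_sum g U W (\<lambda>x. (Dg x v \<bullet> b) *\<^sub>R Df (g x) b)" for b
        by (intro comp_sum.scale Dgb comp_sum.comp[of W "\<lambda>y. Df y b"] Df)
      then show "comp_sum g U W (\<lambda>x. \<Sum>b\<in>Basis. (Dg x v \<bullet> b) *\<^sub>R Df (g x) b)"
        by (rule comp_sum_sum)
    qed
  next
    case (scale a f)
    obtain Da where Da: "\<And>x. x \<in> U \<Longrightarrow> (a has_derivative Da x) (at x)" "\<And>v. smooth_on U (\<lambda>x. Da x v)"
      using scale.hyps(1) smooth_on_derivative by blast
    obtain Df where Df: "\<And>x. x \<in> U \<Longrightarrow> (f has_derivative Df x) (at x)" "\<And>v. comp_sum g U W (\<lambda>x. Df x v)"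
      using scale.IH by blast
    show ?case
    proof (intro exI conjI ballI allI)
      fix x assume "x \<in> U"
      then show "((\<lambda>x. a x *\<^sub>R f x) has_derivative (\<lambda>v. a x *\<^sub>R Df x v + Da x v *\<^sub>R f x)) (at x)"
        using Da Df has_derivative_scaleR by blast
    qed (intro comp_sum.intros Da Df scale)
  next
    case (sum f h)
    then obtain Df Dh where
      "\<And>x. x \<in> U \<Longrightarrow> (f has_derivative Df x) (at x)" "\<And>v. comp_sum g U W (\<lambda>x. Df x v)"
      "\<And>x. x \<in> U \<Longrightarrow> (h has_derivative Dh x) (at x)" "\<And>v. comp_sum g U W (\<lambda>x. Dh x v)"
      by metis
    then show ?case
      by (intro exI[of _ "\<lambda>x v. Df x v + Dh x v"]) (auto intro: comp_sum.intros has_derivative_add)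
  qed
qed

lemma smooth_on_compose:
  fixes g :: "'a::real_normed_vector \<Rightarrow> 'b::euclidean_space"
  assumes "smooth_on U g" "smooth_on W f" "g ` U \<subseteq> W"
  shows "smooth_on U (\<lambda>x. f (g x))"
  using smooth_on_comp_sum[OF assms(1,3)] comp_sum.comp[OF assms(2)] by blast

lemma smooth_on_compose_linear:
  fixes g :: "'a::real_normed_vector \<Rightarrow> 'b::euclidean_space"
  assumes "bounded_linear f" "smooth_on U g"
  shows "smooth_on U (\<lambda>x. f (g x))"
  using smooth_on_compose[OF assms(2) smooth_on_linear[OF assms(1) open_UNIV]] by simp

lemma smooth_on_diff:
  assumes "smooth_on U f" "smooth_on U g"
  shows "smooth_on U (\<lambda>x. f x - g x)"
proof -
  have "smooth_on U (\<lambda>x. f x + (-1) *\<^sub>R g x)"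
    by (intro smooth_on_add smooth_on_scaleR smooth_on_const assms smooth_on_openD[OF assms(1)])
  then show ?thesis by simp
qed

lemma smooth_on_inverse:
  fixes f :: "'a::real_normed_vector \<Rightarrow> real"
  assumes "smooth_on U f" "\<And>x. x \<in> U \<Longrightarrow> f x \<noteq> 0"
  shows "smooth_on U (\<lambda>x. inverse (f x))"
proof -
  have "smooth_on (- {0::real}) inverse"
  \<comment> \<open>Multiples of integer powers are stable under differentiation away from
    \<open>0\<close>; multiples of real powers play the same part for the square root.\<close>
  proof (rule smooth_on_coinduct[where P="\<lambda>g. \<exists>c n. g = (\<lambda>x. c * x powi n)"])
    show "\<exists>c n. inverse = (\<lambda>x::real. c * x powi n)"
      by (intro exI[of _ 1] exI[of _ "-1"]) (auto simp: power_int_minus)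
    fix g :: "real \<Rightarrow> real" assume "\<exists>c n. g = (\<lambda>x. c * x powi n)"
    then obtain c n where g: "g = (\<lambda>x. c * x powi n)" by blast
    show "\<exists>D. (\<forall>x\<in>-{0}. (g has_derivative D x) (at x)) \<and> (\<forall>v. \<exists>c n. (\<lambda>x. D x v) = (\<lambda>x. c * x powi n))"
    proof (intro exI[of _ "\<lambda>x v. (c * v * of_int n) * x powi (n - 1)"] conjI ballI)
      fix x :: real assume "x \<in> -{0}"
      then show "(g has_derivative (\<lambda>v. (c * v * of_int n) * x powi (n - 1))) (at x)"
        unfolding g using has_derivative_mult_right[OF has_derivative_power_int'[of x n UNIV], of c]
        by (simp add: mult.assoc)
    qed blast
  qed auto
  then show ?thesis using smooth_on_compose[OF assms(1)] assms(2) by fastforce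
qed

lemma smooth_on_sqrt:
  assumes "smooth_on U f" "\<And>x. x \<in> U \<Longrightarrow> f x > 0"
  shows "smooth_on U (\<lambda>x. sqrt (f x))"
proof -
  have "smooth_on {0::real<..} (\<lambda>x. x powr (1/2))"
  proof (rule smooth_on_coinduct[where P="\<lambda>g. \<exists>c a. g = (\<lambda>x. c * x powr a)"])
    show "\<exists>c a. (\<lambda>x::real. x powr (1/2)) = (\<lambda>x::real. c * x powr a)"
      by (intro exI[of _ 1] exI[of _ "1/2"]) auto
    fix g :: "real \<Rightarrow> real" assume "\<exists>c a. g = (\<lambda>x. c * x powr a)"
    then obtain c a where g: "g = (\<lambda>x. c * x powr a)" by blast
    show "\<exists>D. (\<forall>x\<in>{0::real<..}. (g has_derivative D x) (at x)) \<and> (\<forall>v. \<exists>c a. (\<lambda>x. D x v) = (\<lambda>x. c * x powr a))"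
    proof (intro exI[of _ "\<lambda>x v. (c * a * v) * x powr (a - 1)"] conjI ballI)
      fix x :: real assume x: "x \<in> {0::real<..}"
      then have "((\<lambda>x. x powr a) has_field_derivative a * x powr (a - 1)) (at x)"
        by (intro has_real_derivative_powr) auto
      then show "(g has_derivative (\<lambda>v. (c * a * v) * x powr (a - 1))) (at x)"
        unfolding g has_field_derivative_def
        using has_derivative_mult_right[of "\<lambda>x. x powr a" "(*) (a * x powr (a - 1))" "at x" c]
        by (simp add: mult_ac)
    qed blast
  qed auto
  then have "smooth_on {0<..} sqrt"
    by (rule smooth_on_cong) (auto simp: powr_half_sqrt)
  then show ?thesis using smooth_on_compose[OF assms(1)] assms(2) by fastforce
qed

lemma smooth_on_cosh_sinh: "smooth_on UNIV (cosh :: real \<Rightarrow> real)" "smooth_on UNIV (sinh :: real \<Rightarrow> real)"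
proof -
  have "smooth_on UNIV (\<lambda>x::real. a * cosh x + b * sinh x)" for a b
  proof (rule smooth_on_coinduct[where P="\<lambda>g. \<exists>a b. g = (\<lambda>x. a * cosh x + b * sinh x)"])
    fix g :: "real \<Rightarrow> real" assume "\<exists>a b. g = (\<lambda>x. a * cosh x + b * sinh x)"
    then obtain a b where g: "g = (\<lambda>x. a * cosh x + b * sinh x)" by blast
    show "\<exists>D. (\<forall>x\<in>UNIV. (g has_derivative D x) (at x)) \<and> (\<forall>v. \<exists>a b. (\<lambda>x. D x v) = (\<lambda>x. a * cosh x + b * sinh x))"
    proof (intro exI[of _ "\<lambda>x v. (v * b) * cosh x + (v * a) * sinh x"] conjI ballI)
      fix x :: real
      show "(g has_derivative (\<lambda>v. (v * b) * cosh x + (v * a) * sinh x)) (at x)"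
        unfolding g by (auto intro!: derivative_eq_intros simp: fun_eq_iff algebra_simps)
    qed blast
  qed auto
  from this[of 1 0] this[of 0 1] show "smooth_on UNIV (cosh :: real \<Rightarrow> real)" "smooth_on UNIV (sinh :: real \<Rightarrow> real)"
    by simp_all
qed

lemma smooth_on_Pair:
  fixes f :: "'a::real_normed_vector \<Rightarrow> 'b::euclidean_space" and g :: "'a \<Rightarrow> 'c::euclidean_space"
  assumes "smooth_on U f" "smooth_on U g"
  shows "smooth_on U (\<lambda>x. (f x, g x))"
proof -
  have "bounded_linear (\<lambda>x::'b. (x, 0::'c))" "bounded_linear (\<lambda>x::'c. (0::'b, x))"
    by (auto intro: bounded_linear_Pair bounded_linear_ident bounded_linear_zero)
  then have "smooth_on U (\<lambda>x. (f x, 0) + (0, g x))"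
    using smooth_on_compose_linear[OF _ assms(1)] smooth_on_compose_linear[OF _ assms(2)]
    by (intro smooth_on_add) fastforce+
  then show ?thesis by simp
qed

text \<open>On a set such as \<open>H3\<close>, smoothness is known only through local extensions.
  Along a map into the set, every extension has the same values, so \<open>V\<close> becomes an
  ordinary smooth function there.\<close>

lemma smooth_map_compose:
  fixes g :: "'a::real_normed_vector \<Rightarrow> 'b::euclidean_space"
  assumes f: "smooth_map A f" and g: "smooth_on U g" and gA: "g ` U \<subseteq> A"
  shows "smooth_on U (\<lambda>x. f (g x))"
proof (rule smooth_on_local)
  fix x assume x: "x \<in> U"
  then obtain W h where W: "g x \<in> W" "smooth_on W h" "\<forall>y\<in>W \<inter> A. h y = f y"
    using f gA unfolding smooth_map_def by blast
  have o: "open (U \<inter> g -` W)"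
    using continuous_open_vimage smooth_on_imp_continuous_on[OF g] smooth_on_openD[OF g] smooth_on_openD[OF W(2)]
    by (simp add: continuous_open_preimage)
  have "smooth_on (U \<inter> g -` W) (\<lambda>x. h (g x))"
    using smooth_on_compose[OF smooth_on_subset[OF g o] W(2)] by auto
  then show "\<exists>Wa f'. x \<in> Wa \<and> smooth_on Wa f' \<and> Wa \<subseteq> U \<and> (\<forall>y\<in>Wa. f' y = f (g y))"
    using x W gA by (intro exI[of _ "U \<inter> g -` W"] exI[of _ "\<lambda>x. h (g x)"]) auto
qed

text \<open>The derivative of the inverse at \<open>y\<close> is the inverse of the derivative at
  \<open>g y\<close>. In dimension two Cramer's rule writes that inverse matrix as a smooth function
  of the point \<open>g y\<close>, so differentiation never leaves the class of smooth functions
  composed with \<open>g\<close>.\<close>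

lemma smooth_local_inverse:
  fixes f :: "real \<times> real \<Rightarrow> real \<times> real"
  assumes f: "smooth_on U f" and x0: "x0 \<in> U"
    and D0: "(f has_derivative D0) (at x0)" and inj: "\<And>v. D0 v = 0 \<Longrightarrow> v = 0"
  obtains U' V g where "open U'" "U' \<subseteq> U" "x0 \<in> U'" "open V" "homeomorphism U' V f g" "smooth_on V g"
proof -
  obtain D where D: "\<And>x. x \<in> U \<Longrightarrow> (f has_derivative D x) (at x)" "\<And>v. smooth_on U (\<lambda>x. D x v)"
    using f smooth_on_derivative by blast
  define F where "F x = Blinfun (D x)" for x
  have F: "blinfun_apply (F x) = D x" if "x \<in> U" for x
    unfolding F_def using D(1)[OF that] bounded_linear_Blinfun_apply has_derivative_bounded_linear by blast
  have "D0 = D x0" using D0 D(1)[OF x0] has_derivative_unique by blast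
  have lin: "linear D0" using D0 has_derivative_linear by blast
  then have "inj D0" using inj linear_injective_0 by blast
  then obtain L where L: "linear L" "L \<circ> D0 = id"
    using linear_injective_left_inverse[OF lin] by blast
  then have Lb: "bounded_linear L" by (simp add: linear_conv_bounded_linear)
  have inv: "Blinfun L o\<^sub>L F x0 = id_blinfun"
    using F[OF x0] L(2) \<open>D0 = D x0\<close> bounded_linear_Blinfun_apply[OF Lb]
    by (intro blinfun_eqI) (simp add: fun_eq_iff del: split_paired_All)
  have cont: "continuous_on U F"
  proof (rule continuous_on_blinfun_componentwise)
    fix i :: "real \<times> real" 
    show "continuous_on U (\<lambda>x. F x i)"
      using continuous_on_cong[of U U "\<lambda>x. F x i" "\<lambda>x. D x i"] F smooth_on_imp_continuous_on[OF D(2)] by auto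
  qed
  have der: "(f has_derivative blinfun_apply (F x)) (at x)" if "x \<in> U" for x
    using D(1)[OF that] F[OF that] by simp
  obtain U' V g g' where IFT: "open U'" "U' \<subseteq> U" "x0 \<in> U'" "open V" "f x0 \<in> V" "homeomorphism U' V f g"
    "\<And>y. y \<in> V \<Longrightarrow> (g has_derivative (g' y)) (at y)"
    "\<And>y. y \<in> V \<Longrightarrow> g' y = Hilbert_Choice.inv (blinfun_apply (F (g y)))"
    "\<And>y. y \<in> V \<Longrightarrow> bij (blinfun_apply (F (g y)))"
    using inverse_function_theorem[OF smooth_on_openD[OF f] der cont x0 inv] by metis
  have gU: "g y \<in> U'" if "y \<in> V" for y
    using IFT(6) that unfolding homeomorphism_def by auto
  have bij: "bij (D x)" if "x \<in> U'" for x
  proof -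
    have "f x \<in> V" "g (f x) = x" using IFT(6) that unfolding homeomorphism_def by auto
    then show ?thesis using IFT(9)[of "f x"] F[of x] IFT(2) that by auto
  qed
  \<comment> \<open>The Jacobian determinant; \<open>K\<close> is Cramer's rule for the inverse
    matrix.\<close>
  define d where "d x = fst (D x (1,0)) * snd (D x (0,1)) - fst (D x (0,1)) * snd (D x (1,0))" for x
  define K where "K x v = inverse (d x) *\<^sub>R (snd (D x (0,1)) * fst v - fst (D x (0,1)) * snd v,
      fst (D x (1,0)) * snd v - snd (D x (1,0)) * fst v)" for x v
  have DK: "D x h = (fst h * fst (D x (1,0)) + snd h * fst (D x (0,1)), fst h * snd (D x (1,0)) + snd h * snd (D x (0,1)))"
    if "x \<in> U" for x h
  proof -
    interpret linear "D x" using D(1)[OF that] has_derivative_linear by blast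
    have "h = fst h *\<^sub>R (1,0) + snd h *\<^sub>R (0,1)" by (simp add: prod_eq_iff)
    then have "D x h = fst h *\<^sub>R D x (1,0) + snd h *\<^sub>R D x (0,1)" by (metis add scaleR)
    then show ?thesis by (simp add: prod_eq_iff)
  qed
  have d0: "d x \<noteq> 0" if "x \<in> U'" for x
  proof
    assume "d x = 0"
    have xU: "x \<in> U" using that IFT(2) by blast
    have inj0: "h = 0" if "D x h = 0" for h
      using bij[OF \<open>x \<in> U'\<close>] that D(1)[OF xU] has_derivative_linear
      by (metis bij_is_inj linear_injective_0)
    \<comment> \<open>When the determinant vanishes, the second row turned by a right angle is in
      the kernel. So that row is zero, and then the same argument disposes of the first row.\<close>
    have "(snd (D x (0,1)), - snd (D x (1,0))) = 0"
      by (rule inj0, subst DK[OF xU]) (use \<open>d x = 0\<close> in \<open>auto simp: d_def zero_prod_def algebra_simps\<close>)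
    then have s: "snd (D x (0,1)) = 0" "snd (D x (1,0)) = 0" by (auto simp: zero_prod_def)
    have "(fst (D x (0,1)), - fst (D x (1,0))) = 0"
      by (rule inj0, subst DK[OF xU]) (use s in \<open>auto simp: zero_prod_def algebra_simps\<close>)
    then have "D x (1,0) = 0" using s by (auto simp: zero_prod_def prod_eq_iff)
    then show False using inj0[of "(1,0)"] by (simp add: zero_prod_def)
  qed
  have K: "K x v = Hilbert_Choice.inv (D x) v" if "x \<in> U'" for x v
  proof -
    have "fst (D x (K x v)) = inverse (d x) * d x * fst v" "snd (D x (K x v)) = inverse (d x) * d x * snd v"
      using that IFT(2) by (subst DK; force simp: K_def d_def algebra_simps)+
    then have "D x (K x v) = v" using d0[OF that] by (simp add: prod_eq_iff)
    then show ?thesis using bij[OF that] by (metis bij_inv_eq_iff)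
  qed
  have Ds: "smooth_on U' (\<lambda>x. fst (D x v))" "smooth_on U' (\<lambda>x. snd (D x v))" for v
    using smooth_on_compose_linear[OF bounded_linear_fst, OF D(2)] smooth_on_compose_linear[OF bounded_linear_snd, OF D(2)]
      smooth_on_subset IFT(1,2) by blast+
  have ds: "smooth_on U' d"
    unfolding d_def by (intro smooth_on_mult smooth_on_diff Ds)
  have Ks: "smooth_on U' (\<lambda>x. fst (K x v))" "smooth_on U' (\<lambda>x. snd (K x v))" for v
    unfolding K_def fst_scaleR snd_scaleR fst_conv snd_conv real_scaleR_def
    using smooth_on_inverse[OF ds d0] by (intro smooth_on_mult smooth_on_diff Ds smooth_on_const IFT(1); simp)+
  have "smooth_on V g"
  proof (rule smooth_on_coinduct[where P="\<lambda>k. \<exists>h. smooth_on U' h \<and> k = (\<lambda>y. h (g y))"])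
    show "\<exists>h. smooth_on U' h \<and> g = (\<lambda>y. h (g y))"
      by (intro exI[of _ "\<lambda>x. x"]) (auto intro: smooth_on_id IFT)
    fix k :: "real \<times> real \<Rightarrow> real \<times> real" assume "\<exists>h. smooth_on U' h \<and> k = (\<lambda>y. h (g y))"
    then obtain h where h: "smooth_on U' h" "k = (\<lambda>y. h (g y))" by blast
    obtain Dh where Dh: "\<And>x. x \<in> U' \<Longrightarrow> (h has_derivative Dh x) (at x)" "\<And>v. smooth_on U' (\<lambda>x. Dh x v)"
      using h smooth_on_derivative by blast
    show "\<exists>E. (\<forall>y\<in>V. (k has_derivative E y) (at y)) \<and> (\<forall>v. \<exists>h. smooth_on U' h \<and> (\<lambda>y. E y v) = (\<lambda>y. h (g y)))"
    proof (intro exI[of _ "\<lambda>y v. fst (K (g y) v) *\<^sub>R Dh (g y) (1,0) + snd (K (g y) v) *\<^sub>R Dh (g y) (0,1)"] conjI ballI allI)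
      fix y assume y: "y \<in> V"
      have gyU: "g y \<in> U" using gU[OF y] IFT(2) by blast
      interpret Dh: linear "Dh (g y)" using Dh(1)[OF gU[OF y]] has_derivative_linear by blast
      have "g' y v = K (g y) v" for v using IFT(8)[OF y] K[OF gU[OF y]] F[OF gyU] by simp
      then have "(k has_derivative (\<lambda>v. Dh (g y) (K (g y) v))) (at y)"
        unfolding h(2) using has_derivative_compose[OF IFT(7)[OF y] Dh(1)[OF gU[OF y]]] by simp
      moreover have Dh_eq: "Dh (g y) w = fst w *\<^sub>R Dh (g y) (1,0) + snd w *\<^sub>R Dh (g y) (0,1)" for w
      proof -
        have "w = fst w *\<^sub>R (1,0) + snd w *\<^sub>R (0,1)" by (simp add: prod_eq_iff)
        then show ?thesis using Dh.add[of "fst w *\<^sub>R (1,0)" "snd w *\<^sub>R (0,1)"]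
          by (simp only: Dh.scaleR)
      qed
      ultimately show "(k has_derivative (\<lambda>v. fst (K (g y) v) *\<^sub>R Dh (g y) (1,0) + snd (K (g y) v) *\<^sub>R Dh (g y) (0,1))) (at y)"
        by (subst Dh_eq[symmetric])
    next
      fix v
      show "\<exists>h. smooth_on U' h \<and> (\<lambda>y. fst (K (g y) v) *\<^sub>R Dh (g y) (1,0) + snd (K (g y) v) *\<^sub>R Dh (g y) (0,1)) = (\<lambda>y. h (g y))"
      proof (intro exI[of _ "\<lambda>x. fst (K x v) *\<^sub>R Dh x (1,0) + snd (K x v) *\<^sub>R Dh x (0,1)"] conjI)
        show "smooth_on U' (\<lambda>x. fst (K x v) *\<^sub>R Dh x (1,0) + snd (K x v) *\<^sub>R Dh x (0,1))"
          using smooth_on_add[OF smooth_on_scaleR[OF Ks(1) Dh(2)] smooth_on_scaleR[OF Ks(2) Dh(2)]] .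
      qed simp
    qed
  qed (use IFT in auto)
  then show ?thesis using that IFT by blast
qed

section \<open>Lorentz geometry of bivectors\<close>

text \<open>Multiplication by the Minkowski matrix, which trades \<open>lor\<close> for the
  Euclidean inner product and so gives access to Euclidean linear algebra.\<close>

definition flip :: "real^4 \<Rightarrow> real^4" where
  "flip z = (\<chi> i. if i = 1 then - z$i else z$i)"

text \<open>Interior product of a bivector with a vector. On the bivector of an
  \<open>orthopair\<close> it exchanges the two vectors, which recovers either one from the bivector
  and the other.\<close>

definition ctr :: "real^4^4 \<Rightarrow> real^4 \<Rightarrow> real^4" where
  "ctr m z = m *v flip z"

lemma vec4_eq_iff: "(x::real^4) = y \<longleftrightarrow> x$1 = y$1 \<and> x$2 = y$2 \<and> x$3 = y$3 \<and> x$4 = y$4"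
  by (simp add: vec_eq_iff forall_4)

lemma flip_nth [simp]: "flip z $ 1 = - z$1" "flip z $ 2 = z$2" "flip z $ 3 = z$3" "flip z $ 4 = z$4"
  by (simp_all add: flip_def)

lemma inner_flip: "x \<bullet> flip z = lor x z"
  by (simp add: inner_vec_def sum_4 lor_def)

lemma lor_commute: "lor x y = lor y x"
  by (simp add: lor_def mult.commute)

lemma bounded_bilinear_lor: "bounded_bilinear lor"
  unfolding bilinear_conv_bounded_bilinear[symmetric] bilinear_def
  by (auto intro!: linearI simp: lor_def algebra_simps)

interpretation lor: bounded_bilinear lor
  by (rule bounded_bilinear_lor)

lemma bounded_bilinear_wedge: "bounded_bilinear wedge"
  unfolding bilinear_conv_bounded_bilinear[symmetric] bilinear_def
  by (auto intro!: linearI simp: wedge_def vec_eq_iff algebra_simps)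

interpretation wedge: bounded_bilinear wedge
  by (rule bounded_bilinear_wedge)

lemma bounded_bilinear_ctr: "bounded_bilinear ctr"
proof -
  have "flip (x + y) = flip x + flip y" "flip (c *\<^sub>R x) = c *\<^sub>R flip x" for x y c
    by (simp_all add: vec4_eq_iff)
  then show ?thesis
    unfolding bilinear_conv_bounded_bilinear[symmetric] bilinear_def
    by (auto intro!: linearI simp: ctr_def matrix_vector_right_distrib
        matrix_vector_mult_add_rdistrib matrix_vector_mult_scaleR scaleR_matrix_vector_assoc)
qed

interpretation ctr: bounded_bilinear ctr
  by (rule bounded_bilinear_ctr)

lemmas lor_simps = lor.add_left lor.add_right lor.diff_left lor.diff_right lor.scaleR_left lor.scaleR_right
  lor.minus_left lor.minus_right lor.zero_left lor.zero_right

lemma ctr_wedge: "ctr (wedge u v) z = lor v z *\<^sub>R u - lor u z *\<^sub>R v"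
  by (simp add: vec4_eq_iff ctr_def wedge_def matrix_vector_mult_def sum_4 lor_def algebra_simps)

lemma H3_lor: "p \<in> H3 \<Longrightarrow> lor p p = -1" and H3_pos: "p \<in> H3 \<Longrightarrow> p$1 > 0"
  by (simp_all add: H3_def)

lemma cauchy_schwarz_3:
  fixes a b c :: real
  shows "(a * x + b * y + c * z)\<^sup>2 \<le> (a\<^sup>2 + b\<^sup>2 + c\<^sup>2) * (x\<^sup>2 + y\<^sup>2 + z\<^sup>2)"
proof -
  have "(a\<^sup>2 + b\<^sup>2 + c\<^sup>2) * (x\<^sup>2 + y\<^sup>2 + z\<^sup>2) - (a * x + b * y + c * z)\<^sup>2
      = (a * y - b * x)\<^sup>2 + (a * z - c * x)\<^sup>2 + (b * z - c * y)\<^sup>2"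
    by (simp add: power2_eq_square algebra_simps)
  also have "\<dots> \<ge> 0" by simp
  finally show ?thesis by simp
qed

lemma H3_orthogonal_cauchy_schwarz:
  assumes "p \<in> H3" "lor p w = 0"
  shows "(p$1)\<^sup>2 * (w$1)\<^sup>2 \<le> ((p$1)\<^sup>2 - 1) * (lor w w + (w$1)\<^sup>2)"
proof -
  have "p$1 * w$1 = p$2 * w$2 + p$3 * w$3 + p$4 * w$4" using assms(2) by (simp add: lor_def)
  then have "(p$1)\<^sup>2 * (w$1)\<^sup>2 = (p$2 * w$2 + p$3 * w$3 + p$4 * w$4)\<^sup>2"
    by (metis power_mult_distrib)
  also have "\<dots> \<le> ((p$2)\<^sup>2 + (p$3)\<^sup>2 + (p$4)\<^sup>2) * ((w$2)\<^sup>2 + (w$3)\<^sup>2 + (w$4)\<^sup>2)"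
    by (rule cauchy_schwarz_3)
  also have "(p$2)\<^sup>2 + (p$3)\<^sup>2 + (p$4)\<^sup>2 = (p$1)\<^sup>2 - 1"
    using H3_lor[OF assms(1)] by (simp add: lor_def power2_eq_square)
  also have "(w$2)\<^sup>2 + (w$3)\<^sup>2 + (w$4)\<^sup>2 = lor w w + (w$1)\<^sup>2"
    by (simp add: lor_def power2_eq_square)
  finally show ?thesis .
qed

text \<open>If \<open>lor w w \<le> 0\<close>, the time component dominates the squared length
  \<open>S\<close> of the spatial part, and Cauchy-Schwarz gives
  \<open>(p$1)\<^sup>2 * S \<le> ((p$1)\<^sup>2 - 1) * S\<close>, so \<open>S = 0\<close>.
  Orthogonality to \<open>p\<close> then removes the time component as well.\<close>

lemma H3_orthogonal_pos:
  assumes "p \<in> H3" "lor p w = 0" "w \<noteq> 0"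
  shows "lor w w > 0"
proof (rule ccontr)
  assume neg: "\<not> lor w w > 0"
  have S: "lor w w + (w$1)\<^sup>2 = (w$2)\<^sup>2 + (w$3)\<^sup>2 + (w$4)\<^sup>2"
    by (simp add: lor_def power2_eq_square)
  have le: "(p$1)\<^sup>2 * (w$1)\<^sup>2 \<le> ((p$1)\<^sup>2 - 1) * (lor w w + (w$1)\<^sup>2)"
    by (rule H3_orthogonal_cauchy_schwarz[OF assms(1,2)])
  have "(p$1)\<^sup>2 * (lor w w + (w$1)\<^sup>2) \<le> (p$1)\<^sup>2 * (w$1)\<^sup>2"
    using neg by (intro mult_left_mono) auto
  then have "lor w w + (w$1)\<^sup>2 \<le> 0" using le by (simp add: algebra_simps)
  then have z: "(w$2)\<^sup>2 + (w$3)\<^sup>2 + (w$4)\<^sup>2 \<le> 0" using S by simp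
  moreover have "(w$2)\<^sup>2 \<ge> 0" "(w$3)\<^sup>2 \<ge> 0" "(w$4)\<^sup>2 \<ge> 0" by simp_all
  ultimately have "(w$2)\<^sup>2 = 0" "(w$3)\<^sup>2 = 0" "(w$4)\<^sup>2 = 0" by linarith+
  then have w: "w$2 = 0" "w$3 = 0" "w$4 = 0" by simp_all
  moreover have "p$1 * w$1 = 0" using assms(2) w by (simp add: lor_def)
  ultimately have "w = 0" using H3_pos[OF assms(1)] by (simp add: vec4_eq_iff)
  then show False using assms(3) by simp
qed

lemma H3_orthogonal_nonneg: "p \<in> H3 \<Longrightarrow> lor p w = 0 \<Longrightarrow> lor w w \<ge> 0"
  by (cases "w = 0") (auto simp: lor.zero_left dest: H3_orthogonal_pos)

text \<open>A unit tangent vector \<open>v\<close> at the point \<open>u\<close>, that is, the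
  initial data of a unit speed geodesic.\<close>

definition orthopair :: "real^4 \<Rightarrow> real^4 \<Rightarrow> bool" where
  "orthopair u v \<longleftrightarrow> u \<in> H3 \<and> lor u v = 0 \<and> lor v v = 1"

lemma orthopairD:
  assumes "orthopair u v"
  shows "u \<in> H3" "lor u u = -1" "lor u v = 0" "lor v u = 0" "lor v v = 1"
  using assms by (auto simp: orthopair_def H3_def lor_commute)

lemma orthopair_abs_less:
  assumes "orthopair u v" shows "\<bar>v$1\<bar> < u$1"
proof -
  have "(u$1)\<^sup>2 * (v$1)\<^sup>2 \<le> ((u$1)\<^sup>2 - 1) * (1 + (v$1)\<^sup>2)"
    using H3_orthogonal_cauchy_schwarz[of u v] assms by (simp add: orthopair_def)
  then have "\<bar>v$1\<bar>\<^sup>2 < (u$1)\<^sup>2" by (simp add: algebra_simps)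
  moreover have "0 \<le> u$1" using H3_pos orthopairD(1)[OF assms] by force
  ultimately show ?thesis by (rule power2_less_imp_less)
qed

text \<open>The range includes the null vectors \<open>u + v\<close> and \<open>u - v\<close>, whose
  time components are the denominators in the Gauss maps.\<close>

lemma orthopair_boost_pos:
  assumes "orthopair u v" "0 < a" "\<bar>b\<bar> \<le> a"
  shows "(a *\<^sub>R u + b *\<^sub>R v) $ 1 > 0"
proof -
  have "\<bar>b * v$1\<bar> \<le> a * \<bar>v$1\<bar>" using assms(3) by (simp add: abs_mult mult_right_mono)
  also have "\<dots> < a * u$1" using orthopair_abs_less[OF assms(1)] assms(2) by simp
  finally show ?thesis by (simp add: abs_less_iff)
qed

section \<open>Determinants, the cross product and Lorentz orthonormal frames\<close>

lemma vector_4: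
  "(vector [w, x, y, z] :: 'a::zero^4) $ 1 = w" "(vector [w, x, y, z] :: 'a^4) $ 2 = x"
  "(vector [w, x, y, z] :: 'a^4) $ 3 = y" "(vector [w, x, y, z] :: 'a^4) $ 4 = z"
  unfolding vector_def by simp_all

lemma det4_explicit: "det4 a b c d =
    a$1 * (b$2 * (c$3 * d$4 - c$4 * d$3) - b$3 * (c$2 * d$4 - c$4 * d$2) + b$4 * (c$2 * d$3 - c$3 * d$2))
  - a$2 * (b$1 * (c$3 * d$4 - c$4 * d$3) - b$3 * (c$1 * d$4 - c$4 * d$1) + b$4 * (c$1 * d$3 - c$3 * d$1))
  + a$3 * (b$1 * (c$2 * d$4 - c$4 * d$2) - b$2 * (c$1 * d$4 - c$4 * d$1) + b$4 * (c$1 * d$2 - c$2 * d$1))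
  - a$4 * (b$1 * (c$2 * d$3 - c$3 * d$2) - b$2 * (c$1 * d$3 - c$3 * d$1) + b$3 * (c$1 * d$2 - c$2 * d$1))"
proof -
  have f: "finite {2::4, 3, 4}" "1 \<notin> {2::4, 3, 4}" "finite {3::4, 4}" "2 \<notin> {3::4, 4}"
    "finite {4::4}" "3 \<notin> {4::4}" by auto
  show ?thesis
    unfolding det4_def det_def UNIV_4
    unfolding sum_over_permutations_insert[OF f(1,2)] sum_over_permutations_insert[OF f(3,4)]
      sum_over_permutations_insert[OF f(5,6)] permutes_sing
    by (simp add: sign_swap_id permutation_swap_id permutation_compose sign_compose sign_id
        swap_id_eq vector_4 algebra_simps)
qed

lemma det4_frame: "det4 u v (a *\<^sub>R e + b *\<^sub>R f) (c *\<^sub>R e + d *\<^sub>R f) = (a * d - b * c) * det4 u v e f"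
  by (simp add: det4_explicit algebra_simps)

lemma hcross_eq:
  assumes "p \<in> H3" "lor p z = 0"
  shows "lor (hcross p u w) z = det4 p u w z"
proof -
  \<comment> \<open>The vector of cofactors. Pairing with \<open>flip n\<close> reproduces the
    determinant, and projecting by \<open>tang p\<close> does not alter the pairing with tangent
    vectors.\<close>
  define n :: "real^4" where "n = (\<chi> i. det4 p u w (axis i 1))"
  have det: "det4 p u w z = lor (flip n) z" for z
    by (simp add: n_def lor_def det4_explicit axis_def algebra_simps)
  have "\<exists>!x. lor p x = 0 \<and> (\<forall>z. lor p z = 0 \<longrightarrow> lor x z = det4 p u w z)"
  proof (rule ex1I[of _ "tang p (flip n)"])
    show "lor p (tang p (flip n)) = 0 \<and> (\<forall>z. lor p z = 0 \<longrightarrow> lor (tang p (flip n)) z = det4 p u w z)"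
      using H3_lor[OF assms(1)] by (simp add: tang_def lor_simps det)
    fix x assume x: "lor p x = 0 \<and> (\<forall>z. lor p z = 0 \<longrightarrow> lor x z = det4 p u w z)"
    define y where "y = x - tang p (flip n)"
    have y: "lor p y = 0"
      using x H3_lor[OF assms(1)] by (simp add: y_def tang_def lor_simps)
    moreover have "lor y y = lor x y - lor (tang p (flip n)) y" by (simp add: y_def lor_simps)
    moreover have "lor (tang p (flip n)) y = det4 p u w y" using y by (simp add: tang_def lor_simps det)
    ultimately have "lor y y = 0" using x by simp
    then have "y = 0" using H3_orthogonal_pos[OF assms(1) y] by force
    then show "x = tang p (flip n)" by (simp add: y_def)
  qed
  from theI'[OF this] assms(2) show ?thesis unfolding hcross_def by blast
qed

definition frame :: "real^4 \<Rightarrow> real^4 \<Rightarrow> real^4 \<Rightarrow> real^4 \<Rightarrow> bool" where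
  "frame u v e f \<longleftrightarrow> orthopair u v \<and> lor u e = 0 \<and> lor v e = 0 \<and> lor u f = 0 \<and> lor v f = 0 \<and>
     lor e e = 1 \<and> lor f f = 1 \<and> lor e f = 0"

text \<open>The rows of \<open>C\<close> are the Lorentz dual frame, so orthonormality says that
  \<open>transpose C\<close> is a right inverse of \<open>A\<close>. It is then also a left inverse,
  which is the expansion, and the product of the determinants is one.\<close>

lemma frame_expansion_and_det:
  assumes "frame u v e f"
  shows "x = - lor u x *\<^sub>R u + lor v x *\<^sub>R v + lor e x *\<^sub>R e + lor f x *\<^sub>R f" and "det4 u v e f \<noteq> 0"
proof -
  define A :: "real^4^4" where "A = vector [u, v, e, f]"
  define C :: "real^4^4" where "C = vector [- flip u, flip v, flip e, flip f]"
  have rows: "A$1 = u" "A$2 = v" "A$3 = e" "A$4 = f" "C$1 = - flip u" "C$2 = flip v" "C$3 = flip e" "C$4 = flip f"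
    by (simp_all add: A_def C_def vector_4)
  have inner: "(A ** transpose C) $ i $ j = A$i \<bullet> C$j" for i j
    by (simp add: matrix_matrix_mult_def transpose_def inner_vec_def)
  have AC: "A ** transpose C = mat 1"
    using assms unfolding frame_def
    by (simp add: vec_eq_iff forall_4 inner rows inner_flip mat_def orthopair_def H3_def lor_commute)
  then have "det A * det (transpose C) = 1" by (metis det_I det_mul)
  then show "det4 u v e f \<noteq> 0" unfolding det4_def A_def by auto
  have "transpose C ** A = mat 1" using AC matrix_left_right_inverse by blast
  then have "transpose A ** C = mat 1"
    by (metis matrix_transpose_mul transpose_mat transpose_transpose)
  then have "x = transpose A *v (C *v x)"
    by (simp add: matrix_vector_mul_assoc)
  moreover have "(C *v x) $ j = C$j \<bullet> x" for j
    by (simp add: matrix_vector_mult_def inner_vec_def)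
  ultimately have "x $ i = (\<Sum>j\<in>UNIV. A$j$i * (C$j \<bullet> x))" for i
    by (metis (no_types, lifting) matrix_vector_mult_def sum.cong transpose_def vec_lambda_beta)
  then have "x = (C$1 \<bullet> x) *\<^sub>R A$1 + (C$2 \<bullet> x) *\<^sub>R A$2 + (C$3 \<bullet> x) *\<^sub>R A$3 + (C$4 \<bullet> x) *\<^sub>R A$4"
    by (simp add: vec_eq_iff sum_4 mult.commute)
  moreover have "flip y \<bullet> x = lor y x" for y by (metis inner_commute inner_flip lor_commute)
  ultimately show "x = - lor u x *\<^sub>R u + lor v x *\<^sub>R v + lor e x *\<^sub>R e + lor f x *\<^sub>R f"
    by (simp add: rows)
qed

lemma frame_expansion:
  assumes "frame u v e f" "lor u x = 0" "lor v x = 0"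
  shows "x = lor e x *\<^sub>R e + lor f x *\<^sub>R f"
  using frame_expansion_and_det(1)[OF assms(1), of x] assms(2,3) by simp

text \<open>Fewer than four vectors leave a nonzero vector orthogonal to all of them. Since one of
  them lies in \<open>H3\<close>, that vector is spacelike and can be normalised.\<close>

lemma exists_unit_orthogonal:
  fixes S :: "(real^4) set"
  assumes "finite S" "card S < 4" "u \<in> S" "u \<in> H3"
  obtains e where "lor e e = 1" "\<And>y. y \<in> S \<Longrightarrow> lor y e = 0"
proof -
  have "dim (flip ` S) \<le> card (flip ` S)" by (rule dim_le_card') (use assms in simp)
  also have "\<dots> < 4" using card_image_le[OF assms(1), of flip] assms(2) by linarith
  finally have "dim (flip ` S) < DIM(real^4)" by simp
  then obtain x where x: "x \<noteq> 0" "\<And>y. y \<in> span (flip ` S) \<Longrightarrow> orthogonal x y"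
    using orthogonal_to_subspace_exists by blast
  have xS: "lor y x = 0" if "y \<in> S" for y
    using x(2)[of "flip y"] that by (simp add: span_base orthogonal_def inner_flip lor_commute)
  have "lor x x > 0" using H3_orthogonal_pos[OF assms(4) xS[OF assms(3)] x(1)] .
  then show ?thesis
    by (intro that[of "(1 / sqrt (lor x x)) *\<^sub>R x"]) (auto simp: lor_simps xS)
qed

lemma frame_exists:
  assumes "orthopair u v"
  obtains e f where "frame u v e f"
proof -
  have u: "u \<in> H3" using assms orthopairD by blast
  obtain e where e: "lor e e = 1" "\<And>y. y \<in> {u, v} \<Longrightarrow> lor y e = 0"
    by (rule exists_unit_orthogonal[of "{u, v}" u]) (use u in \<open>auto simp: card_insert_if\<close>)
  have "card {u, v, e} \<le> 3" by (simp add: card_insert_if)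
  then obtain f where f: "lor f f = 1" "\<And>y. y \<in> {u, v, e} \<Longrightarrow> lor y f = 0"
    using exists_unit_orthogonal[of "{u, v, e}" u] u by auto
  show ?thesis using that[of e f] assms e f by (simp add: frame_def)
qed

lemma sinh_cosh_param:
  assumes "a\<^sup>2 - b\<^sup>2 = 1" "a > 0"
  shows "\<exists>t::real. a = cosh t \<and> b = sinh t"
proof (intro exI conjI)
  have "cosh (arsinh b) = sqrt (b\<^sup>2 + 1)" by (rule cosh_arsinh_real)
  also have "\<dots> = a" using assms by (intro real_sqrt_unique) auto
  finally show "a = cosh (arsinh b)" by simp
qed simp

text \<open>Sliding along a geodesic changes position and velocity by a matrix of determinant one,
  so the bivector belongs to the oriented geodesic and not to its parametrisation.\<close>

lemma wedge_boost: "wedge (cosh t *\<^sub>R u + sinh t *\<^sub>R v) (sinh t *\<^sub>R u + cosh t *\<^sub>R v) = wedge u v" for t :: real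
proof -
  have "wedge (cosh t *\<^sub>R u + sinh t *\<^sub>R v) (sinh t *\<^sub>R u + cosh t *\<^sub>R v)
      = ((cosh t)\<^sup>2 - (sinh t)\<^sup>2) *\<^sub>R wedge u v"
    by (simp add: wedge_def vec_eq_iff power2_eq_square algebra_simps)
  then show ?thesis by (simp only: hyperbolic_pythagoras scaleR_one)
qed

text \<open>Contraction with \<open>v\<close> returns \<open>X\<close>, and contraction with
  \<open>u\<close> returns \<open>Y\<close>.\<close>

lemma wedge_tangent_inject:
  assumes "orthopair u v" "lor u X = 0" "lor v X = 0" "lor u Y = 0" "lor v Y = 0"
    "lor u X' = 0" "lor v X' = 0" "lor u Y' = 0" "lor v Y' = 0"
  shows "wedge X v + wedge u Y = wedge X' v + wedge u Y' \<longleftrightarrow> X = X' \<and> Y = Y'"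
proof
  assume eq: "wedge X v + wedge u Y = wedge X' v + wedge u Y'"
  have *: "ctr (wedge X v + wedge u Y) v = X" "ctr (wedge X v + wedge u Y) u = Y"
    if "lor u X = 0" "lor v X = 0" "lor u Y = 0" "lor v Y = 0" for X Y
    using that orthopairD[OF assms(1)] by (simp_all add: ctr.add_left ctr_wedge lor_commute)
  from *[OF assms(2-5)] *[OF assms(6-9)] eq show "X = X' \<and> Y = Y'" by metis
qed simp

text \<open>The null vectors \<open>u + v\<close> of an oriented plane span the eigenline of the
  contraction for the eigenvalue 1.\<close>

lemma wedge_eq_null:
  assumes uv: "orthopair u v" and uv': "orthopair u' v'" and eq: "wedge u v = wedge u' v'"
  shows "\<exists>c. u' + v' = c *\<^sub>R (u + v)"
proof -
  note o = orthopairD[OF uv] and o' = orthopairD[OF uv']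
  define a b where "a = lor v (u' + v')" and "b = lor u (u' + v')"
  have "u' + v' = ctr (wedge u' v') (u' + v')"
    using o' by (simp add: ctr_wedge lor_simps)
  also have "\<dots> = a *\<^sub>R u - b *\<^sub>R v" by (simp add: eq[symmetric] ctr_wedge a_def b_def)
  finally have w: "u' + v' = a *\<^sub>R u - b *\<^sub>R v" .
  have "a = lor v (a *\<^sub>R u - b *\<^sub>R v)" using arg_cong[OF w, of "lor v"] by (simp only: a_def)
  also have "\<dots> = - b" using o by (simp add: lor_simps)
  finally show ?thesis using w by (intro exI[of _ a]) (simp add: scaleR_right_distrib)
qed

section \<open>Geodesics, Jacobi fields and the two metrics\<close>

lemma smooth_on_lor: "smooth_on U f \<Longrightarrow> smooth_on U g \<Longrightarrow> smooth_on U (\<lambda>x. lor (f x) (g x))"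
  by (rule smooth_on_bilinear[OF bounded_bilinear_lor])

lemma smooth_on_wedge: "smooth_on U f \<Longrightarrow> smooth_on U g \<Longrightarrow> smooth_on U (\<lambda>x. wedge (f x) (g x))"
  by (rule smooth_on_bilinear[OF bounded_bilinear_wedge])

lemma smooth_on_ctr: "smooth_on U f \<Longrightarrow> smooth_on U g \<Longrightarrow> smooth_on U (\<lambda>x. ctr (f x) (g x))"
  by (rule smooth_on_bilinear[OF bounded_bilinear_ctr])

lemma smooth_on_vector_derivative:
  fixes c :: "real \<Rightarrow> 'a::real_normed_vector"
  assumes "smooth_on U c"
  shows "t \<in> U \<Longrightarrow> (c has_vector_derivative vector_derivative c (at t)) (at t)"
    and "smooth_on U (\<lambda>t. vector_derivative c (at t))"
proof -
  obtain D where D: "\<And>x. x \<in> U \<Longrightarrow> (c has_derivative D x) (at x)" "\<And>v. smooth_on U (\<lambda>x. D x v)"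
    using smooth_on_derivative[OF assms] by blast
  have *: "(c has_vector_derivative D t 1) (at t)" if "t \<in> U" for t
  proof -
    have "D t s = s *\<^sub>R D t 1" for s
      using linear.scaleR[OF has_derivative_linear[OF D(1)[OF that]], of s 1] by simp
    then have "D t = (\<lambda>s. s *\<^sub>R D t 1)" by blast
    then show ?thesis using D(1)[OF that] unfolding has_vector_derivative_def by simp
  qed
  then have eq: "vector_derivative c (at t) = D t 1" if "t \<in> U" for t
    using that vector_derivative_at by blast
  show "t \<in> U \<Longrightarrow> (c has_vector_derivative vector_derivative c (at t)) (at t)" using * eq by simp
  show "smooth_on U (\<lambda>t. vector_derivative c (at t))"
    using smooth_on_cong[OF D(2)[of 1]] eq by simp
qed

lemma has_vector_derivative_lor:
  "(f has_vector_derivative f') (at t) \<Longrightarrow> (g has_vector_derivative g') (at t) \<Longrightarrow>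
   ((\<lambda>t. lor (f t) (g t)) has_vector_derivative lor (f t) g' + lor f' (g t)) (at t)"
  by (rule bounded_bilinear.has_vector_derivative[OF bounded_bilinear_lor])

lemma has_vector_derivative_wedge:
  "(f has_vector_derivative f') (at t) \<Longrightarrow> (g has_vector_derivative g') (at t) \<Longrightarrow>
   ((\<lambda>t. wedge (f t) (g t)) has_vector_derivative wedge (f t) g' + wedge f' (g t)) (at t)"
  by (rule bounded_bilinear.has_vector_derivative[OF bounded_bilinear_wedge])

lemma lor_constant_derivative:
  assumes "(f has_vector_derivative f') (at t)" "(g has_vector_derivative g') (at t)"
    and "eventually (\<lambda>s. lor (f s) (g s) = c) (nhds t)"
  shows "lor (f t) g' + lor f' (g t) = 0"
proof -
  have "((\<lambda>s. lor (f s) (g s)) has_vector_derivative 0) (at t)"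
  proof -
    obtain S where "open S" "t \<in> S" "\<forall>s\<in>S. lor (f s) (g s) = c"
      using assms(3) unfolding eventually_nhds by blast
    then show ?thesis
      by (intro has_vector_derivative_transform_within_open[OF has_vector_derivative_const[of c]]) auto
  qed
  then show ?thesis
    using has_vector_derivative_lor[OF assms(1,2)] vector_derivative_unique_at by blast
qed

text \<open>\<open>a\<close> and \<open>b\<close> undo the hyperbolic rotation of the pair
  \<open>(f, f')\<close> and are therefore constant.\<close>

lemma hyperbolic_ode:
  fixes f :: "real \<Rightarrow> 'a::real_normed_vector"
  assumes "\<And>t. (f has_vector_derivative f' t) (at t)" "\<And>t. (f' has_vector_derivative f t) (at t)"
  shows "f t = cosh t *\<^sub>R f 0 + sinh t *\<^sub>R f' 0" "f' t = sinh t *\<^sub>R f 0 + cosh t *\<^sub>R f' 0"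
proof -
  define a where "a t = cosh t *\<^sub>R f t - sinh t *\<^sub>R f' t" for t
  define b where "b t = cosh t *\<^sub>R f' t - sinh t *\<^sub>R f t" for t
  have "(a has_vector_derivative 0) (at t)" "(b has_vector_derivative 0) (at t)" for t
    unfolding a_def b_def by (auto intro!: derivative_eq_intros assms)
  then have "a t = a 0" "b t = b 0"
    using has_vector_derivative_zero_constant[of UNIV a] has_vector_derivative_zero_constant[of UNIV b]
    by (metis UNIV_I convex_UNIV)+
  then have "cosh t *\<^sub>R a t + sinh t *\<^sub>R b t = cosh t *\<^sub>R f 0 + sinh t *\<^sub>R f' 0"
    "sinh t *\<^sub>R a t + cosh t *\<^sub>R b t = sinh t *\<^sub>R f 0 + cosh t *\<^sub>R f' 0"
    by (simp_all add: a_def b_def)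
  moreover have "cosh t *\<^sub>R a t + sinh t *\<^sub>R b t = ((cosh t)\<^sup>2 - (sinh t)\<^sup>2) *\<^sub>R f t"
    "sinh t *\<^sub>R a t + cosh t *\<^sub>R b t = ((cosh t)\<^sup>2 - (sinh t)\<^sup>2) *\<^sub>R f' t"
    by (simp_all add: a_def b_def algebra_simps power2_eq_square)
  ultimately show "f t = cosh t *\<^sub>R f 0 + sinh t *\<^sub>R f' 0" "f' t = sinh t *\<^sub>R f 0 + cosh t *\<^sub>R f' 0"
    by (simp_all only: hyperbolic_pythagoras scaleR_one)
qed

lemma has_vector_derivative_hyperbolic:
  "((\<lambda>t. cosh t *\<^sub>R u + sinh t *\<^sub>R v) has_vector_derivative sinh t *\<^sub>R u + cosh t *\<^sub>R v) (at t)"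
  "((\<lambda>t. sinh t *\<^sub>R u + cosh t *\<^sub>R v) has_vector_derivative cosh t *\<^sub>R u + sinh t *\<^sub>R v) (at t)"
  by (auto intro!: derivative_eq_intros)

lemma smooth_on_hyperbolic:
  "smooth_on UNIV (\<lambda>t::real. cosh t *\<^sub>R u + sinh t *\<^sub>R v)"
  by (intro smooth_on_add smooth_on_scaleR smooth_on_cosh_sinh smooth_on_const open_UNIV)

text \<open>Differentiating \<open>lor \<gamma> \<gamma> = -1\<close> twice shows that the
  acceleration has normal part \<open>\<gamma>\<close>. The geodesic equation kills its tangential
  part, so \<open>\<gamma>'' = \<gamma>\<close> remains.\<close>

lemma unit_geodD:
  assumes "unit_geod \<gamma>"
  shows "(\<gamma> has_vector_derivative vel \<gamma> t) (at t)" "(vel \<gamma> has_vector_derivative \<gamma> t) (at t)"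
    "\<gamma> t = cosh t *\<^sub>R \<gamma> 0 + sinh t *\<^sub>R vel \<gamma> 0" "vel \<gamma> t = sinh t *\<^sub>R \<gamma> 0 + cosh t *\<^sub>R vel \<gamma> 0"
    "orthopair (\<gamma> t) (vel \<gamma> t)"
proof -
  note g = assms[unfolded unit_geod_def]
  have vel: "vel \<gamma> = (\<lambda>t. vector_derivative \<gamma> (at t))" by (simp add: vel_def fun_eq_iff)
  have s: "smooth_on UNIV \<gamma>" using g by blast
  have d1: "(\<gamma> has_vector_derivative vel \<gamma> t) (at t)" for t
    using smooth_on_vector_derivative(1)[OF s] by (simp add: vel)
  have d2: "(vel \<gamma> has_vector_derivative vector_derivative (vel \<gamma>) (at t)) (at t)" for t
    using smooth_on_vector_derivative(1)[of UNIV "vel \<gamma>"] smooth_on_vector_derivative(2)[OF s] by (simp add: vel)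
  have "lor (\<gamma> t) (\<gamma> t) = -1" for t using g H3_lor by blast
  then have "lor (\<gamma> t) (vel \<gamma> t) + lor (vel \<gamma> t) (\<gamma> t) = 0" for t
    using lor_constant_derivative[OF d1 d1] by simp
  then have o: "lor (\<gamma> t) (vel \<gamma> t) = 0" for t by (simp add: lor_commute)
  then have "lor (\<gamma> t) (vector_derivative (vel \<gamma>) (at t)) + lor (vel \<gamma> t) (vel \<gamma> t) = 0" for t
    using lor_constant_derivative[OF d1 d2] by simp
  then have "lor (\<gamma> t) (vector_derivative (vel \<gamma>) (at t)) = -1" for t using g by (simp add: add_eq_0_iff)
  moreover have "covD \<gamma> (vel \<gamma>) t = 0" for t using g by blast
  ultimately have acc: "vector_derivative (vel \<gamma>) (at t) = \<gamma> t" for t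
    by (simp add: covD_def tang_def)
  show "(\<gamma> has_vector_derivative vel \<gamma> t) (at t)" by (rule d1)
  have d2': "(vel \<gamma> has_vector_derivative \<gamma> t) (at t)" for t using d2 acc by simp
  then show "(vel \<gamma> has_vector_derivative \<gamma> t) (at t)" .
  show "\<gamma> t = cosh t *\<^sub>R \<gamma> 0 + sinh t *\<^sub>R vel \<gamma> 0" "vel \<gamma> t = sinh t *\<^sub>R \<gamma> 0 + cosh t *\<^sub>R vel \<gamma> 0"
    using hyperbolic_ode[of \<gamma> "vel \<gamma>", OF d1 d2'] by blast+
  show "orthopair (\<gamma> t) (vel \<gamma> t)" using g o by (simp add: orthopair_def)
qed

lemma orthopair_boost:
  assumes "orthopair u v"
  shows "orthopair (cosh t *\<^sub>R u + sinh t *\<^sub>R v) (sinh t *\<^sub>R u + cosh t *\<^sub>R v)"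
proof -
  note o = orthopairD[OF assms]
  have h: "(cosh t)\<^sup>2 - (sinh t)\<^sup>2 = 1" by (rule hyperbolic_pythagoras)
  have "(cosh t *\<^sub>R u + sinh t *\<^sub>R v) $ 1 > 0"
    by (rule orthopair_boost_pos[OF assms]) (use sinh_le_cosh_real[of t] sinh_le_cosh_real[of "- t"] in \<open>simp_all add: abs_le_iff\<close>)
  then show ?thesis
    using o h by (simp add: orthopair_def H3_def lor_simps power2_eq_square)
qed

lemma unit_geod_hyperbolic:
  assumes "orthopair u v"
  defines "\<gamma> \<equiv> \<lambda>t. cosh t *\<^sub>R u + sinh t *\<^sub>R v"
  shows "unit_geod \<gamma>" "\<gamma> 0 = u" "vel \<gamma> t = sinh t *\<^sub>R u + cosh t *\<^sub>R v"
proof -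
  have vel: "vel \<gamma> = (\<lambda>t. sinh t *\<^sub>R u + cosh t *\<^sub>R v)"
    using has_vector_derivative_hyperbolic(1) unfolding vel_def \<gamma>_def fun_eq_iff
    by (blast intro: vector_derivative_at)
  then show "vel \<gamma> t = sinh t *\<^sub>R u + cosh t *\<^sub>R v" by simp
  have acc: "vector_derivative (vel \<gamma>) (at t) = \<gamma> t" for t
    unfolding vel unfolding \<gamma>_def by (rule vector_derivative_at) (rule has_vector_derivative_hyperbolic(2))
  have o: "orthopair (\<gamma> t) (vel \<gamma> t)" for t unfolding vel unfolding \<gamma>_def by (rule orthopair_boost[OF assms(1)])
  show "unit_geod \<gamma>"
    unfolding unit_geod_def covD_def acc tang_def
    using orthopairD[OF o] smooth_on_hyperbolic[of u v, folded \<gamma>_def] by simp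
  show "\<gamma> 0 = u" by (simp add: \<gamma>_def)
qed

definition jacobi_data :: "(real \<Rightarrow> real^4) \<Rightarrow> real^4 \<Rightarrow> real^4 \<Rightarrow> bool" where
  "jacobi_data \<gamma> X Y \<longleftrightarrow> lor (\<gamma> 0) X = 0 \<and> lor (vel \<gamma> 0) X = 0 \<and> lor (\<gamma> 0) Y = 0 \<and> lor (vel \<gamma> 0) Y = 0"

text \<open>Orthogonality to \<open>\<gamma>\<close> and \<open>vel \<gamma>\<close> makes both
  covariant derivatives ordinary ones, and the curvature term is \<open>- J\<close>. In the ambient
  space the Jacobi equation is thus \<open>J'' = J\<close>.\<close>

lemma normal_jacobiD:
  assumes \<gamma>: "unit_geod \<gamma>" and J: "normal_jacobi \<gamma> J"
  shows "J = (\<lambda>t. cosh t *\<^sub>R J 0 + sinh t *\<^sub>R covD \<gamma> J 0)" "jacobi_data \<gamma> (J 0) (covD \<gamma> J 0)"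
proof -
  note J' = J[unfolded normal_jacobi_def]
  define K where "K t = vector_derivative J (at t)" for t
  define L where "L t = vector_derivative K (at t)" for t
  have s: "smooth_on UNIV J" using J' by blast
  have sK: "smooth_on UNIV K" unfolding K_def[abs_def] by (rule smooth_on_vector_derivative(2)[OF s])
  have dJ: "(J has_vector_derivative K t) (at t)" for t
    unfolding K_def using smooth_on_vector_derivative(1)[OF s] by simp
  have dK: "(K has_vector_derivative L t) (at t)" for t
    unfolding L_def using smooth_on_vector_derivative(1)[OF sK] by simp
  note d\<gamma> = unit_geodD(1,2)[OF \<gamma>]
  have oJ: "lor (\<gamma> t) (J t) = 0" "lor (J t) (vel \<gamma> t) = 0" for t using J' by auto
  have "lor (\<gamma> t) (K t) + lor (vel \<gamma> t) (J t) = 0" for t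
    using lor_constant_derivative[OF d\<gamma>(1) dJ] oJ by simp
  then have oK1: "lor (\<gamma> t) (K t) = 0" for t using oJ by (simp add: lor_commute)
  have "lor (J t) (\<gamma> t) + lor (K t) (vel \<gamma> t) = 0" for t
    using lor_constant_derivative[OF dJ d\<gamma>(2)] oJ by simp
  then have oK2: "lor (vel \<gamma> t) (K t) = 0" for t using oJ by (simp add: lor_commute)
  have cov: "covD \<gamma> J = K"
    using oK1 by (simp add: covD_def tang_def K_def fun_eq_iff)
  have "lor (\<gamma> t) (L t) + lor (vel \<gamma> t) (K t) = 0" for t
    using lor_constant_derivative[OF d\<gamma>(1) dK] oK1 by simp
  then have "covD \<gamma> K t = L t" for t
    using oK2 by (simp add: covD_def tang_def L_def)
  moreover have "covD \<gamma> K t + hypR (J t) (vel \<gamma> t) (vel \<gamma> t) = 0" for t using J' cov by metis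
  ultimately have "L t = J t" for t
    using oJ orthopairD(5)[OF unit_geodD(5)[OF \<gamma>]] by (simp add: hypR_def)
  then have dK': "(K has_vector_derivative J t) (at t)" for t using dK[of t] by simp
  show "J = (\<lambda>t. cosh t *\<^sub>R J 0 + sinh t *\<^sub>R covD \<gamma> J 0)"
    unfolding cov by (rule ext) (rule hyperbolic_ode(1)[OF dJ dK'])
  show "jacobi_data \<gamma> (J 0) (covD \<gamma> J 0)"
    using oJ oK1 oK2 cov by (simp add: jacobi_data_def lor_commute)
qed

lemma normal_jacobi_hyperbolic:
  assumes \<gamma>: "unit_geod \<gamma>" and XY: "jacobi_data \<gamma> X Y"
  defines "J \<equiv> \<lambda>t. cosh t *\<^sub>R X + sinh t *\<^sub>R Y"
  shows "normal_jacobi \<gamma> J" "J 0 = X" "covD \<gamma> J 0 = Y"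
proof -
  define K where "K t = sinh t *\<^sub>R X + cosh t *\<^sub>R Y" for t
  have o: "lor (\<gamma> t) (J t) = 0" "lor (vel \<gamma> t) (J t) = 0" "lor (\<gamma> t) (K t) = 0" for t
    unfolding J_def K_def unit_geodD(3,4)[OF \<gamma>, of t] using XY by (simp_all add: jacobi_data_def lor_simps)
  have "vector_derivative J (at t) = K t" for t
    unfolding J_def K_def by (rule vector_derivative_at) (rule has_vector_derivative_hyperbolic)
  then have cov: "covD \<gamma> J = K" using o by (simp add: covD_def tang_def fun_eq_iff)
  have "vector_derivative K (at t) = J t" for t
    unfolding J_def K_def[abs_def] by (rule vector_derivative_at) (rule has_vector_derivative_hyperbolic)
  then have "covD \<gamma> K t = J t" for t using o by (simp add: covD_def tang_def)
  then show "normal_jacobi \<gamma> J"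
    unfolding normal_jacobi_def cov hypR_def
    using o smooth_on_hyperbolic orthopairD(5)[OF unit_geodD(5)[OF \<gamma>]]
    by (simp add: lor_commute) (simp add: J_def smooth_on_hyperbolic)
  show "J 0 = X" by (simp add: J_def)
  show "covD \<gamma> J 0 = Y" by (simp add: cov K_def)
qed

section \<open>Curves and variations with prescribed velocities\<close>

lemma orthopair_normalise:
  assumes "u \<in> H3" "lor u x = 0" "lor x x = r\<^sup>2" "r \<noteq> 0"
  shows "orthopair u ((1 / r) *\<^sub>R x)"
  using assms by (simp add: orthopair_def lor_simps power2_eq_square)

text \<open>The coefficient of \<open>u\<close> restores the norm \<open>-1\<close>: the sum is the
  point of the hyperboloid over the tangent vector \<open>X\<close>.\<close>

lemma H3_plane:
  assumes u: "u \<in> H3" and X: "lor u X = 0"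
  shows "sqrt (1 + lor X X) *\<^sub>R u + X \<in> H3"
proof (cases "X = 0")
  case True
  then show ?thesis using u by (simp add: lor.zero_left)
next
  case False
  define r where "r = sqrt (lor X X)"
  have pos: "lor X X > 0" by (rule H3_orthogonal_pos[OF u X False])
  then have r: "r > 0" "r\<^sup>2 = lor X X" by (simp_all add: r_def)
  have "orthopair u ((1 / r) *\<^sub>R X)" using u X r by (intro orthopair_normalise) simp_all
  then have "(sqrt (1 + lor X X) *\<^sub>R u + r *\<^sub>R ((1 / r) *\<^sub>R X)) $ 1 > 0"
    using r pos by (intro orthopair_boost_pos) (auto simp: r_def)
  then have "(sqrt (1 + lor X X) *\<^sub>R u + X) $ 1 > 0" using r by simp
  moreover have "(sqrt (1 + lor X X))\<^sup>2 = 1 + lor X X" using pos by simp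
  then have "lor (sqrt (1 + lor X X) *\<^sub>R u + X) (sqrt (1 + lor X X) *\<^sub>R u + X) = -1"
    using X H3_lor[OF u] by (simp add: lor_simps lor_commute[of X u] power2_eq_square)
  ultimately show ?thesis by (simp add: H3_def)
qed

text \<open>A variation with prescribed initial velocities: move along \<open>a\<close> and orthonormalise \<open>v + s Y\<close>
  against \<open>a s\<close>. The normalising factors never vanish, so the variation is defined for all \<open>s\<close>.\<close>

lemma orthopair_variation:
  assumes uv: "orthopair u v" and X: "lor u X = 0" "lor v X = 0" and Y: "lor u Y = 0" "lor v Y = 0"
  obtains a b where "smooth_on UNIV a" "smooth_on UNIV b" "\<And>s::real. orthopair (a s) (b s)"
    "a 0 = u" "b 0 = v" "(a has_vector_derivative X) (at 0)" "(b has_vector_derivative Y) (at 0)"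
proof -
  note o = orthopairD[OF uv]
  have X0: "lor X X \<ge> 0" "lor Y Y \<ge> 0" using H3_orthogonal_nonneg o(1) X Y by auto
  have sq: "0 \<le> s\<^sup>2 * lor X X" for s using X0 by simp
  define a where "a s = sqrt (1 + s\<^sup>2 * lor X X) *\<^sub>R u + s *\<^sub>R X" for s
  define w where "w s = v + s *\<^sub>R Y + (s\<^sup>2 * lor X Y) *\<^sub>R a s" for s
  \<comment> \<open>The squared norm of \<open>w s\<close>. Because
    \<open>lor (a s) (a s) = -1\<close>, making \<open>w s\<close> orthogonal to \<open>a s\<close>
    adds the square of the correction coefficient instead of subtracting it, which keeps
    \<open>n s\<close> positive.\<close>
  define n where "n s = 1 + s\<^sup>2 * lor Y Y + (s\<^sup>2 * lor X Y)\<^sup>2" for s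
  define b where "b s = inverse (sqrt (n s)) *\<^sub>R w s" for s
  have np: "n s > 0" for s
  proof -
    have "0 \<le> s\<^sup>2 * lor Y Y + (s\<^sup>2 * lor X Y)\<^sup>2" using X0 by simp
    then show ?thesis by (simp add: n_def)
  qed
  have aH3: "a s \<in> H3" for s
    using H3_plane[OF o(1), of "s *\<^sub>R X"] X by (simp add: a_def lor_simps power2_eq_square mult.assoc)
  have aa: "lor (a s) (a s) = -1" for s by (rule H3_lor[OF aH3])
  have av: "lor (a s) v = 0" "lor (a s) Y = s * lor X Y" for s
    using o X Y by (simp_all add: a_def lor_simps lor_commute[of X v])
  have aw: "lor (a s) (w s) = 0" for s
    by (simp add: w_def lor_simps aa av power2_eq_square)
  have "lor (w s) (w s) = n s" for s
    using o Y av[of s] aa[of s]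
    by (simp add: w_def lor_simps lor_commute[of v "a s"] lor_commute[of Y "a s"] lor_commute[of Y v] n_def power2_eq_square algebra_simps)
  then have bb: "lor (b s) (b s) = 1" for s
    using np[of s] by (simp add: b_def lor_simps field_simps)
  have ab: "orthopair (a s) (b s)" for s
    using aH3 aw bb by (simp add: orthopair_def b_def lor_simps)
  have sm: "smooth_on UNIV (\<lambda>s::real. s\<^sup>2 * c)" for c
    unfolding power2_eq_square by (intro smooth_on_mult smooth_on_id smooth_on_const open_UNIV)
  have sa: "smooth_on UNIV a"
    unfolding a_def[abs_def] using sq
    by (intro smooth_on_add smooth_on_scaleR smooth_on_sqrt sm smooth_on_const smooth_on_id open_UNIV)
      (auto intro: add_pos_nonneg)
  have sw: "smooth_on UNIV w"
    unfolding w_def[abs_def] by (intro smooth_on_add smooth_on_scaleR sm sa smooth_on_const smooth_on_id open_UNIV)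
  have sn: "smooth_on UNIV n"
    unfolding n_def[abs_def] power2_eq_square[of "_ * lor X Y"]
    by (intro smooth_on_add smooth_on_mult sm smooth_on_const open_UNIV)
  have sb: "smooth_on UNIV b"
    unfolding b_def[abs_def] using np by (intro smooth_on_scaleR smooth_on_inverse smooth_on_sqrt sn sw) (auto simp: less_imp_neq[THEN not_sym])
  have da: "(a has_vector_derivative X) (at 0)"
    unfolding a_def[abs_def] by (auto intro!: derivative_eq_intros)
  have dw: "(w has_vector_derivative Y) (at 0)"
    unfolding w_def[abs_def] by (auto intro!: derivative_eq_intros da)
  have dn: "((\<lambda>s. inverse (sqrt (n s))) has_real_derivative 0) (at 0)"
    unfolding n_def[abs_def] by (auto intro!: derivative_eq_intros)
  have "((\<lambda>s. inverse (sqrt (n s)) *\<^sub>R w s) has_vector_derivative inverse (sqrt (n 0)) *\<^sub>R Y + 0 *\<^sub>R w 0) (at 0)"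
    by (rule has_vector_derivative_scaleR[OF dn dw])
  then have db: "(b has_vector_derivative Y) (at 0)" by (simp add: b_def[abs_def] n_def)
  show ?thesis
    by (rule that[OF sa sb ab _ _ da db]) (simp_all add: a_def b_def w_def n_def)
qed

lemma H3_curve:
  assumes "orthopair p v" "lor p X = 0"
  obtains c where "smooth_on UNIV c" "\<And>s::real. c s \<in> H3" "c 0 = p" "(c has_vector_derivative X) (at 0)"
proof (cases "X = 0")
  case True
  then show ?thesis using that[of "\<lambda>s. p"] assms orthopairD(1) smooth_on_const[OF open_UNIV] by fastforce
next
  case False
  have p: "p \<in> H3" using assms orthopairD by blast
  have pos: "lor X X > 0" by (rule H3_orthogonal_pos[OF p assms(2) False])
  define k where "k = sqrt (lor X X)"
  have k: "k > 0" "k\<^sup>2 = lor X X" using pos by (simp_all add: k_def)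
  define e where "e = (1 / k) *\<^sub>R X"
  have e: "orthopair p e" unfolding e_def by (rule orthopair_normalise[OF p assms(2)]) (use k in auto)
  define c where "c s = cosh (k * s) *\<^sub>R p + sinh (k * s) *\<^sub>R e" for s
  have "smooth_on UNIV (\<lambda>s. k * s)" by (intro smooth_on_mult smooth_on_const smooth_on_id open_UNIV)
  from smooth_on_compose[OF this smooth_on_hyperbolic] have "smooth_on UNIV c" by (simp add: c_def[abs_def])
  moreover have "(c has_vector_derivative X) (at 0)"
    unfolding c_def[abs_def] using k by (auto intro!: derivative_eq_intros simp: e_def)
  moreover have "c s \<in> H3" for s using orthopairD(1)[OF orthopair_boost[OF e]] by (simp add: c_def)
  ultimately show ?thesis using that[of c] by (simp add: c_def)
qed

text \<open>The formula is the product rule for \<open>pl\<close>. An explicit variation shows that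
  the choice is not void; its independence of the variation requires controlling how the initial
  velocity of an arbitrary variation depends on \<open>s\<close>.\<close>

lemma Tmap_eq:
  assumes \<gamma>: "unit_geod \<gamma>" and J: "normal_jacobi \<gamma> J"
  shows "Tmap \<gamma> J = wedge (J 0) (vel \<gamma> 0) + wedge (\<gamma> 0) (covD \<gamma> J 0)"
proof -
  define Y where "Y = covD \<gamma> J 0"
  have Jt: "J = (\<lambda>t. cosh t *\<^sub>R J 0 + sinh t *\<^sub>R Y)" and data: "jacobi_data \<gamma> (J 0) Y"
    using normal_jacobiD[OF \<gamma> J] by (auto simp: Y_def)
  let ?P = "\<lambda>X. \<exists>\<Gamma>. geod_var \<Gamma> \<gamma> \<and> var_field \<Gamma> = J \<and> ((\<lambda>s. pl (\<Gamma> s)) has_vector_derivative X) (at 0)"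
  have ex: "?P (wedge (J 0) (vel \<gamma> 0) + wedge (\<gamma> 0) Y)"
  proof -
    obtain a b where ab: "smooth_on UNIV a" "smooth_on UNIV b" "\<And>s::real. orthopair (a s) (b s)"
      "a 0 = \<gamma> 0" "b 0 = vel \<gamma> 0" "(a has_vector_derivative J 0) (at 0)" "(b has_vector_derivative Y) (at 0)"
      using orthopair_variation[OF unit_geodD(5)[OF \<gamma>, of 0], of "J 0" Y] data unfolding jacobi_data_def by metis
    define \<Gamma> where "\<Gamma> s t = cosh t *\<^sub>R a s + sinh t *\<^sub>R b s" for s t
    note geo = unit_geod_hyperbolic[OF ab(3)]
    have "smooth_on UNIV (\<lambda>z::real\<times>real. \<Gamma> (fst z) (snd z))"
      unfolding \<Gamma>_def
      by (intro smooth_on_add smooth_on_scaleR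
          smooth_on_compose[OF smooth_on_linear[OF bounded_linear_snd open_UNIV] smooth_on_cosh_sinh(1)]
          smooth_on_compose[OF smooth_on_linear[OF bounded_linear_snd open_UNIV] smooth_on_cosh_sinh(2)]
          smooth_on_compose[OF smooth_on_linear[OF bounded_linear_fst open_UNIV] ab(1)]
          smooth_on_compose[OF smooth_on_linear[OF bounded_linear_fst open_UNIV] ab(2)]) auto
    moreover have "\<forall>s. unit_geod (\<Gamma> s)" using geo(1) by (simp add: \<Gamma>_def[abs_def])
    moreover have "\<Gamma> 0 = \<gamma>" unfolding \<Gamma>_def[abs_def] ab(4,5) by (rule ext) (rule unit_geodD(3)[OF \<gamma>, symmetric])
    ultimately have "geod_var \<Gamma> \<gamma>" by (simp add: geod_var_def)
    moreover have "var_field \<Gamma> = J"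
    proof
      fix t
      have "((\<lambda>s. \<Gamma> s t) has_vector_derivative cosh t *\<^sub>R J 0 + sinh t *\<^sub>R Y) (at 0)"
        unfolding \<Gamma>_def by (auto intro!: derivative_eq_intros ab)
      then show "var_field \<Gamma> t = J t" unfolding var_field_def by (subst Jt) (rule vector_derivative_at)
    qed
    moreover have "pl (\<Gamma> s) = wedge (a s) (b s)" for s
      using geo(2,3)[of s] by (simp add: pl_def \<Gamma>_def[abs_def])
    ultimately show ?thesis
      using has_vector_derivative_wedge[OF ab(6,7)] ab(4,5) by (intro exI[of _ \<Gamma>]) (simp add: add.commute)
  qed
  have uniq: "X = wedge (J 0) (vel \<gamma> 0) + wedge (\<gamma> 0) Y" if P: "?P X" for X
  proof -
    obtain \<Gamma> where \<Gamma>: "geod_var \<Gamma> \<gamma>" "var_field \<Gamma> = J" "((\<lambda>s. pl (\<Gamma> s)) has_vector_derivative X) (at 0)"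
      using P by blast
    have geo: "unit_geod (\<Gamma> s)" for s using \<Gamma>(1) by (simp add: geod_var_def)
    have \<Gamma>0: "\<Gamma> 0 = \<gamma>" using \<Gamma>(1) by (simp add: geod_var_def)
    have dJ: "((\<lambda>s. \<Gamma> s t) has_vector_derivative J t) (at 0)" for t
    proof -
      have "smooth_on UNIV (\<lambda>z::real\<times>real. \<Gamma> (fst z) (snd z))" using \<Gamma>(1) by (simp add: geod_var_def)
      from smooth_on_compose[OF smooth_on_Pair[OF smooth_on_id smooth_on_const] this, of UNIV t]
      have "smooth_on UNIV (\<lambda>s. \<Gamma> s t)" by simp
      from smooth_on_vector_derivative(1)[OF this, of 0] \<Gamma>(2) show ?thesis
        by (auto simp: var_field_def)
    qed
    have s1: "sinh (1::real) \<noteq> 0" by simp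
    \<comment> \<open>The initial velocity is read off from the positions at times \<open>0\<close>
      and \<open>1\<close>, whose derivatives in \<open>s\<close> are values of the given field.
      This avoids interchanging the two derivatives.\<close>
    have vel0: "vel (\<Gamma> s) 0 = (1 / sinh 1) *\<^sub>R (\<Gamma> s 1 - cosh 1 *\<^sub>R \<Gamma> s 0)" for s
      using s1 by (subst unit_geodD(3)[OF geo, of s 1]) simp
    have "((\<lambda>s. vel (\<Gamma> s) 0) has_vector_derivative (1 / sinh 1) *\<^sub>R (J 1 - cosh 1 *\<^sub>R J 0)) (at 0)"
      unfolding vel0 by (auto intro!: derivative_eq_intros dJ)
    moreover have "(1 / sinh 1) *\<^sub>R (J 1 - cosh 1 *\<^sub>R J 0) = Y" using s1 by (subst Jt) simp
    ultimately have "((\<lambda>s. vel (\<Gamma> s) 0) has_vector_derivative Y) (at 0)" by simp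
    from has_vector_derivative_wedge[OF dJ[of 0] this]
    have "((\<lambda>s. pl (\<Gamma> s)) has_vector_derivative wedge (\<gamma> 0) Y + wedge (J 0) (vel \<gamma> 0)) (at 0)"
      by (simp add: pl_def \<Gamma>0)
    then show ?thesis using \<Gamma>(3) vector_derivative_unique_at by (metis add.commute)
  qed
  have "?P (SOME X. ?P X)" using ex by (rule someI)
  then show ?thesis unfolding Tmap_def Y_def[symmetric] by (rule uniq)
qed

text \<open>The quadratic forms \<open>X \<mapsto> X \<and> X\<close> and \<open>X \<mapsto> \<langle>X, X\<rangle>\<close> on bivectors, which up to sign restrict to
  the two metrics on tangent vectors of the space of geodesics.\<close>

definition pfaffian :: "real^4^4 \<Rightarrow> real" where
  "pfaffian X = X$1$2 * X$3$4 - X$1$3 * X$2$4 + X$1$4 * X$2$3"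

definition bivector_norm :: "real^4^4 \<Rightarrow> real" where
  "bivector_norm X = (X$1$2)\<^sup>2 + (X$1$3)\<^sup>2 + (X$1$4)\<^sup>2 - (X$2$3)\<^sup>2 - (X$2$4)\<^sup>2 - (X$3$4)\<^sup>2"

lemma pfaffian_tangent: "pfaffian (wedge X v + wedge u Y) = - det4 u v X Y"
  by (simp add: pfaffian_def wedge_def det4_explicit algebra_simps)

lemma bivector_norm_tangent:
  assumes "orthopair u v" "lor u X = 0" "lor v X = 0" "lor u Y = 0" "lor v Y = 0"
  shows "bivector_norm (wedge X v + wedge u Y) = lor Y Y - lor X X"
proof -
  have "bivector_norm (wedge X v + wedge u Y) =
     (lor v X)\<^sup>2 - lor X X * lor v v + (lor u Y)\<^sup>2 - lor u u * lor Y Y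
     - 2 * (lor u X * lor v Y - lor X Y * lor u v)"
    by (simp add: bivector_norm_def wedge_def lor_def algebra_simps power2_eq_square)
  then show ?thesis using assms by (simp add: orthopair_def H3_def)
qed

text \<open>Both definitions pick an arbitrary geodesic and Jacobi field representing the tangent
  vector. The resulting value is a quadratic function of the bivector \<open>Tmap \<gamma> J\<close>
  alone, so it can be computed from the given representative.\<close>

lemma metrics_tangent:
  assumes \<gamma>: "unit_geod \<gamma>" and data: "jacobi_data \<gamma> X Y"
  defines "T \<equiv> wedge X (vel \<gamma> 0) + wedge (\<gamma> 0) Y"
  shows "gx (pl \<gamma>) T = det4 (\<gamma> 0) (vel \<gamma> 0) X Y" "gK (pl \<gamma>) T = lor X X - lor Y Y"
proof -
  have T: "Tmap \<gamma>' J = wedge (J 0) (vel \<gamma>' 0) + wedge (\<gamma>' 0) (covD \<gamma>' J 0)"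
    "lor (hcross (\<gamma>' 0) (vel \<gamma>' 0) (J 0)) (covD \<gamma>' J 0) = - pfaffian (Tmap \<gamma>' J)"
    "lor (J 0) (J 0) - lor (covD \<gamma>' J 0) (covD \<gamma>' J 0) = - bivector_norm (Tmap \<gamma>' J)"
    if "unit_geod \<gamma>'" "normal_jacobi \<gamma>' J" for \<gamma>' J
  proof -
    show t: "Tmap \<gamma>' J = wedge (J 0) (vel \<gamma>' 0) + wedge (\<gamma>' 0) (covD \<gamma>' J 0)"
      by (rule Tmap_eq[OF that])
    have o: "orthopair (\<gamma>' 0) (vel \<gamma>' 0)" and d: "jacobi_data \<gamma>' (J 0) (covD \<gamma>' J 0)"
      using unit_geodD(5) normal_jacobiD(2) that by auto
    show "lor (hcross (\<gamma>' 0) (vel \<gamma>' 0) (J 0)) (covD \<gamma>' J 0) = - pfaffian (Tmap \<gamma>' J)"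
      using o d by (simp add: t pfaffian_tangent hcross_eq jacobi_data_def orthopair_def)
    show "lor (J 0) (J 0) - lor (covD \<gamma>' J 0) (covD \<gamma>' J 0) = - bivector_norm (Tmap \<gamma>' J)"
      using d by (simp add: t bivector_norm_tangent[OF o] jacobi_data_def)
  qed
  have gx: "gx m S = - pfaffian S" and gK: "gK m S = - bivector_norm S"
    if "\<exists>\<gamma> J. unit_geod \<gamma> \<and> pl \<gamma> = m \<and> normal_jacobi \<gamma> J \<and> Tmap \<gamma> J = S" for m S
  proof -
    from that obtain g J where g: "unit_geod g" "pl g = m" "normal_jacobi g J" "Tmap g J = S" by blast
    show "gx m S = - pfaffian S"
      unfolding gx_def
      by (rule some_equality, rule exI[of _ g], rule exI[of _ J]) (use g T(2) in auto)
    show "gK m S = - bivector_norm S"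
      unfolding gK_def
      by (rule some_equality, rule exI[of _ g], rule exI[of _ J]) (use g T(3) in auto)
  qed
  note J = normal_jacobi_hyperbolic[OF \<gamma> data]
  have "\<exists>\<gamma>' J. unit_geod \<gamma>' \<and> pl \<gamma>' = pl \<gamma> \<and> normal_jacobi \<gamma>' J \<and> Tmap \<gamma>' J = T"
    by (rule exI[of _ \<gamma>], rule exI[of _ "\<lambda>t. cosh t *\<^sub>R X + sinh t *\<^sub>R Y"])
      (simp add: \<gamma> J T(1)[OF \<gamma> J(1)] T_def)
  from gx[OF this] gK[OF this] show "gx (pl \<gamma>) T = det4 (\<gamma> 0) (vel \<gamma> 0) X Y" "gK (pl \<gamma>) T = lor X X - lor Y Y"
    using bivector_norm_tangent[OF unit_geodD(5)[OF \<gamma>]] data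
    by (simp_all add: T_def pfaffian_tangent jacobi_data_def)
qed

section \<open>Foliations by geodesics\<close>

locale geodesic_foliation =
  fixes V :: "real^4 \<Rightarrow> real^4"
  assumes foliation: "geod_foliation V"
begin

text \<open>The projection of \<open>H3\<close> to the leaf space, in Pluecker coordinates.\<close>

definition bivec :: "real^4 \<Rightarrow> real^4^4" where
  "bivec p = wedge p (V p)"

text \<open>\<open>H3\<close> has no interior in the ambient space, so a derivative within it is not
  unique off the tangent space. Curves determine its values on tangent vectors, and only these
  values enter.\<close>

definition dV :: "real^4 \<Rightarrow> real^4 \<Rightarrow> real^4" where
  "dV p = (SOME L. (V has_derivative L) (at p within H3))"

definition perp :: "real^4 \<Rightarrow> (real^4) set" where
  "perp p = {X. lor p X = 0 \<and> lor (V p) X = 0}"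

lemma smooth_V: "smooth_map H3 V"
  using foliation by (simp add: geod_foliation_def)

lemma orthopair_V: "p \<in> H3 \<Longrightarrow> orthopair p (V p)"
  using foliation by (simp add: geod_foliation_def orthopair_def)

lemma V_boost:
  assumes "p \<in> H3"
  defines "q t \<equiv> cosh t *\<^sub>R p + sinh t *\<^sub>R V p"
  shows "q t \<in> H3" "V (q t) = sinh t *\<^sub>R p + cosh t *\<^sub>R V p" "bivec (q t) = bivec p"
proof -
  obtain \<gamma> where \<gamma>: "unit_geod \<gamma>" "\<gamma> 0 = p" "\<And>t. vel \<gamma> t = V (\<gamma> t)"
    using foliation assms(1) unfolding geod_foliation_def by blast
  have "\<gamma> t = q t" "vel \<gamma> t = sinh t *\<^sub>R p + cosh t *\<^sub>R V p"
    using unit_geodD(3,4)[OF \<gamma>(1), of t] \<gamma>(2) \<gamma>(3)[of 0] by (simp_all add: q_def)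
  then show "V (q t) = sinh t *\<^sub>R p + cosh t *\<^sub>R V p" using \<gamma>(3)[of t] by simp
  then show "bivec (q t) = bivec p" by (simp add: bivec_def q_def wedge_boost)
  show "q t \<in> H3" unfolding q_def by (rule orthopairD(1)[OF orthopair_boost[OF orthopair_V[OF assms(1)]]])
qed

lemma leaf_through:
  assumes "p \<in> H3"
  obtains \<gamma> where "unit_geod \<gamma>" "\<gamma> 0 = p" "\<And>t. vel \<gamma> t = V (\<gamma> t)" "pl \<gamma> = bivec p"
proof -
  obtain \<gamma> where \<gamma>: "unit_geod \<gamma>" "\<gamma> 0 = p" "\<And>t. vel \<gamma> t = V (\<gamma> t)"
    using foliation assms(1) unfolding geod_foliation_def by blast
  then show ?thesis using that[of \<gamma>] by (simp add: pl_def bivec_def)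
qed

lemma leaf_space_eq: "leaf_space V = bivec ` H3"
proof
  show "leaf_space V \<subseteq> bivec ` H3"
  proof
    fix m assume "m \<in> leaf_space V"
    then obtain \<gamma> where "unit_geod \<gamma>" "\<forall>t. vel \<gamma> t = V (\<gamma> t)" "m = pl \<gamma>"
      by (auto simp: leaf_space_def)
    then show "m \<in> bivec ` H3"
      using orthopairD(1)[OF unit_geodD(5), of \<gamma> 0] by (auto simp: pl_def bivec_def)
  qed
  show "bivec ` H3 \<subseteq> leaf_space V"
  proof
    fix m assume "m \<in> bivec ` H3"
    then obtain p where p: "p \<in> H3" "m = bivec p" by blast
    obtain \<gamma> where "unit_geod \<gamma>" "\<And>t. vel \<gamma> t = V (\<gamma> t)" "pl \<gamma> = bivec p"
      using leaf_through[OF p(1)] by blast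
    then show "m \<in> leaf_space V" unfolding leaf_space_def p(2) by (intro image_eqI[of _ _ \<gamma>]) auto
  qed
qed

lemma V_has_derivative:
  assumes "p \<in> H3" shows "(V has_derivative dV p) (at p within H3)"
proof -
  obtain W g where W: "p \<in> W" "smooth_on W g" "\<forall>y\<in>W \<inter> H3. g y = V y"
    using smooth_V assms unfolding smooth_map_def by blast
  obtain L where "(g has_derivative L) (at p)"
    using smooth_on_derivative[OF W(2)] W(1) by metis
  then have "(g has_derivative L) (at p within H3)" by (rule has_derivative_at_withinI)
  moreover have "eventually (\<lambda>x. g x = V x) (at p within H3)"
    unfolding eventually_at_topological using W smooth_on_openD[OF W(2)] by (intro exI[of _ W]) auto
  ultimately have "(V has_derivative L) (at p within H3)"
    by (rule has_derivative_transform_eventually) (use W assms in auto)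
  then show ?thesis unfolding dV_def by (rule someI[where P="\<lambda>L. (V has_derivative L) (at p within H3)"])
qed

lemma linear_dV: "p \<in> H3 \<Longrightarrow> linear (dV p)"
  using V_has_derivative has_derivative_linear by blast

text \<open>Staying in \<open>H3\<close> is asked only near \<open>0\<close>, because the lift of a
  curve of leaves is controlled only while the leaves remain in \<open>lift_dom\<close>.\<close>

lemma V_curve_derivative:
  assumes "eventually (\<lambda>s. c s \<in> H3) (nhds 0)" "c 0 = p" "(c has_vector_derivative X) (at 0)"
  shows "((\<lambda>s. V (c s)) has_vector_derivative dV p X) (at (0::real))"
proof -
  obtain S where S: "open S" "0 \<in> S" "\<forall>s\<in>S. c s \<in> H3"
    using assms(1) unfolding eventually_nhds by blast
  have "(V has_derivative dV p) (at (c 0) within c ` S)"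
    using V_has_derivative[of p] S assms(2) by (auto intro: has_derivative_subset)
  from vector_derivative_diff_chain_within[OF has_vector_derivative_at_within[OF assms(3)] this]
  show ?thesis using at_within_open[OF S(2,1)] by (simp add: o_def)
qed

lemma bivec_curve_derivative:
  assumes "eventually (\<lambda>s. c s \<in> H3) (nhds 0)" "c 0 = p" "(c has_vector_derivative X) (at 0)"
  shows "((\<lambda>s. bivec (c s)) has_vector_derivative wedge X (V p) + wedge p (dV p X)) (at (0::real))"
  using has_vector_derivative_wedge[OF assms(3) V_curve_derivative[OF assms]] assms(2)
  by (simp add: bivec_def add.commute)

text \<open>Along its leaf \<open>V\<close> is the velocity, so this derivative is the ambient
  acceleration \<open>\<gamma>'' = \<gamma>\<close>. It is normal to the hyperboloid: the covariant
  derivative vanishes, the ambient one does not.\<close>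

lemma dV_self: "p \<in> H3 \<Longrightarrow> dV p (V p) = p"
proof -
  assume p: "p \<in> H3"
  obtain \<gamma> where \<gamma>: "unit_geod \<gamma>" "\<gamma> 0 = p" "\<And>t. vel \<gamma> t = V (\<gamma> t)"
    using leaf_through[OF p] by blast
  have "((\<lambda>s. V (\<gamma> s)) has_vector_derivative dV p (V p)) (at 0)"
    using orthopairD(1)[OF unit_geodD(5)[OF \<gamma>(1)]] \<gamma>(2) \<gamma>(3)[of 0] unit_geodD(1)[OF \<gamma>(1), of 0]
    by (intro V_curve_derivative) auto
  moreover have "((\<lambda>s. V (\<gamma> s)) has_vector_derivative p) (at 0)"
    using unit_geodD(2)[OF \<gamma>(1), of 0] unfolding \<gamma>(2) \<gamma>(3)[abs_def, symmetric] by simp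
  ultimately show ?thesis using vector_derivative_unique_at by blast
qed

text \<open>Differentiate \<open>lor c (V c) = 0\<close> and \<open>lor (V c) (V c) = 1\<close>
  along a curve. On \<open>perp p\<close> the ambient derivative thus needs no projection to be the
  covariant one.\<close>

lemma dV_perp:
  assumes "p \<in> H3" "X \<in> perp p" shows "dV p X \<in> perp p"
proof -
  have X: "lor p X = 0" "lor (V p) X = 0" using assms(2) by (auto simp: perp_def)
  obtain c where c: "\<And>s::real. c s \<in> H3" "c 0 = p" "(c has_vector_derivative X) (at 0)"
    using H3_curve[OF orthopair_V[OF assms(1)] X(1)] by metis
  have d: "((\<lambda>s. V (c s)) has_vector_derivative dV p X) (at 0)"
    by (rule V_curve_derivative) (use c in auto)
  have "lor (c 0) (dV p X) + lor X (V (c 0)) = 0"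
    by (rule lor_constant_derivative[OF c(3) d, of 0]) (use orthopairD(3)[OF orthopair_V] c(1) in auto)
  moreover have "lor (V (c 0)) (dV p X) + lor (dV p X) (V (c 0)) = 0"
    by (rule lor_constant_derivative[OF d d, of 1]) (use orthopairD(5)[OF orthopair_V] c(1) in auto)
  ultimately show ?thesis using X c(2) by (simp add: perp_def lor_commute)
qed

lemma smooth_on_V: "smooth_on U c \<Longrightarrow> c ` U \<subseteq> H3 \<Longrightarrow> smooth_on U (\<lambda>x. V (c x))"
  for c :: "'a::real_normed_vector \<Rightarrow> real^4"
  by (rule smooth_map_compose[OF smooth_V])

lemma smooth_on_bivec: "smooth_on U c \<Longrightarrow> c ` U \<subseteq> H3 \<Longrightarrow> smooth_on U (\<lambda>x. bivec (c x))"
  for c :: "'a::real_normed_vector \<Rightarrow> real^4"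
  unfolding bivec_def by (intro smooth_on_wedge smooth_on_V)

text \<open>Near \<open>bivec p\<close>, a geodesic \<open>m\<close> is determined by its intersection \<open>lift (V p) m\<close> with the
  totally geodesic plane through \<open>p\<close> orthogonal to \<open>V p\<close>.\<close>

definition lift_dom :: "real^4 \<Rightarrow> (real^4^4) set" where
  "lift_dom N = {m. lor (ctr m N) (ctr m N) < 0 \<and> 0 < ctr m N $ 1}"

definition lift :: "real^4 \<Rightarrow> real^4^4 \<Rightarrow> real^4" where
  "lift N m = inverse (sqrt (- lor (ctr m N) (ctr m N))) *\<^sub>R ctr m N"

lemma smooth_on_ctr_left: "smooth_on UNIV (\<lambda>m. ctr m N)"
  by (intro smooth_on_ctr smooth_on_id smooth_on_const open_UNIV)

lemma open_lift_dom: "open (lift_dom N)"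
proof -
  have c: "continuous_on UNIV (\<lambda>m. ctr m N)" by (rule smooth_on_imp_continuous_on[OF smooth_on_ctr_left])
  have "continuous_on UNIV (\<lambda>m. lor (ctr m N) (ctr m N))"
    by (rule smooth_on_imp_continuous_on[OF smooth_on_lor[OF smooth_on_ctr_left smooth_on_ctr_left]])
  then show ?thesis unfolding lift_dom_def
    by (intro open_Collect_conj open_Collect_less continuous_on_const continuous_on_component c)
qed

lemma smooth_on_lift: "smooth_on (lift_dom N) (lift N)"
proof -
  have s: "smooth_on (lift_dom N) (\<lambda>m. ctr m N)"
    by (rule smooth_on_subset[OF smooth_on_ctr_left open_lift_dom]) simp
  have n: "smooth_on (lift_dom N) (\<lambda>m. - lor (ctr m N) (ctr m N))"
    using smooth_on_diff[OF smooth_on_const[OF open_lift_dom] smooth_on_lor[OF s s], of 0] by simp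
  show ?thesis unfolding lift_def[abs_def]
    by (intro smooth_on_scaleR smooth_on_inverse smooth_on_sqrt n s) (auto simp: lift_dom_def)
qed

text \<open>\<open>ctr m N\<close> lies in the plane of the leaf and is orthogonal to
  \<open>N\<close>. In \<open>lift_dom\<close> it is timelike and future-pointing, so its
  normalisation is a point of the leaf, at time \<open>t\<close> from \<open>u\<close>.\<close>

lemma lift_leaf:
  assumes "m \<in> leaf_space V" "m \<in> lift_dom N"
  shows "lift N m \<in> H3" "lor N (lift N m) = 0" "bivec (lift N m) = m"
proof -
  obtain u where u: "u \<in> H3" "m = bivec u" using assms(1) leaf_space_eq by blast
  define v where "v = V u"
  have uv: "orthopair u v" unfolding v_def by (rule orthopair_V[OF u(1)])
  note o = orthopairD[OF uv]
  define a b where "a = lor v N" and "b = - lor u N"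
  have z: "ctr m N = a *\<^sub>R u + b *\<^sub>R v" by (simp add: u(2) bivec_def ctr_wedge a_def b_def v_def)
  have zz: "lor (ctr m N) (ctr m N) = b\<^sup>2 - a\<^sup>2" unfolding z using o by (simp add: lor_simps power2_eq_square)
  have lt: "b\<^sup>2 < a\<^sup>2" and pos: "ctr m N $ 1 > 0" using assms(2) zz by (auto simp: lift_dom_def)
  then have ba: "\<bar>b\<bar> < \<bar>a\<bar>" using abs_le_square_iff[of a b] by linarith
  \<comment> \<open>Otherwise the opposite vector would be future-pointing.\<close>
  have a: "a > 0"
  proof (rule ccontr)
    assume "\<not> a > 0"
    then have "((- a) *\<^sub>R u + (- b) *\<^sub>R v) $ 1 > 0" using ba by (intro orthopair_boost_pos[OF uv]) auto
    then show False using pos z by simp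
  qed
  define r where "r = sqrt (a\<^sup>2 - b\<^sup>2)"
  have r: "r > 0" "r\<^sup>2 = a\<^sup>2 - b\<^sup>2" using lt by (simp_all add: r_def)
  have "(a / r)\<^sup>2 - (b / r)\<^sup>2 = (a\<^sup>2 - b\<^sup>2) / r\<^sup>2" by (simp add: power_divide diff_divide_distrib)
  then have "(a / r)\<^sup>2 - (b / r)\<^sup>2 = 1" using r(1) by (simp add: r(2)[symmetric])
  then obtain t where t: "a / r = cosh t" "b / r = sinh t"
    using sinh_cosh_param[of "a / r" "b / r"] a r by auto
  have "lift N m = (a / r) *\<^sub>R u + (b / r) *\<^sub>R v"
    unfolding lift_def zz unfolding z by (simp add: r_def scaleR_right_distrib divide_inverse mult.commute)
  then have q: "lift N m = cosh t *\<^sub>R u + sinh t *\<^sub>R V u" by (simp add: t v_def)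
  show "lift N m \<in> H3" "bivec (lift N m) = m" unfolding q using V_boost[OF u(1), of t] u(2) by auto
  have "lor N (ctr m N) = 0" by (simp add: z lor_simps a_def b_def lor_commute[of N])
  then show "lor N (lift N m) = 0" by (simp add: lift_def lor_simps)
qed

text \<open>On the slice orthogonal to \<open>N\<close> the contraction is a multiple of
  \<open>q\<close>, and the factor is positive because the leaf crosses the slice in the direction
  of \<open>N\<close>.\<close>

lemma lift_bivec:
  assumes "q \<in> H3" "lor N q = 0" "lor N (V q) > 0"
  shows "bivec q \<in> lift_dom N" "lift N (bivec q) = q"
proof -
  define a where "a = lor N (V q)"
  have a: "a > 0" using assms(3) by (simp add: a_def)
  have z: "ctr (bivec q) N = a *\<^sub>R q"
    using assms(2) by (simp add: bivec_def ctr_wedge lor_commute[of _ N] a_def)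
  have zz: "- lor (ctr (bivec q) N) (ctr (bivec q) N) = a\<^sup>2"
    unfolding z using H3_lor[OF assms(1)] by (simp add: lor_simps power2_eq_square)
  show "bivec q \<in> lift_dom N"
    using a H3_pos[OF assms(1)] H3_lor[OF assms(1)] by (simp add: lift_dom_def z lor_simps)
  show "lift N (bivec q) = q" unfolding lift_def zz unfolding z using a by simp
qed

text \<open>A curve of leaves is lifted to its intersections with the slice orthogonal to
  \<open>V p\<close>; differentiating \<open>bivec (q s) = c s\<close> gives one inclusion.
  Projecting curves in \<open>H3\<close> to the leaf space gives the other.\<close>

lemma tspace_leaf_space:
  assumes "p \<in> H3"
  shows "tspace (leaf_space V) (bivec p) = (\<lambda>X. wedge X (V p) + wedge p (dV p X)) ` perp p"
proof
  let ?N = "V p"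
  note o = orthopairD[OF orthopair_V[OF assms]]
  show "tspace (leaf_space V) (bivec p) \<subseteq> (\<lambda>X. wedge X (V p) + wedge p (dV p X)) ` perp p"
  proof
    fix T assume "T \<in> tspace (leaf_space V) (bivec p)"
    then obtain c where c: "smooth_on UNIV c" "\<And>s::real. c s \<in> leaf_space V" "c 0 = bivec p"
      "(c has_vector_derivative T) (at 0)" unfolding tspace_def by blast
    have dom: "bivec p \<in> lift_dom ?N" and lp: "lift ?N (bivec p) = p"
      using lift_bivec[OF assms, of ?N] o by auto
    have cont: "isCont c 0" using c(4) has_vector_derivative_continuous by blast
    have ev: "eventually (\<lambda>s. c s \<in> lift_dom ?N) (nhds 0)"
      using topological_tendstoD[OF cont[unfolded isCont_def] open_lift_dom] dom c(3)
      by (simp add: eventually_nhds_conv_at)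
    define q where "q s = lift ?N (c s)" for s
    obtain D where D: "(lift ?N has_derivative D) (at (c 0))"
      using smooth_on_derivative[OF smooth_on_lift[of ?N]] dom c(3) by metis
    define X where "X = D T"
    have dq: "(q has_vector_derivative X) (at 0)"
      using vector_derivative_diff_chain_within[OF c(4) has_derivative_at_withinI[OF D]]
      by (simp add: q_def[abs_def] o_def X_def)
    have q: "eventually (\<lambda>s. q s \<in> H3) (nhds 0)" "eventually (\<lambda>s. lor ?N (q s) = 0) (nhds 0)"
      "eventually (\<lambda>s. bivec (q s) = c s) (nhds 0)"
      using ev lift_leaf[OF c(2)] by (auto simp: q_def elim: eventually_mono)
    have q0: "q 0 = p" using lp c(3) by (simp add: q_def)
    have "lor (q 0) X + lor X (q 0) = 0"
      by (rule lor_constant_derivative[OF dq dq, of "-1"]) (use q(1) H3_lor in \<open>auto elim: eventually_mono\<close>)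
    moreover have "lor ?N X + lor 0 (q 0) = 0"
      by (rule lor_constant_derivative[OF has_vector_derivative_const dq, of _ 0]) (use q(2) in auto)
    ultimately have "X \<in> perp p" using q0 by (simp add: perp_def lor_simps lor_commute)
    moreover have "T = wedge X (V p) + wedge p (dV p X)"
    proof -
      obtain S where S: "open S" "0 \<in> S" "\<And>s. s \<in> S \<Longrightarrow> bivec (q s) = c s"
        using q(3) unfolding eventually_nhds by blast
      have "(c has_vector_derivative wedge X (V p) + wedge p (dV p X)) (at 0)"
        using has_vector_derivative_transform_within_open[OF bivec_curve_derivative[OF q(1) q0 dq] S] .
      then show ?thesis using c(4) vector_derivative_unique_at by blast
    qed
    ultimately show "T \<in> (\<lambda>X. wedge X (V p) + wedge p (dV p X)) ` perp p" by blast
  qed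
  show "(\<lambda>X. wedge X (V p) + wedge p (dV p X)) ` perp p \<subseteq> tspace (leaf_space V) (bivec p)"
  proof
    fix T assume "T \<in> (\<lambda>X. wedge X (V p) + wedge p (dV p X)) ` perp p"
    then obtain X where X: "X \<in> perp p" "T = wedge X (V p) + wedge p (dV p X)" by blast
    then have "lor p X = 0" by (simp add: perp_def)
    then obtain c where c: "smooth_on UNIV c" "\<And>s::real. c s \<in> H3" "c 0 = p" "(c has_vector_derivative X) (at 0)"
      using H3_curve[OF orthopair_V[OF assms]] by metis
    have "smooth_on UNIV (\<lambda>s. bivec (c s))" using smooth_on_bivec[OF c(1)] c(2) by blast
    moreover have "((\<lambda>s. bivec (c s)) has_vector_derivative T) (at 0)"
      unfolding X(2) by (rule bivec_curve_derivative) (use c in auto)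
    ultimately show "T \<in> tspace (leaf_space V) (bivec p)"
      unfolding tspace_def using c by (auto simp: leaf_space_eq intro!: exI[of _ "\<lambda>s. bivec (c s)"])
  qed
qed

section \<open>The metrics on the leaf space and the eigenvalue criteria\<close>

definition dbivec :: "real^4 \<Rightarrow> real^4 \<Rightarrow> real^4^4" where
  "dbivec p X = wedge X (V p) + wedge p (dV p X)"

lemma tspace_bivec: "p \<in> H3 \<Longrightarrow> tspace (leaf_space V) (bivec p) = dbivec p ` perp p"
  using tspace_leaf_space by (simp add: dbivec_def[abs_def])

lemma dbivec_metrics:
  assumes "p \<in> H3" "X \<in> perp p"
  shows "gx (bivec p) (dbivec p X) = det4 p (V p) X (dV p X)"
    and "gK (bivec p) (dbivec p X) = lor X X - lor (dV p X) (dV p X)"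
proof -
  obtain \<gamma> where \<gamma>: "unit_geod \<gamma>" "\<gamma> 0 = p" "\<And>t. vel \<gamma> t = V (\<gamma> t)" "pl \<gamma> = bivec p"
    using leaf_through[OF assms(1)] by blast
  have "jacobi_data \<gamma> X (dV p X)"
    using assms(2) dV_perp[OF assms] \<gamma>(2,3) by (simp add: jacobi_data_def perp_def)
  from metrics_tangent[OF \<gamma>(1) this] \<gamma> show
    "gx (bivec p) (dbivec p X) = det4 p (V p) X (dV p X)"
    "gK (bivec p) (dbivec p X) = lor X X - lor (dV p X) (dV p X)"
    by (simp_all add: dbivec_def)
qed

lemma dbivec_eq_0_iff:
  assumes "p \<in> H3" "X \<in> perp p"
  shows "dbivec p X = 0 \<longleftrightarrow> X = 0"
  using wedge_tangent_inject[OF orthopair_V[OF assms(1)], of X "dV p X" 0 0] assms dV_perp[OF assms]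
    linear_0[OF linear_dV[OF assms(1)]]
  by (auto simp: dbivec_def perp_def lor.zero_right wedge.zero_left wedge.zero_right)

lemma det4_perp_eq_0_iff:
  assumes "p \<in> H3" "X \<in> perp p" "Y \<in> perp p" "X \<noteq> 0"
  shows "det4 p (V p) X Y = 0 \<longleftrightarrow> (\<exists>k. Y = k *\<^sub>R X)"
proof -
  obtain e f where fr: "frame p (V p) e f" using frame_exists[OF orthopair_V[OF assms(1)]] by blast
  define a b c d where "a = lor e X" and "b = lor f X" and "c = lor e Y" and "d = lor f Y"
  have X: "X = a *\<^sub>R e + b *\<^sub>R f" and Y: "Y = c *\<^sub>R e + d *\<^sub>R f"
    using frame_expansion[OF fr] assms by (auto simp: perp_def a_def b_def c_def d_def)
  have det: "det4 p (V p) X Y = (a * d - b * c) * det4 p (V p) e f"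
    unfolding X Y by (rule det4_frame)
  have iff: "det4 p (V p) X Y = 0 \<longleftrightarrow> a * d = b * c"
    unfolding det using frame_expansion_and_det(2)[OF fr] by simp
  have "Y = (c / a) *\<^sub>R X" if "a * d = b * c" "a \<noteq> 0"
    using that by (subst X, subst Y) (simp add: scaleR_right_distrib field_simps)
  moreover have "Y = (d / b) *\<^sub>R X" if "a * d = b * c" "b \<noteq> 0"
    using that by (subst X, subst Y) (simp add: scaleR_right_distrib field_simps)
  moreover have "a \<noteq> 0 \<or> b \<noteq> 0" using X assms(4) by auto
  moreover have "a * d = b * c" if "Y = k *\<^sub>R X" for k
    using that by (simp add: a_def b_def c_def d_def lor_simps)
  ultimately show ?thesis unfolding iff by blast
qed

text \<open>Along a leaf the Jacobi field with initial data \<open>X, k X\<close> is \<open>(cosh t + k sinh t) X\<close>. It would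
  vanish somewhere if \<open>k\<^sup>2 > 1\<close>, but a nonzero tangent vector of the leaf space has a nowhere
  vanishing Jacobi field.\<close>

lemma eigenvalue_bound:
  assumes p: "p \<in> H3" and X: "X \<in> perp p" "X \<noteq> 0" "dV p X = k *\<^sub>R X"
  shows "k\<^sup>2 \<le> 1"
proof (rule ccontr)
  assume "\<not> k\<^sup>2 \<le> 1"
  then have k: "k\<^sup>2 > 1" by simp
  \<comment> \<open>\<open>r\<close> normalises \<open>(\<bar>k\<bar>, - sgn k)\<close> to a pair
    \<open>(cosh t, sinh t)\<close>; then \<open>tanh t = - 1 / k\<close>, so \<open>t\<close> is
    the zero of the Jacobi field.\<close>
  define r where "r = sqrt (k\<^sup>2 - 1)"
  have r: "r > 0" "r\<^sup>2 = k\<^sup>2 - 1" using k by (simp_all add: r_def)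
  have k0: "k \<noteq> 0" using k by auto
  have "(\<bar>k\<bar> / r)\<^sup>2 - (- sgn k / r)\<^sup>2 = (k\<^sup>2 - 1) / r\<^sup>2"
    using k0 by (simp add: power_divide diff_divide_distrib sgn_if)
  then have "(\<bar>k\<bar> / r)\<^sup>2 - (- sgn k / r)\<^sup>2 = 1" using r(1) by (simp add: r(2)[symmetric])
  then obtain t where t: "\<bar>k\<bar> / r = cosh t" "- sgn k / r = sinh t"
    using sinh_cosh_param[of "\<bar>k\<bar> / r" "- sgn k / r"] r k0 by auto
  have vanish: "cosh t + sinh t * k = 0"
    unfolding t[symmetric] using r by (simp add: field_simps abs_sgn)
  define q where "q = cosh t *\<^sub>R p + sinh t *\<^sub>R V p"
  note q = V_boost[OF p, of t, folded q_def]
  note o = orthopairD[OF orthopair_V[OF p]]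
  \<comment> \<open>Since \<open>bivec q = bivec p\<close>, the same tangent vector is described at
    \<open>q\<close> by some \<open>Y\<close>. Contracting both descriptions with \<open>V q\<close>
    shows that \<open>Y\<close> is the value of the Jacobi field at time \<open>t\<close>.\<close>
  have "dbivec p X \<in> tspace (leaf_space V) (bivec q)"
    unfolding q(3) tspace_bivec[OF p] using X by blast
  then obtain Y where Y: "Y \<in> perp q" "dbivec p X = dbivec q Y"
    unfolding tspace_bivec[OF q(1)] by blast
  have "ctr (dbivec q Y) (V q) = Y"
    using Y(1) dV_perp[OF q(1) Y(1)] orthopairD[OF orthopair_V[OF q(1)]]
    by (simp add: dbivec_def ctr.add_left ctr_wedge perp_def lor_commute)
  moreover have "ctr (dbivec p X) (V q) = (cosh t + sinh t * k) *\<^sub>R X"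
    using X(1) o unfolding q(2)
    by (simp add: dbivec_def X(3) ctr.add_left ctr_wedge perp_def lor_simps lor_commute[of X] algebra_simps)
  ultimately have "Y = 0" using Y(2) vanish by simp
  then have "dbivec p X = 0" using Y dbivec_eq_0_iff[OF q(1)] by simp
  then show False using dbivec_eq_0_iff[OF p X(1)] X(2) by simp
qed

lemma semidefinite_iff:
  "semidefinite (leaf_space V) \<longleftrightarrow>
    (\<forall>p\<in>H3. \<forall>X\<in>perp p. X \<noteq> 0 \<longrightarrow> dV p X \<noteq> X \<and> dV p X \<noteq> - X)"
proof -
  have *: "(gx (bivec p) (dbivec p X) = 0 \<longrightarrow> 0 < gK (bivec p) (dbivec p X)) \<longleftrightarrow> dV p X \<noteq> X \<and> dV p X \<noteq> - X"
    if p: "p \<in> H3" and X: "X \<in> perp p" "X \<noteq> 0" for p X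
  proof -
    have pos: "lor X X > 0" using H3_orthogonal_pos[OF p] X by (simp add: perp_def)
    have gx: "gx (bivec p) (dbivec p X) = 0 \<longleftrightarrow> (\<exists>k. dV p X = k *\<^sub>R X)"
      using det4_perp_eq_0_iff[OF p X(1) dV_perp[OF p X(1)] X(2)] dbivec_metrics(1)[OF p X(1)] by simp
    have gK: "gK (bivec p) (dbivec p X) = (1 - k\<^sup>2) * lor X X" if "dV p X = k *\<^sub>R X" for k
      using dbivec_metrics(2)[OF p X(1)] that by (simp add: lor_simps power2_eq_square algebra_simps)
    show ?thesis
    proof
      assume l: "gx (bivec p) (dbivec p X) = 0 \<longrightarrow> 0 < gK (bivec p) (dbivec p X)"
      have "dV p X \<noteq> k *\<^sub>R X" if "k\<^sup>2 = 1" for k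
      proof
        assume "dV p X = k *\<^sub>R X"
        with l gx gK that show False by fastforce
      qed
      from this[of 1] this[of "-1"] show "dV p X \<noteq> X \<and> dV p X \<noteq> - X" by simp
    next
      assume r: "dV p X \<noteq> X \<and> dV p X \<noteq> - X"
      show "gx (bivec p) (dbivec p X) = 0 \<longrightarrow> 0 < gK (bivec p) (dbivec p X)"
      proof
        assume "gx (bivec p) (dbivec p X) = 0"
        then obtain k where k: "dV p X = k *\<^sub>R X" using gx by blast
        have "k \<noteq> 1" "k \<noteq> - 1" using r k by auto
        then have "k\<^sup>2 \<noteq> 1" by (simp add: power2_eq_1_iff)
        then have "k\<^sup>2 < 1" using eigenvalue_bound[OF p X k] by simp
        then show "0 < gK (bivec p) (dbivec p X)" unfolding gK[OF k] using pos by simp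
      qed
    qed
  qed
  show ?thesis
    unfolding semidefinite_def leaf_space_eq ball_simps
    \<comment> \<open>The preceding unfolding also rewrites the set inside \<open>tspace\<close>;
      folding it back lets \<open>tspace_bivec\<close> apply.\<close>
    unfolding leaf_space_eq[symmetric]
    using * dbivec_eq_0_iff by (auto simp: tspace_bivec)
qed

text \<open>By the chain rule the derivative of \<open>V\<close> along a curve depends only on the
  velocity, so the curve chosen in \<open>nablaV\<close> is immaterial.\<close>

lemma nablaV_eq:
  assumes "p \<in> H3" "lor p X = 0"
  shows "nablaV V p X = tang p (dV p X)"
  unfolding nablaV_def
proof (rule some_equality)
  obtain c where c: "smooth_on UNIV c" "\<And>s::real. c s \<in> H3" "c 0 = p" "(c has_vector_derivative X) (at 0)"
    using H3_curve[OF orthopair_V[OF assms(1)] assms(2)] by metis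
  have "((\<lambda>s. V (c s)) has_vector_derivative dV p X) (at 0)"
    by (rule V_curve_derivative) (use c in auto)
  then show "\<exists>c. smooth_on UNIV c \<and> (\<forall>s. c s \<in> H3) \<and> c 0 = p \<and> vel c 0 = X \<and>
      tang p (dV p X) = tang p (vector_derivative (V \<circ> c) (at 0))"
    using c by (intro exI[of _ c]) (simp add: vel_def vector_derivative_at o_def)
next
  fix w assume "\<exists>c. smooth_on UNIV c \<and> (\<forall>s. c s \<in> H3) \<and> c 0 = p \<and> vel c 0 = X \<and>
      w = tang p (vector_derivative (V \<circ> c) (at 0))"
  then obtain c where c: "smooth_on UNIV c" "\<forall>s. c s \<in> H3" "c 0 = p" "vel c 0 = X"
    "w = tang p (vector_derivative (V \<circ> c) (at 0))" by blast
  have "(c has_vector_derivative X) (at 0)"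
    using smooth_on_vector_derivative(1)[OF c(1), of 0] c(4) by (simp add: vel_def)
  then have "((\<lambda>s. V (c s)) has_vector_derivative dV p X) (at 0)"
    using c by (intro V_curve_derivative) auto
  then show "w = tang p (dV p X)" by (simp add: c(5) o_def vector_derivative_at)
qed

text \<open>Split \<open>X = Y + c *\<^sub>R V p\<close> with \<open>Y\<close> in
  \<open>perp p\<close>. As leaves are geodesics, \<open>nablaV\<close> ignores the second summand,
  so the components of the eigenvector equation are \<open>k * c = 0\<close> and
  \<open>dV p Y = k *\<^sub>R Y\<close>.\<close>

lemma nondegenerate_iff:
  "nondegenerate V \<longleftrightarrow> (\<forall>p\<in>H3. \<forall>X\<in>perp p. X \<noteq> 0 \<longrightarrow> (\<forall>k. dV p X \<noteq> k *\<^sub>R X))"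
proof
  assume nd: "nondegenerate V"
  show "\<forall>p\<in>H3. \<forall>X\<in>perp p. X \<noteq> 0 \<longrightarrow> (\<forall>k. dV p X \<noteq> k *\<^sub>R X)"
  proof (intro ballI allI impI notI)
    fix p X k assume p: "p \<in> H3" and X: "X \<in> perp p" "X \<noteq> 0" "dV p X = k *\<^sub>R X"
    have pX: "lor p X = 0" "lor (V p) X = 0" using X by (auto simp: perp_def)
    have "nablaV V p X = k *\<^sub>R X"
      using nablaV_eq[OF p pX(1)] X(3) pX by (simp add: tang_def lor_simps)
    then obtain \<mu> where "X = \<mu> *\<^sub>R V p" using nd p pX X(2) unfolding nondegenerate_def by blast
    moreover from this have "\<mu> = 0" using pX(2) orthopairD[OF orthopair_V[OF p]] by (simp add: lor_simps)
    ultimately show False using X(2) by simp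
  qed
next
  assume r: "\<forall>p\<in>H3. \<forall>X\<in>perp p. X \<noteq> 0 \<longrightarrow> (\<forall>k. dV p X \<noteq> k *\<^sub>R X)"
  show "nondegenerate V"
    unfolding nondegenerate_def
  proof (intro ballI allI impI)
    fix p X assume p: "p \<in> H3" and X: "lor p X = 0 \<and> X \<noteq> 0 \<and> (\<exists>k. nablaV V p X = k *\<^sub>R X)"
    note o = orthopairD[OF orthopair_V[OF p]]
    interpret dV: linear "dV p" by (rule linear_dV[OF p])
    obtain k where k: "nablaV V p X = k *\<^sub>R X" using X by blast
    define c where "c = lor (V p) X"
    define Y where "Y = X - c *\<^sub>R V p"
    have XY: "X = Y + c *\<^sub>R V p" by (simp add: Y_def)
    have Y: "Y \<in> perp p" using X o by (simp add: Y_def perp_def lor_simps c_def)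
    note dY = dV_perp[OF p Y]
    have "dV p X = dV p Y + c *\<^sub>R p" unfolding XY using dV_self[OF p] by (simp add: dV.add dV.scaleR)
    then have "nablaV V p X = dV p Y"
      using nablaV_eq[OF p] X dY o by (simp add: tang_def lor_simps perp_def)
    then have eq: "dV p Y = k *\<^sub>R Y + (k * c) *\<^sub>R V p" using k XY by (simp add: scaleR_right_distrib)
    have "lor (V p) (dV p Y) = k * c" unfolding eq using Y o by (simp add: perp_def lor_simps)
    then have "k * c = 0" using dY by (simp add: perp_def)
    then have "dV p Y = k *\<^sub>R Y" using eq by simp
    then have "Y = 0" using r p Y by blast
    then show "\<exists>\<mu>. X = \<mu> *\<^sub>R V p" using XY by auto
  qed
qed

lemma gx_definite_on_iff:
  "gx_definite_on (leaf_space V) \<longleftrightarrow> (\<forall>p\<in>H3. \<forall>X\<in>perp p. X \<noteq> 0 \<longrightarrow> (\<forall>k. dV p X \<noteq> k *\<^sub>R X))"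
proof -
  define Q where "Q p X = det4 p (V p) X (dV p X)" for p X
  have Q0: "Q p X = 0 \<longleftrightarrow> (\<exists>k. dV p X = k *\<^sub>R X)" if "p \<in> H3" "X \<in> perp p" "X \<noteq> 0" for p X
    unfolding Q_def by (rule det4_perp_eq_0_iff[OF that(1,2) dV_perp[OF that(1,2)] that(3)])
  have def: "((\<forall>X\<in>perp p. X \<noteq> 0 \<longrightarrow> Q p X > 0) \<or> (\<forall>X\<in>perp p. X \<noteq> 0 \<longrightarrow> Q p X < 0))
      \<longleftrightarrow> (\<forall>X\<in>perp p. X \<noteq> 0 \<longrightarrow> Q p X \<noteq> 0)" if p: "p \<in> H3" for p
  proof
    assume nz: "\<forall>X\<in>perp p. X \<noteq> 0 \<longrightarrow> Q p X \<noteq> 0"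
    interpret dV: linear "dV p" by (rule linear_dV[OF p])
    obtain e f where fr: "frame p (V p) e f" using frame_exists[OF orthopair_V[OF p]] by blast
    then have ef: "e \<in> perp p" "f \<in> perp p" by (auto simp: frame_def perp_def)
    define A C B where "A = Q p e" and "C = Q p f" and
      "B = det4 p (V p) e (dV p f) + det4 p (V p) f (dV p e)"
    have Qxy: "Q p (x *\<^sub>R e + y *\<^sub>R f) = A * x\<^sup>2 + B * x * y + C * y\<^sup>2" for x y
      unfolding Q_def A_def B_def C_def dV.add dV.scaleR
      by (simp add: det4_explicit algebra_simps power2_eq_square)
    have in_perp: "x *\<^sub>R e + y *\<^sub>R f \<in> perp p" for x y using ef by (simp add: perp_def lor_simps)
    have zero: "x *\<^sub>R e + y *\<^sub>R f = 0 \<longleftrightarrow> x = 0 \<and> y = 0" for x y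
    proof
      assume z: "x *\<^sub>R e + y *\<^sub>R f = 0"
      have "lor e (x *\<^sub>R e + y *\<^sub>R f) = x" "lor f (x *\<^sub>R e + y *\<^sub>R f) = y"
        using fr by (simp_all add: frame_def lor_simps lor_commute[of f e])
      then show "x = 0 \<and> y = 0" unfolding z by (simp add: lor.zero_right)
    qed simp
    have nzxy: "A * x\<^sup>2 + B * x * y + C * y\<^sup>2 \<noteq> 0" if "x \<noteq> 0 \<or> y \<noteq> 0" for x y
      using nz in_perp[of x y] zero[of x y] that unfolding Qxy[symmetric] by blast
    have A: "A \<noteq> 0" using nzxy[of 1 0] by simp
    have disc: "4 * A * C - B\<^sup>2 > 0"
    proof (rule ccontr)
      assume "\<not> ?thesis"
      then have s: "(sqrt (B\<^sup>2 - 4 * A * C))\<^sup>2 = B\<^sup>2 - 4 * A * C" by simp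
      \<comment> \<open>The quadratic formula: with a non-negative discriminant,
        \<open>(s - B, 2 * A)\<close> is a zero of the form, nontrivial because
        \<open>A \<noteq> 0\<close>.\<close>
      define s where "s = sqrt (B\<^sup>2 - 4 * A * C)"
      have "A * (s - B)\<^sup>2 + B * (s - B) * (2 * A) + C * (2 * A)\<^sup>2 = A * (s\<^sup>2 - (B\<^sup>2 - 4 * A * C))"
        by (simp add: power2_eq_square algebra_simps)
      also have "\<dots> = 0" using s by (simp add: s_def)
      finally show False using nzxy[of "s - B" "2 * A"] A by simp
    qed
    \<comment> \<open>Multiplying by \<open>A\<close> treats both signs at once; the rest is
      completing the square.\<close>
    have sign: "A * (A * x\<^sup>2 + B * x * y + C * y\<^sup>2) > 0" if "x \<noteq> 0 \<or> y \<noteq> 0" for x y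
    proof -
      have "4 * (A * (A * x\<^sup>2 + B * x * y + C * y\<^sup>2)) = (2 * A * x + B * y)\<^sup>2 + (4 * A * C - B\<^sup>2) * y\<^sup>2"
        by (simp add: power2_eq_square algebra_simps)
      also have "\<dots> > 0"
      proof (cases "y = 0")
        case True
        then show ?thesis using A that by simp
      next
        case False
        then show ?thesis using disc by (intro add_nonneg_pos mult_pos_pos) auto
      qed
      finally show ?thesis by simp
    qed
    have "A * Q p X > 0" if "X \<in> perp p" "X \<noteq> 0" for X
    proof -
      have X: "X = lor e X *\<^sub>R e + lor f X *\<^sub>R f" using frame_expansion[OF fr] that by (simp add: perp_def)
      then have "lor e X \<noteq> 0 \<or> lor f X \<noteq> 0" using that(2) by auto
      from sign[OF this] show ?thesis unfolding Qxy[symmetric] X[symmetric] .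
    qed
    then show "(\<forall>X\<in>perp p. X \<noteq> 0 \<longrightarrow> Q p X > 0) \<or> (\<forall>X\<in>perp p. X \<noteq> 0 \<longrightarrow> Q p X < 0)"
      using A by (metis linorder_neqE_linordered_idom zero_less_mult_pos mult_neg_pos mult_pos_neg not_less_iff_gr_or_eq zero_less_mult_iff)
  qed force
  have "gx_definite_on (leaf_space V) \<longleftrightarrow> (\<forall>p\<in>H3.
      (\<forall>X\<in>perp p. X \<noteq> 0 \<longrightarrow> Q p X > 0) \<or> (\<forall>X\<in>perp p. X \<noteq> 0 \<longrightarrow> Q p X < 0))"
    unfolding gx_definite_on_def leaf_space_eq ball_simps
    unfolding leaf_space_eq[symmetric]
    using dbivec_eq_0_iff by (auto simp: tspace_bivec dbivec_metrics Q_def)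
  then show ?thesis using def Q0 by auto
qed

end

section \<open>Gauss maps\<close>

definition project :: "real^4 \<Rightarrow> real^4" where
  "project x = (1 / x$1) *\<^sub>R x"

text \<open>The sign \<open>\<epsilon>\<close> serves both Gauss maps: the backward endpoint is the
  forward endpoint for the reversed velocity.\<close>

definition gauss :: "real \<Rightarrow> real^4^4 \<Rightarrow> real^4" where
  "gauss \<epsilon> m = (SOME x. \<exists>\<gamma>. unit_geod \<gamma> \<and> pl \<gamma> = m \<and> x = project (\<gamma> 0 + \<epsilon> *\<^sub>R vel \<gamma> 0))"

lemma gauss_maps: "gauss_plus = gauss 1" "gauss_minus = gauss (-1)"
  unfolding gauss_plus_def gauss_minus_def gauss_def endpt_fwd_def endpt_bwd_def project_def fun_eq_iff
  by simp_all

lemma project_scaleR: "c \<noteq> 0 \<Longrightarrow> project (c *\<^sub>R x) = project x"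
  by (simp add: project_def)

lemma project_Sinf: "lor x x = 0 \<Longrightarrow> x$1 \<noteq> 0 \<Longrightarrow> project x \<in> Sinf"
  by (simp add: project_def Sinf_def lor_simps)

lemma smooth_on_component:
  fixes f :: "'a::real_normed_vector \<Rightarrow> real^4"
  shows "smooth_on U f \<Longrightarrow> smooth_on U (\<lambda>x. f x $ i)"
  by (rule smooth_on_compose_linear[OF bounded_linear_vec_nth])

lemma smooth_on_project:
  assumes "smooth_on U f" "\<And>x. x \<in> U \<Longrightarrow> f x $ 1 \<noteq> 0"
  shows "smooth_on U (\<lambda>x. project (f x))"
  unfolding project_def divide_inverse mult_1
  using assms by (intro smooth_on_scaleR smooth_on_inverse smooth_on_component)

lemma null_pos: "orthopair u v \<Longrightarrow> (u + v) $ 1 > 0"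
  using orthopair_boost_pos[of u v 1 1] by simp

lemma null_lor: "orthopair u v \<Longrightarrow> lor (u + v) (u + v) = 0"
  using orthopairD by (simp add: lor_simps)

lemma orthopair_sign: "orthopair u v \<Longrightarrow> \<epsilon>\<^sup>2 = 1 \<Longrightarrow> orthopair u (\<epsilon> *\<^sub>R v)"
  by (simp add: orthopair_def lor_simps power2_eq_square)

text \<open>Geodesics with the same bivector have proportional null vectors, and
  \<open>project\<close> removes the factor.\<close>

lemma gauss_pl:
  assumes \<epsilon>: "\<epsilon>\<^sup>2 = 1" and \<gamma>: "unit_geod \<gamma>"
  shows "gauss \<epsilon> (pl \<gamma>) = project (\<gamma> 0 + \<epsilon> *\<^sub>R vel \<gamma> 0)"
  unfolding gauss_def
proof (rule some_equality)
  show "\<exists>\<gamma>'. unit_geod \<gamma>' \<and> pl \<gamma>' = pl \<gamma> \<and>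
      project (\<gamma> 0 + \<epsilon> *\<^sub>R vel \<gamma> 0) = project (\<gamma>' 0 + \<epsilon> *\<^sub>R vel \<gamma>' 0)"
    using \<gamma> by blast
  fix x assume "\<exists>\<gamma>'. unit_geod \<gamma>' \<and> pl \<gamma>' = pl \<gamma> \<and> x = project (\<gamma>' 0 + \<epsilon> *\<^sub>R vel \<gamma>' 0)"
  then obtain \<gamma>' where \<gamma>': "unit_geod \<gamma>'" "pl \<gamma>' = pl \<gamma>" "x = project (\<gamma>' 0 + \<epsilon> *\<^sub>R vel \<gamma>' 0)" by blast
  note o = orthopair_sign[OF unit_geodD(5)[OF \<gamma>, of 0] \<epsilon>]
    and o' = orthopair_sign[OF unit_geodD(5)[OF \<gamma>'(1), of 0] \<epsilon>]
  have "wedge (\<gamma> 0) (\<epsilon> *\<^sub>R vel \<gamma> 0) = wedge (\<gamma>' 0) (\<epsilon> *\<^sub>R vel \<gamma>' 0)"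
    using \<gamma>'(2) by (simp add: pl_def wedge.scaleR_right)
  from wedge_eq_null[OF o o' this]
  obtain c where c: "\<gamma>' 0 + \<epsilon> *\<^sub>R vel \<gamma>' 0 = c *\<^sub>R (\<gamma> 0 + \<epsilon> *\<^sub>R vel \<gamma> 0)" by blast
  then have "c \<noteq> 0" using null_pos[OF o'] by auto
  then show "x = project (\<gamma> 0 + \<epsilon> *\<^sub>R vel \<gamma> 0)" unfolding \<gamma>'(3) c by (rule project_scaleR)
qed

text \<open>Once \<open>lor z (p - n) = -2\<close> is imposed, the quadratic equation
  \<open>lor z z = 0\<close> becomes linear in \<open>lor p z\<close>, so the components along
  \<open>e\<close> and \<open>f\<close> determine a null vector.\<close>

lemma frame_null_eqI:
  assumes fr: "frame p n e f" and x: "lor x x = 0" and y: "lor y y = 0"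
    and "lor x (p - n) = -2" "lor y (p - n) = -2" "lor e x = lor e y" "lor f x = lor f y"
  shows "x = y"
proof -
  have exp: "z = - lor p z *\<^sub>R p + lor n z *\<^sub>R n + lor e z *\<^sub>R e + lor f z *\<^sub>R f" for z
    by (rule frame_expansion_and_det(1)[OF fr])
  have norm: "lor z z = - (lor p z)\<^sup>2 + (lor n z)\<^sup>2 + (lor e z)\<^sup>2 + (lor f z)\<^sup>2" for z
  proof -
    have "lor z z = lor (- lor p z *\<^sub>R p + lor n z *\<^sub>R n + lor e z *\<^sub>R e + lor f z *\<^sub>R f) z"
      using exp[of z] by simp
    then show ?thesis by (simp add: lor.add_left lor.diff_left lor.scaleR_left lor.minus_left power2_eq_square)
  qed
  have z: "lor p z = - 1 - ((lor e z)\<^sup>2 + (lor f z)\<^sup>2) / 4 \<and> lor n z = 1 - ((lor e z)\<^sup>2 + (lor f z)\<^sup>2) / 4"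
    if "lor z z = 0" "lor z (p - n) = -2" for z
  proof -
    have n: "lor n z = lor p z + 2" using that(2) by (simp add: lor_simps lor_commute[of z])
    have "(lor e z)\<^sup>2 + (lor f z)\<^sup>2 = - 4 - 4 * lor p z"
      using norm[of z] that(1) unfolding n by (simp add: power2_eq_square algebra_simps)
    then show ?thesis using n by (simp add: field_simps)
  qed
  have "lor p x = lor p y" "lor n x = lor n y" using z[OF x assms(4)] z[OF y assms(5)] assms(6,7) by simp_all
  then show ?thesis using exp[of x] exp[of y] assms(6,7) by simp
qed

text \<open>Stereographic projection of the sphere at infinity from the null direction \<open>p - n\<close>.\<close>

definition stereo_den :: "real^4 \<Rightarrow> real^4 \<Rightarrow> real^4 \<Rightarrow> real" where
  "stereo_den p n x = - lor x (p - n) / 2"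

definition stereo :: "real^4 \<Rightarrow> real^4 \<Rightarrow> real^4 \<Rightarrow> real^4 \<Rightarrow> real^4 \<Rightarrow> real \<times> real" where
  "stereo p n e f x = (lor e x * inverse (stereo_den p n x), lor f x * inverse (stereo_den p n x))"

lemma stereo_den_scaleR: "stereo_den p n (c *\<^sub>R x) = c * stereo_den p n x"
  by (simp add: stereo_den_def lor.scaleR_left)

lemma stereo_scaleR: "c \<noteq> 0 \<Longrightarrow> stereo p n e f (c *\<^sub>R x) = stereo p n e f x"
  by (simp add: stereo_def stereo_den_scaleR lor_simps)

text \<open>Rescaling both points to denominator one makes them equal by
  \<open>frame_null_eqI\<close>. The scaling factors then agree because points of
  \<open>Sinf\<close> have time component one.\<close>

lemma stereo_inject:
  assumes fr: "frame p n e f" and x: "x \<in> Sinf" "stereo_den p n x > 0" and y: "y \<in> Sinf" "stereo_den p n y > 0"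
    and eq: "stereo p n e f x = stereo p n e f y"
  shows "x = y"
proof -
  define a b where "a = inverse (stereo_den p n x)" and "b = inverse (stereo_den p n y)"
  have ab: "a > 0" "b > 0" using x y by (simp_all add: a_def b_def)
  have "a *\<^sub>R x = b *\<^sub>R y"
  proof (rule frame_null_eqI[OF fr])
    show "lor (a *\<^sub>R x) (a *\<^sub>R x) = 0" "lor (b *\<^sub>R y) (b *\<^sub>R y) = 0"
      using x y by (simp_all add: Sinf_def lor_simps)
    show "lor (a *\<^sub>R x) (p - n) = -2" "lor (b *\<^sub>R y) (p - n) = -2"
      using x(2) y(2) by (simp_all add: a_def b_def stereo_den_def lor.scaleR_left lor.minus_left field_simps)
    show "lor e (a *\<^sub>R x) = lor e (b *\<^sub>R y)" "lor f (a *\<^sub>R x) = lor f (b *\<^sub>R y)"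
      using eq by (simp_all add: stereo_def a_def b_def lor_simps mult.commute)
  qed
  moreover have "(a *\<^sub>R x) $ 1 = a" "(b *\<^sub>R y) $ 1 = b" using x y by (simp_all add: Sinf_def)
  ultimately have "a = b" by metis
  then show ?thesis using \<open>a *\<^sub>R x = b *\<^sub>R y\<close> ab by simp
qed

lemma smooth_on_stereo_den: "smooth_on UNIV (stereo_den p n)"
proof -
  have "smooth_on UNIV (\<lambda>x. lor x ((- 1 / 2) *\<^sub>R (p - n)))"
    by (intro smooth_on_lor smooth_on_id smooth_on_const open_UNIV)
  then show ?thesis by (simp add: stereo_den_def[abs_def] lor.scaleR_right lor.minus_right)
qed

lemma smooth_on_stereo:
  fixes g :: "'a::real_normed_vector \<Rightarrow> real^4"
  assumes g: "smooth_on U g" and "\<And>x. x \<in> U \<Longrightarrow> stereo_den p n (g x) \<noteq> 0"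
  shows "smooth_on U (\<lambda>x. stereo p n e f (g x))"
proof -
  have "smooth_on U (\<lambda>x. stereo_den p n (g x))"
    using smooth_on_compose[OF g smooth_on_stereo_den] by simp
  then show ?thesis unfolding stereo_def
    using assms smooth_on_openD[OF g]
    by (intro smooth_on_Pair smooth_on_mult smooth_on_inverse smooth_on_lor smooth_on_const)
qed

text \<open>Global parametrisation of the totally geodesic plane through \<open>p\<close> with
  tangent vectors \<open>e\<close> and \<open>f\<close>, inverse to orthogonal projection onto its
  tangent plane at \<open>p\<close>.\<close>

definition plane_point :: "real^4 \<Rightarrow> real^4 \<Rightarrow> real^4 \<Rightarrow> real \<times> real \<Rightarrow> real^4" where
  "plane_point p e f z = sqrt (1 + ((fst z)\<^sup>2 + (snd z)\<^sup>2)) *\<^sub>R p + (fst z *\<^sub>R e + snd z *\<^sub>R f)"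

lemma plane_point_H3:
  assumes "frame p n e f"
  shows "plane_point p e f z \<in> H3" "lor n (plane_point p e f z) = 0"
    "(lor e (plane_point p e f z), lor f (plane_point p e f z)) = z"
proof -
  have p: "p \<in> H3" and l: "lor p e = 0" "lor p f = 0" "lor e f = 0" "lor e e = 1" "lor f f = 1"
    "lor n e = 0" "lor n f = 0" "lor n p = 0" "lor e p = 0" "lor f p = 0" "lor f e = 0"
    using assms by (auto simp: frame_def orthopair_def lor_commute)
  define X where "X = fst z *\<^sub>R e + snd z *\<^sub>R f"
  have "lor X X = (fst z)\<^sup>2 + (snd z)\<^sup>2" "lor p X = 0"
    using l by (simp_all add: X_def lor_simps power2_eq_square)
  then show "plane_point p e f z \<in> H3" using H3_plane[OF p, of X] by (simp add: plane_point_def X_def)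
  show "lor n (plane_point p e f z) = 0" "(lor e (plane_point p e f z), lor f (plane_point p e f z)) = z"
    using l by (simp_all add: plane_point_def lor_simps)
qed

lemma plane_point_coords:
  assumes fr: "frame p n e f" and x: "x \<in> H3" "lor n x = 0"
  shows "plane_point p e f (lor e x, lor f x) = x"
proof -
  have p: "p \<in> H3" and l: "lor p e = 0" "lor p f = 0" "lor e f = 0" "lor e e = 1" "lor f f = 1"
    using fr by (auto simp: frame_def orthopair_def)
  define X where "X = lor e x *\<^sub>R e + lor f x *\<^sub>R f"
  define a where "a = - lor p x"
  have xe: "x = a *\<^sub>R p + X"
    using frame_expansion_and_det(1)[OF fr, of x] x(2) by (simp add: X_def a_def algebra_simps)
  have XX: "lor X X = (lor e x)\<^sup>2 + (lor f x)\<^sup>2" and pX: "lor p X = 0"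
    using l by (simp_all add: X_def lor_simps lor_commute[of f e] power2_eq_square)
  have "lor x x = - a\<^sup>2 + lor X X"
    unfolding xe using pX H3_lor[OF p] by (simp add: lor_simps lor_commute[of X p] power2_eq_square)
  then have a2: "a\<^sup>2 = 1 + lor X X" using H3_lor[OF x(1)] by simp
  \<comment> \<open>The norm determines \<open>a\<close> only up to sign; a negative
    \<open>a\<close> would place \<open>- x\<close> in \<open>H3\<close>.\<close>
  have "a \<ge> 0"
  proof (rule ccontr)
    assume "\<not> a \<ge> 0"
    then have "sqrt (1 + lor X X) = - a" unfolding a2[symmetric] by (simp add: real_sqrt_abs)
    then have "- x = sqrt (1 + lor (- X) (- X)) *\<^sub>R p + (- X)" unfolding xe by (simp add: lor_simps)
    then have "- x \<in> H3" using H3_plane[OF p, of "- X"] pX by (simp add: lor_simps)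
    then show False using H3_pos[OF x(1)] H3_pos by fastforce
  qed
  then have "sqrt (1 + ((lor e x)\<^sup>2 + (lor f x)\<^sup>2)) = a"
    using a2 XX by (intro real_sqrt_unique) simp_all
  then show ?thesis using xe[symmetric] by (simp only: plane_point_def X_def fst_conv snd_conv)
qed

lemma smooth_on_plane_point: "smooth_on UNIV (plane_point p e f)"
proof -
  have fs: "smooth_on UNIV (fst :: real \<times> real \<Rightarrow> real)" "smooth_on UNIV (snd :: real \<times> real \<Rightarrow> real)"
    by (intro smooth_on_linear bounded_linear_fst bounded_linear_snd open_UNIV)+
  have "1 + ((fst z)\<^sup>2 + (snd z)\<^sup>2) > 0" for z :: "real \<times> real" by (intro add_pos_nonneg) auto
  then show ?thesis unfolding plane_point_def[abs_def] power2_eq_square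
    by (intro smooth_on_add smooth_on_scaleR smooth_on_sqrt smooth_on_mult smooth_on_const fs open_UNIV) auto
qed

section \<open>The Gauss maps of the leaf space\<close>

context geodesic_foliation
begin

lemma gauss_bivec:
  assumes "\<epsilon>\<^sup>2 = 1" "p \<in> H3"
  shows "gauss \<epsilon> (bivec p) = project (p + \<epsilon> *\<^sub>R V p)"
proof -
  obtain \<gamma> where \<gamma>: "unit_geod \<gamma>" "\<gamma> 0 = p" "\<And>t. vel \<gamma> t = V (\<gamma> t)" "pl \<gamma> = bivec p"
    using leaf_through[OF assms(2)] by blast
  from gauss_pl[OF assms(1) \<gamma>(1)] show ?thesis by (simp add: \<gamma>)
qed

lemma gauss_Sinf: "\<epsilon>\<^sup>2 = 1 \<Longrightarrow> p \<in> H3 \<Longrightarrow> gauss \<epsilon> (bivec p) \<in> Sinf"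
  using project_Sinf[OF null_lor, OF orthopair_sign[OF orthopair_V]] null_pos[OF orthopair_sign[OF orthopair_V]]
  by (simp add: gauss_bivec less_imp_neq[THEN not_sym])

text \<open>On a leaf through \<open>q\<close>, \<open>V q\<close> is recovered from \<open>m = bivec q\<close> as \<open>ctr m q\<close>.\<close>

lemma smooth_map_gauss:
  assumes \<epsilon>: "\<epsilon>\<^sup>2 = 1" and U: "U \<subseteq> leaf_space V"
  shows "smooth_map U (gauss \<epsilon>)"
  unfolding smooth_map_def
proof
  fix m assume "m \<in> U"
  then obtain p where p: "p \<in> H3" "m = bivec p" using U leaf_space_eq by blast
  define N where "N = V p"
  note o = orthopairD[OF orthopair_V[OF p(1)]]
  define F where "F m = lift N m + \<epsilon> *\<^sub>R ctr m (lift N m)" for m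
  have sF: "smooth_on (lift_dom N) F"
    unfolding F_def[abs_def]
    by (intro smooth_on_add smooth_on_scaleR smooth_on_ctr smooth_on_lift smooth_on_const smooth_on_id open_lift_dom)
  define W where "W = lift_dom N \<inter> F -` {x. x $ 1 > 0}"
  have "open {x::real^4. x $ 1 > 0}"
    by (intro open_Collect_less continuous_on_const continuous_on_component continuous_on_id)
  then have W: "open W" unfolding W_def
    by (intro continuous_open_preimage smooth_on_imp_continuous_on[OF sF] open_lift_dom)
  have sW: "smooth_on W (\<lambda>m. project (F m))"
    by (rule smooth_on_project[OF smooth_on_subset[OF sF W]]) (auto simp: W_def)
  have Fq: "F m' = lift N m' + \<epsilon> *\<^sub>R V (lift N m')" if "m' \<in> leaf_space V" "m' \<in> lift_dom N" for m'
  proof -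
    note l = lift_leaf[OF that]
    have "ctr m' (lift N m') = V (lift N m')"
      using orthopairD[OF orthopair_V[OF l(1)]] by (subst l(3)[symmetric]) (simp add: bivec_def ctr_wedge)
    then show ?thesis by (simp add: F_def)
  qed
  have "m \<in> W"
  proof -
    have "m \<in> leaf_space V" "m \<in> lift_dom N"
      using p leaf_space_eq lift_bivec(1)[OF p(1), of N] o by (auto simp: N_def)
    moreover from this have "F m $ 1 > 0"
      unfolding Fq[OF calculation] by (intro null_pos orthopair_sign[OF orthopair_V \<epsilon>] lift_leaf)
    ultimately show ?thesis by (simp add: W_def)
  qed
  moreover have "project (F m') = gauss \<epsilon> m'" if "m' \<in> W \<inter> U" for m'
  proof -
    have m': "m' \<in> leaf_space V" "m' \<in> lift_dom N" using that U by (auto simp: W_def)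
    note l = lift_leaf[OF m']
    show ?thesis using gauss_bivec[OF \<epsilon> l(1)] l(3) Fq[OF m'] by simp
  qed
  ultimately show "\<exists>W g. m \<in> W \<and> smooth_on W g \<and> (\<forall>y\<in>W \<inter> U. g y = gauss \<epsilon> y)"
    using sW by blast
qed

text \<open>If the sum vanished, a curve of leaves with nonzero velocity \<open>dbivec p X\<close>
  would have an image of zero velocity at infinity. The smooth local inverse would carry this back
  to zero velocity.\<close>

lemma local_diffeo_imp:
  assumes \<epsilon>: "\<epsilon>\<^sup>2 = 1" and ld: "local_diffeo (leaf_space V) Sinf (gauss \<epsilon>)"
    and p: "p \<in> H3" and X: "X \<in> perp p" "X \<noteq> 0"
  shows "X + \<epsilon> *\<^sub>R dV p X \<noteq> 0"
proof
  assume zero: "X + \<epsilon> *\<^sub>R dV p X = 0"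
  have m: "bivec p \<in> leaf_space V" using p leaf_space_eq by blast
  then obtain U where U: "openin (top_of_set (leaf_space V)) U" "bivec p \<in> U" "inj_on (gauss \<epsilon>) U"
    "smooth_map (gauss \<epsilon> ` U) (inv_into U (gauss \<epsilon>))"
    using ld unfolding local_diffeo_def by blast
  obtain W h where W: "gauss \<epsilon> (bivec p) \<in> W" "smooth_on W h"
    "\<And>y. y \<in> W \<inter> gauss \<epsilon> ` U \<Longrightarrow> h y = inv_into U (gauss \<epsilon>) y"
    using bspec[OF U(4)[unfolded smooth_map_def] imageI[OF U(2)]] by blast
  obtain T where T: "open T" "U = leaf_space V \<inter> T" using U(1) by (auto simp: openin_open)
  obtain c where c: "\<And>s::real. c s \<in> H3" "c 0 = p" "(c has_vector_derivative X) (at 0)"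
    using H3_curve[OF orthopair_V[OF p], of X] X by (auto simp: perp_def)
  define C where "C s = bivec (c s)" for s
  define G where "G s = gauss \<epsilon> (C s)" for s
  have dC: "(C has_vector_derivative dbivec p X) (at 0)"
    unfolding C_def[abs_def] dbivec_def by (rule bivec_curve_derivative) (use c in auto)
  have dc: "((\<lambda>s. c s + \<epsilon> *\<^sub>R V (c s)) has_vector_derivative X + \<epsilon> *\<^sub>R dV p X) (at 0)"
  proof -
    have "((\<lambda>s. V (c s)) has_vector_derivative dV p X) (at 0)"
      by (rule V_curve_derivative) (use c in auto)
    then show ?thesis by (auto intro!: derivative_eq_intros c(3))
  qed
  obtain D where D: "(project has_derivative D) (at (c 0 + \<epsilon> *\<^sub>R V (c 0)))"
  proof -
    have "open {x::real^4. x $ 1 > 0}"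
      by (intro open_Collect_less continuous_on_const continuous_on_component continuous_on_id)
    then have s: "smooth_on {x::real^4. x $ 1 > 0} (\<lambda>x. project x)"
      by (intro smooth_on_project smooth_on_id) auto
    obtain D where "\<And>x. x \<in> {x. x $ 1 > 0} \<Longrightarrow> (project has_derivative D x) (at x)"
      using smooth_on_derivative[OF s] by metis
    then show ?thesis using that null_pos[OF orthopair_sign[OF orthopair_V \<epsilon>]] c(1) by blast
  qed
  have dG: "(G has_vector_derivative 0) (at 0)"
    using vector_derivative_diff_chain_within[OF dc has_derivative_at_withinI[OF D]] zero
      linear_0[OF has_derivative_linear[OF D]]
    by (simp add: G_def[abs_def] C_def gauss_bivec[OF \<epsilon> c(1)] o_def)
  have G0: "G 0 \<in> W" using W(1) c(2) by (simp add: G_def C_def)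
  obtain Dh where Dh: "(h has_derivative Dh) (at (G 0))"
    using smooth_on_derivative[OF W(2)] G0 by metis
  have dhG: "((\<lambda>s. h (G s)) has_vector_derivative 0) (at 0)"
    using vector_derivative_diff_chain_within[OF dG has_derivative_at_withinI[OF Dh]]
      linear_0[OF has_derivative_linear[OF Dh]] by (simp add: o_def)
  have "isCont C 0" "isCont G 0" using dC dG has_vector_derivative_continuous by blast+
  then have ev: "eventually (\<lambda>s. C s \<in> T) (nhds 0)" "eventually (\<lambda>s. G s \<in> W) (nhds 0)"
    using topological_tendstoD[of C _ "at 0" T] topological_tendstoD[of G _ "at 0" W] T U(2) c(2)
      smooth_on_openD[OF W(2)] G0
    by (auto simp: isCont_def eventually_nhds_conv_at C_def)
  have "eventually (\<lambda>s. h (G s) = C s) (nhds 0)"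
    using ev
  proof eventually_elim
    case (elim s)
    then have "C s \<in> U" using c(1) T(2) by (auto simp: C_def leaf_space_eq)
    then show ?case using W(3)[of "G s"] elim U(3) by (simp add: G_def)
  qed
  then obtain S where S: "open S" "0 \<in> S" "\<And>s. s \<in> S \<Longrightarrow> h (G s) = C s"
    unfolding eventually_nhds by blast
  have "(C has_vector_derivative 0) (at 0)"
    by (rule has_vector_derivative_transform_within_open[OF dhG S])
  then have "dbivec p X = 0" using dC vector_derivative_unique_at by blast
  then show False using dbivec_eq_0_iff[OF p X(1)] X(2) by simp
qed

text \<open>Leaves are charted by their intersection with the plane through \<open>p\<close>
  orthogonal to \<open>V p\<close>, endpoints by stereographic coordinates. In these charts the
  differential at \<open>bivec p\<close> is
  \<open>X \<mapsto> X + \<epsilon> *\<^sub>R dV p X\<close> read in the frame \<open>e\<close>,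
  \<open>f\<close>.\<close>

lemma local_diffeoI:
  assumes \<epsilon>: "\<epsilon>\<^sup>2 = 1" and nz: "\<And>p X. p \<in> H3 \<Longrightarrow> X \<in> perp p \<Longrightarrow> X \<noteq> 0 \<Longrightarrow> X + \<epsilon> *\<^sub>R dV p X \<noteq> 0"
  shows "local_diffeo (leaf_space V) Sinf (gauss \<epsilon>)"
  unfolding local_diffeo_def
proof (intro conjI ballI)
  show "gauss \<epsilon> ` leaf_space V \<subseteq> Sinf" using gauss_Sinf[OF \<epsilon>] by (auto simp: leaf_space_eq)
  fix m assume "m \<in> leaf_space V"
  then obtain p where p: "p \<in> H3" "m = bivec p" using leaf_space_eq by blast
  obtain e f where fr: "frame p (V p) e f" using frame_exists[OF orthopair_V[OF p(1)]] by blast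
  \<comment> \<open>\<open>p + n\<close> and \<open>p - n\<close> are the null directions of the two
    ends of the leaf through \<open>p\<close>; the chart around the first projects from the
    second.\<close>
  define n where "n = \<epsilon> *\<^sub>R V p"
  have fr': "frame p n e f"
    using fr orthopair_sign[OF _ \<epsilon>, of p "V p"] by (simp add: frame_def n_def lor_simps)
  note o = orthopairD[OF orthopair_V[OF p(1)]]
  define q where "q = plane_point p e f"
  have q: "q z \<in> H3" "lor (V p) (q z) = 0" "(lor e (q z), lor f (q z)) = z" for z
    using plane_point_H3[OF fr, of z] by (simp_all add: q_def)
  have q0: "q 0 = p" by (simp add: q_def plane_point_def)
  have sq: "smooth_on UNIV q" unfolding q_def by (rule smooth_on_plane_point)
  have sVq: "smooth_on UNIV (\<lambda>z. V (q z))" by (rule smooth_on_V[OF sq]) (use q(1) in blast)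
  define y where "y z = q z + \<epsilon> *\<^sub>R V (q z)" for z
  have sy: "smooth_on UNIV y"
    unfolding y_def[abs_def] by (intro smooth_on_add smooth_on_scaleR smooth_on_const sq sVq open_UNIV)
  have oy: "orthopair (q z) (\<epsilon> *\<^sub>R V (q z))" for z by (rule orthopair_sign[OF orthopair_V[OF q(1)] \<epsilon>])
  have ypos: "y z $ 1 > 0" for z unfolding y_def by (rule null_pos[OF oy])
  have gq: "gauss \<epsilon> (bivec (q z)) = (1 / y z $ 1) *\<^sub>R y z" for z
    using gauss_bivec[OF \<epsilon> q(1)] by (simp add: y_def project_def)
  define den where "den = stereo_den p n"
  define st where "st = stereo p n e f"
  \<comment> \<open>The first condition makes \<open>lift\<close> invert
    \<open>bivec \<circ> q\<close>; the second keeps the endpoint away from the centre of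
    projection.\<close>
  define D where "D = {z. lor (V p) (V (q z)) > 0} \<inter> {z. den (y z) > 0}"
  have sden: "smooth_on UNIV (\<lambda>z. den (y z))"
    unfolding den_def using smooth_on_compose[OF sy smooth_on_stereo_den] by simp
  have openD: "open D"
    unfolding D_def
    by (intro open_Int open_Collect_less continuous_on_const smooth_on_imp_continuous_on[OF sden]
        smooth_on_imp_continuous_on[OF smooth_on_lor[OF smooth_on_const[OF open_UNIV] sVq]])
  have y0: "y 0 = p + n" by (simp add: y_def q0 n_def)
  have lp: "lor p p = -1" "lor n n = 1" "lor p n = 0" "lor n p = 0" "lor e p = 0" "lor e n = 0" "lor f p = 0" "lor f n = 0"
    using fr' o(2) by (auto simp: frame_def orthopair_def lor_commute)
  \<comment> \<open>The factor in \<open>stereo_den\<close> is chosen for this value: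
    \<open>lor (p + n) (p - n) = -2\<close>.\<close>
  have den0: "den (y 0) = 1" using lp by (simp add: y0 den_def stereo_den_def lor_simps)
  have D0: "0 \<in> D" using o den0 by (simp add: D_def q0)
  define G where "G z = st (y z)" for z
  have sG: "smooth_on D G"
    unfolding G_def[abs_def] st_def
    by (rule smooth_on_stereo[OF smooth_on_subset[OF sy openD]]) (auto simp: D_def den_def)
  obtain DG where DG: "(G has_derivative DG) (at 0)"
    using smooth_on_derivative[OF sG] D0 by metis
  have DG_inj: "w = 0" if "DG w = 0" for w
  proof -
    define X where "X = fst w *\<^sub>R e + snd w *\<^sub>R f"
    have X: "X \<in> perp p" using fr by (simp add: X_def perp_def frame_def lor_simps)
    have dq: "((\<lambda>s. q (s *\<^sub>R w)) has_vector_derivative X) (at 0)"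
      unfolding q_def plane_point_def X_def by (auto intro!: derivative_eq_intros)
    have dVq: "((\<lambda>s. V (q (s *\<^sub>R w))) has_vector_derivative dV p X) (at 0)"
      using q(1) q0 dq by (intro V_curve_derivative) auto
    define Z where "Z = X + \<epsilon> *\<^sub>R dV p X"
    have Zp: "Z \<in> perp p" using X dV_perp[OF p(1) X] by (simp add: Z_def perp_def lor_simps)
    have dy: "((\<lambda>s. y (s *\<^sub>R w)) has_vector_derivative Z) (at 0)"
      unfolding y_def Z_def by (auto intro!: derivative_eq_intros dq dVq)
    have dl: "((\<lambda>s. lor a (y (s *\<^sub>R w))) has_real_derivative lor a Z) (at 0)" for a
      using bounded_linear.has_vector_derivative[OF lor.bounded_linear_right dy]
      by (simp add: has_real_derivative_iff_has_vector_derivative)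
    have dden: "((\<lambda>s. den (y (s *\<^sub>R w))) has_real_derivative (- lor (p - n) Z / 2)) (at 0)"
      unfolding den_def stereo_den_def lor_commute[of "y _"] by (auto intro!: derivative_eq_intros dl)
    \<comment> \<open>The derivative of the denominator drops out because the numerator vanishes at
      \<open>y 0 = p + n\<close>.\<close>
    have dst: "((\<lambda>s. lor a (y (s *\<^sub>R w)) * inverse (den (y (s *\<^sub>R w)))) has_real_derivative lor a Z) (at 0)"
      if "lor a (p + n) = 0" for a
      using that den0 by (auto intro!: derivative_eq_intros dl dden simp: y0)
    have "((\<lambda>s. G (s *\<^sub>R w)) has_vector_derivative (lor e Z, lor f Z)) (at 0)"
      unfolding G_def st_def stereo_def den_def[symmetric]
      using dst[of e] dst[of f] lp
      by (intro has_vector_derivative_Pair) (simp_all add: has_real_derivative_iff_has_vector_derivative lor_simps)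
    moreover have "((\<lambda>s. G (s *\<^sub>R w)) has_vector_derivative DG w) (at 0)"
    proof -
      have "((\<lambda>s::real. s *\<^sub>R w) has_vector_derivative w) (at 0)" by (auto intro!: derivative_eq_intros)
      from vector_derivative_diff_chain_within[OF this, of G DG] DG show ?thesis
        by (simp add: o_def has_derivative_at_withinI)
    qed
    ultimately have "(lor e Z, lor f Z) = 0" using that vector_derivative_unique_at by metis
    then have "Z = 0" using frame_expansion[OF fr, of Z] Zp by (simp add: perp_def zero_prod_def)
    then have "X = 0" using nz[OF p(1) X] by (auto simp: Z_def)
    then have "lor e X = 0" "lor f X = 0" by (simp_all add: lor.zero_right)
    then show "w = 0"
      using fr by (simp add: X_def frame_def lor_simps lor_commute[of f e] prod_eq_iff)
  qed
  obtain O' P g where IFT: "open O'" "O' \<subseteq> D" "0 \<in> O'" "open P" "homeomorphism O' P G g" "smooth_on P g"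
    using smooth_local_inverse[OF sG D0 DG DG_inj] by blast
  have hom: "\<And>z. z \<in> O' \<Longrightarrow> G z \<in> P \<and> g (G z) = z" "\<And>w. w \<in> P \<Longrightarrow> g w \<in> O' \<and> G (g w) = w"
    using IFT(5) unfolding homeomorphism_def by auto
  define U where "U = (\<lambda>z. bivec (q z)) ` O'"
  \<comment> \<open>\<open>st\<close> and the sign of \<open>den\<close> ignore positive factors, so
    normalising \<open>y z\<close> to a point of \<open>Sinf\<close> does not affect membership in
    this open set.\<close>
  define W where "W = {x. den x > 0} \<inter> st -` P"
  have st_proj: "st ((1 / y z $ 1) *\<^sub>R y z) = G z" "den ((1 / y z $ 1) *\<^sub>R y z) = den (y z) / y z $ 1" for z
    using ypos[of z] by (simp_all add: st_def den_def stereo_scaleR stereo_den_scaleR G_def)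
  have sst: "smooth_on {x. den x > 0} (\<lambda>x. st x)"
    unfolding st_def den_def
    by (intro smooth_on_stereo smooth_on_id open_Collect_less continuous_on_const
        smooth_on_imp_continuous_on[OF smooth_on_stereo_den]) auto
  have openW: "open W"
    unfolding W_def using continuous_open_preimage smooth_on_imp_continuous_on[OF sst] smooth_on_openD[OF sst] IFT(4)
    by simp
  have gW: "gauss \<epsilon> (bivec (q z)) \<in> W" "st (gauss \<epsilon> (bivec (q z))) = G z" if "z \<in> O'" for z
  proof -
    have "den (y z) > 0" using that IFT(2) by (auto simp: D_def)
    then show "gauss \<epsilon> (bivec (q z)) \<in> W" "st (gauss \<epsilon> (bivec (q z))) = G z"
      using hom(1)[OF that] ypos[of z] by (simp_all add: W_def gq st_proj)
  qed
  \<comment> \<open>Open conditions on the matrix, expressed through \<open>lift\<close>, which make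
    \<open>U\<close> relatively open.\<close>
  have U_eq: "U = leaf_space V \<inter> (lift_dom (V p) \<inter> (\<lambda>m. (lor e (lift (V p) m), lor f (lift (V p) m))) -` O')"
    (is "_ = leaf_space V \<inter> ?T")
  proof (intro equalityI subsetI)
    fix m' assume "m' \<in> U"
    then obtain z where z: "z \<in> O'" "m' = bivec (q z)" by (auto simp: U_def)
    then have "lor (V p) (V (q z)) > 0" using IFT(2) by (auto simp: D_def)
    from lift_bivec[OF q(1,2) this] show "m' \<in> leaf_space V \<inter> ?T"
      using z q(1,3)[of z] by (auto simp: leaf_space_eq)
  next
    fix m' assume m': "m' \<in> leaf_space V \<inter> ?T"
    then have l: "lift (V p) m' \<in> H3" "lor (V p) (lift (V p) m') = 0" "bivec (lift (V p) m') = m'"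
      using lift_leaf by blast+
    then show "m' \<in> U"
      using plane_point_coords[OF fr l(1,2)] m' unfolding U_def q_def
      by (intro image_eqI[of _ _ "(lor e (lift (V p) m'), lor f (lift (V p) m'))"]) auto
  qed
  have inj: "inj_on (gauss \<epsilon>) U"
  proof (rule inj_onI)
    fix a b assume "a \<in> U" "b \<in> U" and eq: "gauss \<epsilon> a = gauss \<epsilon> b"
    then obtain z w where zw: "z \<in> O'" "a = bivec (q z)" "w \<in> O'" "b = bivec (q w)" by (auto simp: U_def)
    then have "G z = G w" using gW(2) eq by metis
    then have "z = w" using hom(1) zw by metis
    then show "a = b" using zw by simp
  qed
  have image: "gauss \<epsilon> ` U = Sinf \<inter> W"
  proof (intro equalityI subsetI)
    fix x assume "x \<in> gauss \<epsilon> ` U"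
    then show "x \<in> Sinf \<inter> W" using gW(1) gauss_Sinf[OF \<epsilon> q(1)] by (auto simp: U_def)
  next
    fix x assume x: "x \<in> Sinf \<inter> W"
    \<comment> \<open>The leaf is found from the stereographic coordinates of \<open>x\<close>;
      injectivity of the chart on \<open>Sinf\<close> then identifies its endpoint with
      \<open>x\<close>.\<close>
    define z where "z = g (st x)"
    have z: "z \<in> O'" "G z = st x" using x hom(2) by (auto simp: z_def W_def)
    have "x = gauss \<epsilon> (bivec (q z))"
    proof (rule stereo_inject[OF fr'])
      show "x \<in> Sinf" "stereo_den p n x > 0" using x by (simp_all add: W_def den_def)
      show "gauss \<epsilon> (bivec (q z)) \<in> Sinf" by (rule gauss_Sinf[OF \<epsilon> q(1)])
      show "stereo_den p n (gauss \<epsilon> (bivec (q z))) > 0" using gW(1)[OF z(1)] by (simp add: W_def den_def)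
      show "stereo p n e f x = stereo p n e f (gauss \<epsilon> (bivec (q z)))"
        using gW(2)[OF z(1)] z(2) by (simp add: st_def)
    qed
    then show "x \<in> gauss \<epsilon> ` U" using z(1) by (auto simp: U_def)
  qed
  have "openin (top_of_set (leaf_space V)) U"
  proof -
    have "smooth_on (lift_dom (V p)) (\<lambda>m. (lor e (lift (V p) m), lor f (lift (V p) m)))"
      by (intro smooth_on_Pair smooth_on_lor smooth_on_const smooth_on_lift open_lift_dom)
    then have "open ?T"
      by (intro continuous_open_preimage smooth_on_imp_continuous_on open_lift_dom IFT(1))
    then show ?thesis unfolding U_eq by (rule openin_open_Int)
  qed
  moreover have "m \<in> U" using IFT(3) q0 p(2) by (auto simp: U_def intro!: image_eqI[of _ _ 0])
  moreover have "openin (top_of_set Sinf) (gauss \<epsilon> ` U)"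
    unfolding image by (rule openin_open_Int[OF openW])
  moreover have "smooth_map U (gauss \<epsilon>)" by (rule smooth_map_gauss[OF \<epsilon>]) (simp add: U_eq)
  moreover have "smooth_map (gauss \<epsilon> ` U) (inv_into U (gauss \<epsilon>))"
    unfolding smooth_map_def
  proof
    fix x assume x: "x \<in> gauss \<epsilon> ` U"
    have s1: "smooth_on W (\<lambda>x. g (st x))"
      by (rule smooth_on_compose[OF smooth_on_subset[OF sst openW] IFT(6)]) (auto simp: W_def)
    have "smooth_on W (\<lambda>x. q (g (st x)))" by (rule smooth_on_compose[OF s1 sq]) simp
    then have "smooth_on W (\<lambda>x. bivec (q (g (st x))))" by (rule smooth_on_bivec) (use q(1) in blast)
    moreover have "bivec (q (g (st x'))) = inv_into U (gauss \<epsilon>) x'" if x': "x' \<in> gauss \<epsilon> ` U" for x'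
    proof -
      obtain z where z: "z \<in> O'" "x' = gauss \<epsilon> (bivec (q z))" using x' by (auto simp: U_def)
      then have "g (st x') = z" using gW(2) hom(1) by simp
      moreover have "bivec (q z) \<in> U" using z(1) by (auto simp: U_def)
      ultimately show ?thesis using z(2) inj by simp
    qed
    moreover have "x \<in> W" using x image by auto
    ultimately show "\<exists>W h. x \<in> W \<and> smooth_on W h \<and> (\<forall>x'\<in>W \<inter> gauss \<epsilon> ` U. h x' = inv_into U (gauss \<epsilon>) x')"
      by (intro exI[of _ W] exI[of _ "\<lambda>x. bivec (q (g (st x)))"]) auto
  qed
  ultimately show "\<exists>U. openin (top_of_set (leaf_space V)) U \<and> m \<in> U \<and>
      openin (top_of_set Sinf) (gauss \<epsilon> ` U) \<and> inj_on (gauss \<epsilon>) U \<and> smooth_map U (gauss \<epsilon>) \<and>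
      smooth_map (gauss \<epsilon> ` U) (inv_into U (gauss \<epsilon>))"
    using inj by blast
qed

lemma semi_nondegenerate_iff:
  "semi_nondegenerate V \<longleftrightarrow>
    (\<forall>p\<in>H3. \<forall>X\<in>perp p. X \<noteq> 0 \<longrightarrow> dV p X \<noteq> X \<and> dV p X \<noteq> - X)"
proof -
  have "local_diffeo (leaf_space V) Sinf (gauss \<epsilon>) \<longleftrightarrow>
      (\<forall>p\<in>H3. \<forall>X\<in>perp p. X \<noteq> 0 \<longrightarrow> X + \<epsilon> *\<^sub>R dV p X \<noteq> 0)" if "\<epsilon>\<^sup>2 = 1" for \<epsilon>
    using local_diffeo_imp[OF that] local_diffeoI[OF that] by blast
  note * = this[of 1, simplified] this[of "-1", simplified]
  have "X + Y = 0 \<longleftrightarrow> Y = - X" for X Y :: "real^4" by (simp add: add_eq_0_iff)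
  then show ?thesis unfolding semi_nondegenerate_def gauss_maps * by (simp only: eq_commute[of _ "dV _ _"]) blast
qed

end

theorem theorem4p3:
  fixes V :: "real^4 \<Rightarrow> real^4"
  assumes "geod_foliation V"
  shows "(semi_nondegenerate V \<longleftrightarrow> semidefinite (leaf_space V)) \<and>
         (nondegenerate V \<longleftrightarrow> gx_definite_on (leaf_space V))"
proof -
  interpret geodesic_foliation V by unfold_locales (rule assms)
  show ?thesis
    unfolding semi_nondegenerate_iff semidefinite_iff nondegenerate_iff gx_definite_on_iff by simp
qed

end
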